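(* Let $f:S^n\to S^m$ be an LOMSE with associated angle $\theta$, and consider its LOC segment $\{(r,\tan\theta\cdot r): r\in(0,1]\}$ in the quotient space $\{(r,\rho): r>0,\ \rho\in\mathbb R\}$ with the canonical metric $$g_0=\sigma_0^2\,(r^2+\lambda^2\rho^2)^p\, r^{2(n-p)}\,(dr^2+d\rho^2).$$ Then the LOC segment is stable if and only if $f$ is of Type (I), and it is unstable if and only if $f$ is of Type (II).
   Context: **Lawson–Osserman maps.** A smooth map $f:S^n\to S^m$ between unit spheres is a Lawson–Osserman map (LOM) if there is an acute angle $\theta\in(0,\pi/2)$ such that $M_{f,\theta}=\{(\cos\theta\, x,\ \sin\theta\, f(x)): x\in S^n\}$ is a minimal submanifold of the unit sphere $S^{m+n+1}\subset\mathbb R^{m+n+2}$. The cone over $M_{f,\theta}$ is the associated Lawson–Osserman cone (LOC). **LOMSE.** An LOM $f$ is an LOMSE if at each $x\in S^n$ all nonzero singular values of the differential $(f_* )_x:T_xS^n\to T_{f(x)}S^m$ (with respect to the standard round metrics) are equal, i.e. the set of singular values is $\{0,\lambda\}$ with $\lambda>0$. For an LOMSE it is known that $\lambda$ and the multiplicity $p$ of $\lambda$ (so $0$ has multiplicity $n-p>0$) do not depend on $x$; that $f=i\circ\pi$ where $\pi$ is a Hopf fibration from $S^n$ onto a complex, quaternionic or octonionic projective space $(\mathbb P^p,h)$ of real dimension $p$ and $i:(\mathbb P^p,\lambda^2h)\to S^m$ is a minimal isometric immersion; and that the $m+1$ components of $f$ are spherical harmonics of a common even degree $k$, with $\lambda=\sqrt{k(k+n-1)/p}$.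 One says $f$ is of $(n,p,k)$-type. The angle is then determined by $\tan^2\theta=\dfrac{p-n\lambda^{-2}}{n-p}$. **Types.** $f$ is of Type (I) if $(n,p,k)\in\{(3,2,2),(5,4,2),(5,4,4)\}$ or $n\ge 7$. $f$ is of Type (II) if $(n,p)=(3,2)$ and $k\ge 4$, or $(n,p)=(5,4)$ and $k\ge 6$. (The degree $k$ is a positive even integer and $n$ is odd.) **Quotient space.** $\sigma_0$ denotes the volume of the unit sphere $S^n$. The point $(r,\rho)$ represents the $n$-dimensional submanifold $\{(rx,\rho f(x)): x\in S^n\}$ of $\mathbb R^{m+n+2}$. The LOC curve $\{\rho=\tan\theta\cdot r,\ r>0\}$ represents the LOC and is a geodesic of $g_0$; the LOC segment is its part with $r\in(0,1]$ (open at the origin). **Stability.** The LOC segment is stable if the second variation of $g_0$-length is nonnegative for every variation compactly supported in the interior $\{0<r<1\}$ of the segment, and unstable if it is negative for some such variation. *)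

theory Defs
  imports "HOL-Analysis.Analysis"
begin

section \<open>Smooth maps defined on unit spheres\<close>

primrec Ck_on :: "nat \<Rightarrow> ('a::real_normed_vector \<Rightarrow> 'b::real_normed_vector) \<Rightarrow> 'a set \<Rightarrow> bool" where
  "Ck_on 0 f S \<longleftrightarrow> continuous_on S f"
| "Ck_on (Suc k) f S \<longleftrightarrow>
     f differentiable_on S \<and> (\<forall>v. Ck_on k (\<lambda>x. frechet_derivative f (at x) v) S)"

text \<open>Only meant for open sets \<open>S\<close>.\<close>

definition smooth_on :: "'a set \<Rightarrow> ('a::real_normed_vector \<Rightarrow> 'b::real_normed_vector) \<Rightarrow> bool" where
  "smooth_on S f \<longleftrightarrow> (\<forall>k. Ck_on k f S)"

text \<open>
  The sphere \<open>S\<^sup>n\<close> is \<open>sphere 0 1\<close> in a Euclidean space of dimension \<open>n + 1\<close>. A map on the sphere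
  is differentiated through its extension that is constant along rays. It is smooth on the sphere
  iff this extension is smooth off the origin, and the derivative of the extension at a point
  \<open>x\<close> of the sphere restricts to the differential on the tangent space and vanishes on the normal
  direction. The values of the map off the sphere are irrelevant.
\<close>

definition radial_ext :: "('a::euclidean_space \<Rightarrow> 'b::euclidean_space) \<Rightarrow> 'a \<Rightarrow> 'b" where
  "radial_ext F y = F (y /\<^sub>R norm y)"

definition smooth_on_sphere :: "('a::euclidean_space \<Rightarrow> 'b::euclidean_space) \<Rightarrow> bool" where
  "smooth_on_sphere F \<longleftrightarrow> smooth_on (- {0}) (radial_ext F)"

definition tangent_sphere :: "'a::euclidean_space \<Rightarrow> 'a set" where
  "tangent_sphere x = {v. v \<bullet> x = 0}"

definition sphere_diff :: "('a::euclidean_space \<Rightarrow> 'b::euclidean_space) \<Rightarrow> 'a \<Rightarrow> 'a \<Rightarrow> 'b" where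
  "sphere_diff F x v = frechet_derivative (radial_ext F) (at x) v"

text \<open>
  For \<open>u\<close> tangent at \<open>x\<close>, \<open>sphere_diff2 F x u u\<close> is the acceleration at \<open>t = 0\<close> of the curve
  \<open>F ((x + t u) / \<parallel>x + t u\<parallel>)\<close>, whose initial velocity is \<open>sphere_diff F x u\<close>.
\<close>

definition sphere_diff2 :: "('a::euclidean_space \<Rightarrow> 'b::euclidean_space) \<Rightarrow> 'a \<Rightarrow> 'a \<Rightarrow> 'a \<Rightarrow> 'b" where
  "sphere_diff2 F x u v = frechet_derivative (\<lambda>y. frechet_derivative (radial_ext F) (at y) u) (at x) v"

section \<open>Minimality in a unit sphere\<close>

text \<open>
  \<open>F\<close> maps the sphere into a unit sphere, and \<open>H\<close> is a subspace of the tangent space at \<open>x\<close> on which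
  the differential of \<open>F\<close> is injective, with the same image as the whole tangent space. The
  second fundamental form of the image of \<open>F\<close> (as a submanifold of the unit sphere) in the normal
  direction \<open>\<nu>\<close>, pulled back to \<open>H\<close>, is \<open>\<lambda>u v. sphere_diff2 F x u v \<bullet> \<nu>\<close>, and the mean curvature
  vector is zero iff its trace with respect to the induced metric is zero for all normal \<open>\<nu>\<close>.
  For an immersion of the sphere itself, \<open>H\<close> is the tangent space. For an immersion \<open>i\<close> of the base
  of a Riemannian submersion \<open>\<pi>\<close> of the sphere, take \<open>F = i \<circ> \<pi>\<close> and \<open>H\<close> the horizontal space.
\<close>

definition induced_onb :: "('a::euclidean_space \<Rightarrow> 'b::euclidean_space) \<Rightarrow> 'a \<Rightarrow> 'a set \<Rightarrow> 'a set \<Rightarrow> bool" where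
  "induced_onb F x H B \<longleftrightarrow> B \<subseteq> H \<and> span B = H \<and>
     (\<forall>u\<in>B. \<forall>v\<in>B. sphere_diff F x u \<bullet> sphere_diff F x v = (if u = v then 1 else 0))"

definition spherical_normal :: "('a::euclidean_space \<Rightarrow> 'b::euclidean_space) \<Rightarrow> 'a \<Rightarrow> 'a set \<Rightarrow> 'b \<Rightarrow> bool" where
  "spherical_normal F x H \<nu> \<longleftrightarrow> \<nu> \<bullet> F x = 0 \<and> (\<forall>v\<in>H. \<nu> \<bullet> sphere_diff F x v = 0)"

definition minimal_immersion_at :: "('a::euclidean_space \<Rightarrow> 'b::euclidean_space) \<Rightarrow> 'a \<Rightarrow> 'a set \<Rightarrow> bool" where
  "minimal_immersion_at F x H \<longleftrightarrow> inj_on (sphere_diff F x) H \<and>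
     (\<forall>B \<nu>. induced_onb F x H B \<and> spherical_normal F x H \<nu> \<longrightarrow>
        (\<Sum>e\<in>B. sphere_diff2 F x e e \<bullet> \<nu>) = 0)"

section \<open>Lawson--Osserman maps\<close>

definition LO_graph :: "('a::euclidean_space \<Rightarrow> 'b::euclidean_space) \<Rightarrow> real \<Rightarrow> 'a \<Rightarrow> 'a \<times> 'b" where
  "LO_graph f \<theta> x = (cos \<theta> *\<^sub>R x, sin \<theta> *\<^sub>R f x)"

definition LOM_angle :: "('a::euclidean_space \<Rightarrow> 'b::euclidean_space) \<Rightarrow> real \<Rightarrow> bool" where
  "LOM_angle f \<theta> \<longleftrightarrow> 0 < \<theta> \<and> \<theta> < pi / 2 \<and>
     (\<forall>x\<in>sphere 0 1. minimal_immersion_at (LO_graph f \<theta>) x (tangent_sphere x))"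

definition LOM :: "('a::euclidean_space \<Rightarrow> 'b::euclidean_space) \<Rightarrow> bool" where
  "LOM f \<longleftrightarrow> f ` sphere 0 1 \<subseteq> sphere 0 1 \<and> smooth_on_sphere f \<and> (\<exists>\<theta>. LOM_angle f \<theta>)"

text \<open>
  \<open>singular_space f x \<mu>\<close> is the eigenspace of \<open>A\<^sup>* A\<close> for the eigenvalue \<open>\<mu>\<^sup>2\<close>, where \<open>A\<close> is the
  differential of \<open>f\<close> on the tangent space at \<open>x\<close>; its dimension is the multiplicity of the
  singular value \<open>\<mu>\<close>.
\<close>

definition singular_space :: "('a::euclidean_space \<Rightarrow> 'b::euclidean_space) \<Rightarrow> 'a \<Rightarrow> real \<Rightarrow> 'a set" where
  "singular_space f x \<mu> =
     {v \<in> tangent_sphere x. \<forall>w\<in>tangent_sphere x. sphere_diff f x v \<bullet> sphere_diff f x w = \<mu>\<^sup>2 * (v \<bullet> w)}"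

definition singular_values :: "('a::euclidean_space \<Rightarrow> 'b::euclidean_space) \<Rightarrow> 'a \<Rightarrow> real set" where
  "singular_values f x = {\<mu>. 0 \<le> \<mu> \<and> (\<exists>v\<in>singular_space f x \<mu>. v \<noteq> 0)}"

definition LOMSE :: "('a::euclidean_space \<Rightarrow> 'b::euclidean_space) \<Rightarrow> bool" where
  "LOMSE f \<longleftrightarrow> LOM f \<and> (\<forall>x\<in>sphere 0 1. \<exists>\<mu>>0. singular_values f x = {0, \<mu>})"

section \<open>Hopf fibrations\<close>

text \<open>Cayley--Dickson doubling: \<open>(a, b) (c, d) = (a c - d\<^sup>* b, d a + b c\<^sup>*)\<close>.\<close>

type_synonym quat = "complex \<times> complex"
type_synonym oct = "quat \<times> quat"

definition quat_cnj :: "quat \<Rightarrow> quat" where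
  "quat_cnj x = (cnj (fst x), - snd x)"

definition quat_mult :: "quat \<Rightarrow> quat \<Rightarrow> quat" where
  "quat_mult x y = (fst x * fst y - cnj (snd y) * snd x, snd y * fst x + snd x * cnj (fst y))"

definition oct_cnj :: "oct \<Rightarrow> oct" where
  "oct_cnj x = (quat_cnj (fst x), - snd x)"

definition oct_mult :: "oct \<Rightarrow> oct \<Rightarrow> oct" where
  "oct_mult x y =
     (quat_mult (fst x) (fst y) - quat_mult (quat_cnj (snd y)) (snd x),
      quat_mult (snd y) (fst x) + quat_mult (snd x) (quat_cnj (fst y)))"

text \<open>
  The octonionic line through a nonzero \<open>(a, b)\<close>: the graph of left multiplication by
  \<open>b a\<^sup>-\<^sup>1 = b a\<^sup>* / \<parallel>a\<parallel>\<^sup>2\<close>, or the vertical line if \<open>a = 0\<close>.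
\<close>

definition oct_line :: "oct \<times> oct \<Rightarrow> (oct \<times> oct) set" where
  "oct_line z = (let a = fst z; b = snd z in
     if a = 0 then {0} \<times> UNIV
     else {(u, oct_mult (oct_mult b (oct_cnj a) /\<^sub>R (norm a)\<^sup>2) u) | u. True})"

text \<open>
  The points of the projective space are the complex, quaternionic or octonionic lines, as real
  subspaces of the ambient space of the sphere; \<open>\<pi> x\<close> is the line through \<open>x\<close>, so the fibre
  through \<open>x\<close> is \<open>\<pi> x \<inter> sphere 0 1\<close>. The ambient space carries orthogonal complex or quaternionic
  structures (\<open>J\<close>, respectively \<open>I\<close>, \<open>J\<close>, \<open>I J\<close>), which amounts to an isometry with a space of
  complex or quaternionic tuples. The projective space has real dimension \<open>p\<close> and the metric \<open>h\<close>
  that makes \<open>\<pi>\<close> a Riemannian submersion.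
\<close>

definition complex_Hopf :: "('a::euclidean_space \<Rightarrow> 'a set) \<Rightarrow> nat \<Rightarrow> bool" where
  "complex_Hopf \<pi> p \<longleftrightarrow> DIM('a) = p + 2 \<and>
     (\<exists>J. orthogonal_transformation J \<and> (\<forall>x. J (J x) = - x) \<and> (\<forall>x. \<pi> x = span {x, J x}))"

definition quaternionic_Hopf :: "('a::euclidean_space \<Rightarrow> 'a set) \<Rightarrow> nat \<Rightarrow> bool" where
  "quaternionic_Hopf \<pi> p \<longleftrightarrow> DIM('a) = p + 4 \<and>
     (\<exists>I J. orthogonal_transformation I \<and> orthogonal_transformation J \<and>
        (\<forall>x. I (I x) = - x) \<and> (\<forall>x. J (J x) = - x) \<and> (\<forall>x. I (J x) = - J (I x)) \<and>
        (\<forall>x. \<pi> x = span {x, I x, J x, I (J x)}))"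

definition octonionic_Hopf :: "('a::euclidean_space \<Rightarrow> 'a set) \<Rightarrow> nat \<Rightarrow> bool" where
  "octonionic_Hopf \<pi> p \<longleftrightarrow> DIM('a) = 16 \<and> p = 8 \<and>
     (\<exists>\<phi>::'a \<Rightarrow> oct \<times> oct. linear \<phi> \<and> bij \<phi> \<and> (\<forall>x. norm (\<phi> x) = norm x) \<and>
        (\<forall>x. \<pi> x = \<phi> -` oct_line (\<phi> x)))"

definition Hopf_fibration :: "('a::euclidean_space \<Rightarrow> 'a set) \<Rightarrow> nat \<Rightarrow> bool" where
  "Hopf_fibration \<pi> p \<longleftrightarrow> 0 < p \<and> (complex_Hopf \<pi> p \<or> quaternionic_Hopf \<pi> p \<or> octonionic_Hopf \<pi> p)"

definition horizontal_space :: "('a::euclidean_space \<Rightarrow> 'a set) \<Rightarrow> 'a \<Rightarrow> 'a set" where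
  "horizontal_space \<pi> x = {v. \<forall>w\<in>\<pi> x. v \<bullet> w = 0}"

text \<open>
  \<open>f = i \<circ> \<pi>\<close> on the sphere, where \<open>i\<close> is a minimal isometric immersion of the projective space with
  metric \<open>lam\<^sup>2 h\<close>. The differential of \<open>\<pi>\<close> identifies the horizontal space isometrically with the
  tangent space of the base, so the differential of \<open>i\<close> is that of \<open>f\<close> on horizontal vectors.
\<close>

definition factors_through_Hopf :: "('a::euclidean_space \<Rightarrow> 'b::euclidean_space) \<Rightarrow> nat \<Rightarrow> real \<Rightarrow> bool" where
  "factors_through_Hopf f p lam \<longleftrightarrow> (\<exists>\<pi> i. Hopf_fibration \<pi> p \<and>
     (\<forall>x\<in>sphere 0 1. f x = i (\<pi> x) \<and>
        (\<forall>v\<in>horizontal_space \<pi> x. \<forall>w\<in>horizontal_space \<pi> x.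
           sphere_diff f x v \<bullet> sphere_diff f x w = lam\<^sup>2 * (v \<bullet> w)) \<and>
        minimal_immersion_at f x (horizontal_space \<pi> x)))"

section \<open>Spherical harmonics\<close>

definition laplacian :: "('a::euclidean_space \<Rightarrow> real) \<Rightarrow> 'a \<Rightarrow> real" where
  "laplacian P x = (\<Sum>b\<in>Basis. frechet_derivative (\<lambda>y. frechet_derivative P (at y) b) (at x) b)"

text \<open>Restrictions to the sphere of homogeneous harmonic polynomials (including zero).\<close>

definition spherical_harmonic :: "nat \<Rightarrow> ('a::euclidean_space \<Rightarrow> real) \<Rightarrow> bool" where
  "spherical_harmonic k u \<longleftrightarrow> (\<exists>P. real_polynomial_function P \<and> (\<forall>c x. P (c *\<^sub>R x) = c ^ k * P x) \<and>
     (\<forall>x. laplacian P x = 0) \<and> (\<forall>x\<in>sphere 0 1. u x = P x))"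

section \<open>Types of LOMSEs\<close>

text \<open>
  \<open>f\<close> is of \<open>(n, p, k)\<close>-type with nonzero singular value \<open>lam\<close>. The formulas for \<open>lam\<close> and the angle
  in terms of \<open>(n, p, k)\<close> are consequences and not part of the definition.
\<close>

definition LOMSE_type ::
  "('a::euclidean_space \<Rightarrow> 'b::euclidean_space) \<Rightarrow> nat \<Rightarrow> nat \<Rightarrow> nat \<Rightarrow> real \<Rightarrow> bool" where
  "LOMSE_type f n p k lam \<longleftrightarrow> LOMSE f \<and> DIM('a) = n + 1 \<and> 0 < lam \<and>
     (\<forall>x\<in>sphere 0 1. singular_values f x = {0, lam} \<and> dim (singular_space f x lam) = p) \<and>
     factors_through_Hopf f p lam \<and>
     0 < k \<and> even k \<and> (\<forall>b\<in>Basis. spherical_harmonic k (\<lambda>x. f x \<bullet> b))"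

definition Type_I :: "nat \<Rightarrow> nat \<Rightarrow> nat \<Rightarrow> bool" where
  "Type_I n p k \<longleftrightarrow> (n, p, k) \<in> {(3, 2, 2), (5, 4, 2), (5, 4, 4)} \<or> 7 \<le> n"

definition Type_II :: "nat \<Rightarrow> nat \<Rightarrow> nat \<Rightarrow> bool" where
  "Type_II n p k \<longleftrightarrow> (n, p) = (3, 2) \<and> 4 \<le> k \<or> (n, p) = (5, 4) \<and> 6 \<le> k"

section \<open>The quotient metric and stability of the LOC segment\<close>

text \<open>The volume of \<open>S\<^sup>n\<close> is \<open>n + 1\<close> times the volume of the unit ball that it bounds.\<close>

definition sphere_volume :: "nat \<Rightarrow> real" where
  "sphere_volume n = (real n + 1) * unit_ball_vol (real n + 1)"

definition g0 :: "nat \<Rightarrow> nat \<Rightarrow> real \<Rightarrow> real \<times> real \<Rightarrow> real \<times> real \<Rightarrow> real \<times> real \<Rightarrow> real" where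
  "g0 n p lam q u v = (sphere_volume n)\<^sup>2 *
     ((fst q)\<^sup>2 + lam\<^sup>2 * (snd q)\<^sup>2) ^ p * fst q ^ (2 * (n - p)) * (fst u * fst v + snd u * snd v)"

definition g0_length :: "nat \<Rightarrow> nat \<Rightarrow> real \<Rightarrow> (real \<Rightarrow> real \<times> real) \<Rightarrow> real" where
  "g0_length n p lam c = integral {0<..1} (\<lambda>t.
     let c' = vector_derivative c (at t within {0<..1}) in sqrt (g0 n p lam (c t) c' c'))"

definition LOC_segment :: "real \<Rightarrow> real \<Rightarrow> real \<times> real" where
  "LOC_segment \<theta> t = (t, tan \<theta> * t)"

text \<open>
  \<open>\<Gamma> s\<close> is the varied curve with variation parameter \<open>s\<close>, which stays in the quotient space
  \<open>{(r, \<rho>). 0 < r}\<close>. It agrees with the LOC segment outside a compact subset of the interior.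
\<close>

definition compact_variation :: "real \<Rightarrow> (real \<Rightarrow> real \<Rightarrow> real \<times> real) \<Rightarrow> bool" where
  "compact_variation \<theta> \<Gamma> \<longleftrightarrow> (\<exists>\<epsilon> a b. 0 < \<epsilon> \<and> 0 < a \<and> a < b \<and> b < 1 \<and>
     smooth_on ({-\<epsilon><..<\<epsilon>} \<times> {0<..<1}) (\<lambda>(s, t). \<Gamma> s t) \<and>
     (\<forall>t\<in>{0<..1}. \<Gamma> 0 t = LOC_segment \<theta> t) \<and>
     (\<forall>s\<in>{-\<epsilon><..<\<epsilon>}. \<forall>t\<in>{0<..1}. 0 < fst (\<Gamma> s t) \<and> (t \<notin> {a..b} \<longrightarrow> \<Gamma> s t = LOC_segment \<theta> t)))"

definition second_variation :: "nat \<Rightarrow> nat \<Rightarrow> real \<Rightarrow> (real \<Rightarrow> real \<Rightarrow> real \<times> real) \<Rightarrow> real" where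
  "second_variation n p lam \<Gamma> = deriv (deriv (\<lambda>s. g0_length n p lam (\<Gamma> s))) 0"

definition LOC_stable :: "nat \<Rightarrow> nat \<Rightarrow> real \<Rightarrow> real \<Rightarrow> bool" where
  "LOC_stable n p lam \<theta> \<longleftrightarrow> (\<forall>\<Gamma>. compact_variation \<theta> \<Gamma> \<longrightarrow> 0 \<le> second_variation n p lam \<Gamma>)"

definition LOC_unstable :: "nat \<Rightarrow> nat \<Rightarrow> real \<Rightarrow> real \<Rightarrow> bool" where
  "LOC_unstable n p lam \<theta> \<longleftrightarrow> (\<exists>\<Gamma>. compact_variation \<theta> \<Gamma> \<and> second_variation n p lam \<Gamma> < 0)"

end

theory Submission
  imports Defs
begin

text \<open>
  Write \<open>\<tau> = tan \<theta>\<close> and use the orthogonal coordinates along and across the LOC ray. The weight of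
  \<open>g0\<close> is homogeneous of degree \<open>n\<close> and critical in the normal direction along the ray, so a
  variation with normal component \<open>z\<close> has second variation
  \<open>C \<integral> (t\<^sup>n z'\<^sup>2 - \<kappa> t\<^sup>n\<^sup>-\<^sup>2 z\<^sup>2) dt\<close> with \<open>C > 0\<close> and \<open>\<kappa> = n - 2 n\<^sup>2 / (p \<lambda>\<^sup>2)\<close>; the tangential
  component contributes only a total derivative. By Hardy's inequality, whose constant is sharp on
  functions supported near the origin, this form is nonnegative iff \<open>\<kappa> \<le> ((n - 1) / 2)\<^sup>2\<close>.

  Minimality of the graph in the single normal direction \<open>(- sin \<theta> x, cos \<theta> f x)\<close> gives the equation
  for the angle. Applying the Laplacian to \<open>\<Sum> P\<^sub>b\<^sup>2 = \<bar>y\<bar>\<^sup>2\<^sup>k\<close>, where the \<open>P\<^sub>b\<close> are the harmonic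
  polynomials of the components of \<open>f\<close>, gives \<open>p \<lambda>\<^sup>2 = k (k + n - 1)\<close>. A complex (quaternionic)
  structure forces the dimension of the ambient space to be divisible by 2 (by 4), which leaves only
  \<open>(n, p) = (3, 2), (5, 4)\<close> below \<open>n = 7\<close>.
\<close>

section \<open>Singular frames and the dimensions of Hopf fibrations\<close>

text \<open>\<open>second_variation\<close> is the iterated \<open>deriv\<close> of a length
  integral and must be computed for every smooth family, accelerations and tangential motion
  included. This calls for explicit mixed partials, differentiation under the integral, and a
  density in logarithmic form, where p and n - p enter linearly. The special normal suffices for the
  angle because |x| = 1 and |f| = 1 determine its second fundamental form from first derivatives
  alone. The resulting equation is used a second time: it makes the ray a geodesic and eliminates
  tan \<theta> from \<kappa>. Hardy's threshold is where the Euler equation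
  \<open>t^2 z'' + n t z' + \<kappa> z = 0\<close> loses its real power solutions:
  \<open>t^(-s)\<close> solves it iff \<open>s^2 - (n - 1) s + \<kappa> = 0\<close>, and the double
  root is (n - 1) / 2. That root is the m of the completed square and of the test function. The
  tangent space is split into singular spaces by Rayleigh quotients, since
  \<open>singular_values\<close> only records eigenvalues and no decomposition.\<close>

lemma quadratic_nonneg_imp_linear_zero:
  fixes a b :: real
  assumes "\<And>s. 0 \<le> a * s\<^sup>2 + 2 * b * s"
  shows "b = 0"
proof (rule ccontr)
  assume b: "b \<noteq> 0"
  \<comment> \<open>Evaluate at s = - b / c. This c spares a case distinction on the sign of a: it
    is positive and a < 2 c, so the value becomes negative. The lemma serves as the first-order
    condition at a maximum.\<close>
  define c where "c = \<bar>a\<bar> + 1"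
  have c: "c > 0" "a \<le> c - 1" by (auto simp: c_def)
  have "0 \<le> (a * (- b / c)\<^sup>2 + 2 * b * (- b / c)) * c\<^sup>2"
    using assms[of "- b / c"] by (intro mult_nonneg_nonneg) auto
  also have "\<dots> = (a - 2 * c) * b\<^sup>2"
    using c by (simp add: field_simps power2_eq_square)
  also have "\<dots> < 0"
    using b c by (intro mult_neg_pos) auto
  finally show False by simp
qed

text \<open>Maximise |A v| over the compact unit sphere of W. Comparing v with v + s w leaves a
  nonnegative quadratic in s without constant term, so its linear coefficient vanishes; this is the
  eigenvector equation of the form A v . A w restricted to W.\<close>

lemma rayleigh_maximizer:
  fixes A :: "'a::euclidean_space \<Rightarrow> 'b::euclidean_space"
  assumes A: "linear A" and W: "subspace W" "W \<noteq> {0}"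
  obtains v where "v \<in> W" "norm v = 1" "\<And>w. w \<in> W \<Longrightarrow> A v \<bullet> A w = (norm (A v))\<^sup>2 * (v \<bullet> w)"
proof -
  obtain w0 where w0: "w0 \<in> W" "w0 \<noteq> 0" using W subspace_0 by blast
  define K where "K = W \<inter> sphere 0 1"
  have "compact K" unfolding K_def
    using closed_subspace[OF W(1)] by (simp add: closed_Int_compact)
  moreover have "w0 /\<^sub>R norm w0 \<in> K" unfolding K_def using w0 W by (simp add: subspace_scale)
  moreover have "continuous_on K (\<lambda>v. norm (A v))"
    using A by (intro continuous_on_norm linear_continuous_on) (simp add: linear_conv_bounded_linear)
  ultimately obtain v where v: "v \<in> K" and max: "\<And>w. w \<in> K \<Longrightarrow> norm (A w) \<le> norm (A v)"
    using continuous_attains_sup[of K "\<lambda>v. norm (A v)"] by blast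
  have v1: "v \<in> W" "norm v = 1" using v by (auto simp: K_def)
  have le: "norm (A w) \<le> norm (A v) * norm w" if "w \<in> W" for w
  proof (cases "w = 0")
    case False
    then have "norm (A (w /\<^sub>R norm w)) \<le> norm (A v)"
      using that W by (intro max) (simp add: K_def subspace_scale)
    with False show ?thesis
      using A by (simp add: linear_cmul divide_simps)
  qed (use A in \<open>simp add: linear_0\<close>)
  have "A v \<bullet> A w = (norm (A v))\<^sup>2 * (v \<bullet> w)" if w: "w \<in> W" for w
  proof -
    define M where "M = (norm (A v))\<^sup>2"
    have "0 \<le> (M * (norm w)\<^sup>2 - (norm (A w))\<^sup>2) * s\<^sup>2 + 2 * (M * (v \<bullet> w) - A v \<bullet> A w) * s" for s
    proof -
      have "norm (A (v + s *\<^sub>R w)) \<le> norm (A v) * norm (v + s *\<^sub>R w)"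
        by (intro le) (use v1 w W in \<open>auto intro: subspace_add subspace_scale\<close>)
      then have "(norm (A (v + s *\<^sub>R w)))\<^sup>2 \<le> M * (norm (v + s *\<^sub>R w))\<^sup>2"
        unfolding M_def power_mult_distrib[symmetric] by (intro power_mono) auto
      moreover have "(norm (A (v + s *\<^sub>R w)))\<^sup>2 = M + 2 * s * (A v \<bullet> A w) + s\<^sup>2 * (norm (A w))\<^sup>2"
        unfolding M_def power2_norm_eq_inner linear_add[OF A] linear_cmul[OF A]
        by (simp add: algebra_simps inner_commute power2_eq_square)
      moreover have "(norm (v + s *\<^sub>R w))\<^sup>2 = 1 + 2 * s * (v \<bullet> w) + s\<^sup>2 * (norm w)\<^sup>2"
        using v1(2) unfolding power2_norm_eq_inner norm_eq_1
        by (simp add: algebra_simps inner_commute power2_eq_square)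
      ultimately show ?thesis by (simp add: algebra_simps)
    qed
    from quadratic_nonneg_imp_linear_zero[OF this] show ?thesis by (simp add: M_def)
  qed
  with v1 show ?thesis by (rule that)
qed

lemma subspace_singular_space: "linear (sphere_diff f x) \<Longrightarrow> subspace (singular_space f x \<mu>)"
  by (auto simp: subspace_def singular_space_def tangent_sphere_def linear_0 linear_add linear_cmul
      inner_left_distrib algebra_simps)

text \<open>If the two eigenspaces did not fill the tangent space, a Rayleigh maximizer on the
  orthogonal complement of their sum would be a further singular vector, and its value 0 or
  \<open>lam\<close> would put it back into that sum. \<open>B0\<close> is nonempty because 0 is a
  singular value; this later yields p < n.\<close>

lemma singular_frame:
  fixes f :: "'a::euclidean_space \<Rightarrow> 'b::euclidean_space"
  assumes A: "linear (sphere_diff f x)" and x: "norm x = 1"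
    and sv: "singular_values f x = {0, lam}" and lam: "0 < lam"
  obtains B0 B1 where "finite B0" "finite B1" "B0 \<inter> B1 = {}" "B0 \<noteq> {}"
    "B0 \<subseteq> singular_space f x 0" "B1 \<subseteq> singular_space f x lam"
    "\<And>e. e \<in> B0 \<union> B1 \<Longrightarrow> norm e = 1"
    "pairwise orthogonal (B0 \<union> B1)" "span (B0 \<union> B1) = tangent_sphere x"
    "card B1 = dim (singular_space f x lam)" "card B0 + card B1 = DIM('a) - 1"
proof -
  let ?A = "sphere_diff f x" and ?T = "tangent_sphere x"
  let ?V = "singular_space f x"
  have T: "subspace ?T" by (auto simp: subspace_def tangent_sphere_def inner_left_distrib)
  have VT: "?V \<mu> \<subseteq> ?T" for \<mu> by (auto simp: singular_space_def)
  have orth01: "v \<bullet> w = 0" if "v \<in> ?V 0" "w \<in> ?V lam" for v w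
  proof -
    have "?A v \<bullet> ?A w = 0" "?A w \<bullet> ?A v = lam\<^sup>2 * (w \<bullet> v)"
      using that VT by (auto simp: singular_space_def)
    with lam show ?thesis by (simp add: inner_commute)
  qed
  obtain B0 where B0: "B0 \<subseteq> ?V 0" "pairwise orthogonal B0" "\<And>e. e \<in> B0 \<Longrightarrow> norm e = 1"
    "independent B0" "card B0 = dim (?V 0)" "span B0 = ?V 0"
    using orthonormal_basis_subspace[OF subspace_singular_space[OF A]] by blast
  obtain B1 where B1: "B1 \<subseteq> ?V lam" "pairwise orthogonal B1" "\<And>e. e \<in> B1 \<Longrightarrow> norm e = 1"
    "independent B1" "card B1 = dim (?V lam)" "span B1 = ?V lam"
    using orthonormal_basis_subspace[OF subspace_singular_space[OF A]] by blast
  have po: "pairwise orthogonal (B0 \<union> B1)"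
    using B0(1,2) B1(1,2) orth01 by (auto simp: pairwise_def orthogonal_def) (metis inner_commute subsetD)+
  have disj: "B0 \<inter> B1 = {}"
  proof (rule ccontr)
    assume "B0 \<inter> B1 \<noteq> {}"
    then obtain e where e: "e \<in> B0" "e \<in> B1" by blast
    then have "e \<bullet> e = 0" using orth01 B0(1) B1(1) by blast
    with B0(3)[OF e(1)] show False by simp
  qed
  have "B0 \<noteq> {}"
  proof
    assume "B0 = {}"
    then have "?V 0 = {0}" using B0(6) by simp
    moreover have "0 \<in> singular_values f x" using sv by simp
    ultimately show False by (auto simp: singular_values_def)
  qed
  have sub: "span (B0 \<union> B1) \<subseteq> ?T"
    using B0(1) B1(1) VT T by (intro span_minimal) blast+
  have span: "span (B0 \<union> B1) = ?T"
  proof (rule ccontr)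
    assume "span (B0 \<union> B1) \<noteq> ?T"
    define W where "W = {w \<in> ?T. \<forall>e \<in> B0 \<union> B1. orthogonal e w}"
    have W: "subspace W" using T by (auto simp: W_def subspace_def orthogonal_def inner_right_distrib)
    have "span (B0 \<union> B1) \<subset> span ?T"
      using sub \<open>span (B0 \<union> B1) \<noteq> ?T\<close> by (simp add: span_eq_iff[THEN iffD2, OF T] psubset_eq)
    then obtain z where "z \<noteq> 0" "z \<in> span ?T" "\<And>y. y \<in> span (B0 \<union> B1) \<Longrightarrow> orthogonal z y"
      using orthogonal_to_subspace_exists_gen by metis
    then have "z \<in> W" using span_eq_iff[THEN iffD2, OF T] by (auto simp: W_def orthogonal_commute span_base)
    with \<open>z \<noteq> 0\<close> have "W \<noteq> {0}" by blast
    then obtain v where v: "v \<in> W" "norm v = 1"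
      and ev: "\<And>w. w \<in> W \<Longrightarrow> ?A v \<bullet> ?A w = (norm (?A v))\<^sup>2 * (v \<bullet> w)"
      using rayleigh_maximizer[OF A W] by metis
    \<comment> \<open>Vectors of the frame are eigenvectors, so orthogonality of v to u passes to A
      v and A u.\<close>
    have vorth: "v \<bullet> u = 0 \<and> ?A v \<bullet> ?A u = 0" if "u \<in> span (B0 \<union> B1)" for u
      using that
    proof (induction rule: span_induct)
      case base
      show ?case using A
        by (auto simp: subspace_def linear_0 linear_add linear_cmul inner_right_distrib)
    next
      case (step u)
      have vT: "v \<in> ?T" "v \<bullet> u = 0" using v(1) step by (auto simp: W_def orthogonal_def inner_commute)
      obtain \<mu> where "u \<in> ?V \<mu>" using step B0(1) B1(1) by blast
      then have "?A u \<bullet> ?A v = \<mu>\<^sup>2 * (u \<bullet> v)" using vT(1) by (auto simp: singular_space_def)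
      with vT(2) show ?case by (simp add: inner_commute)
    qed
    \<comment> \<open>The maximizer was tested against W only. Splitting a tangent w into its part
      in the span and its part in W extends the equation to the whole tangent space.\<close>
    have "v \<in> ?V (norm (?A v))"
      unfolding singular_space_def
    proof (intro CollectI conjI ballI)
      show vT: "v \<in> ?T" using v by (simp add: W_def)
      fix w assume w: "w \<in> ?T"
      obtain y z where yz: "y \<in> span (B0 \<union> B1)" "\<And>u. u \<in> span (B0 \<union> B1) \<Longrightarrow> orthogonal z u" "w = y + z"
        using orthogonal_subspace_decomp_exists by blast
      have "z \<in> ?T" using yz sub w T subspace_diff[OF T, of w y] by auto
      then have "z \<in> W" using yz(2) by (auto simp: W_def orthogonal_commute span_base)
      then show "?A v \<bullet> ?A w = (norm (?A v))\<^sup>2 * (v \<bullet> w)"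
        using vorth[OF yz(1)] ev A by (simp add: yz(3) linear_add inner_right_distrib)
    qed
    moreover from this v(2) have "norm (?A v) \<in> singular_values f x"
      unfolding singular_values_def by (auto intro!: bexI[of _ v])
    ultimately have "v \<in> ?V 0 \<union> ?V lam" using sv by auto
    then have "v \<in> span (B0 \<union> B1)"
      using B0(6) B1(6) by (metis Un_iff span_mono subsetD sup_ge1 sup_ge2)
    with vorth v(2) show False by (metis inner_eq_zero_iff norm_zero zero_neq_one)
  qed
  have fin: "finite B0" "finite B1" using B0(4) B1(4) independent_imp_finite by auto
  have "x \<noteq> 0" using x by auto
  have "card B0 + card B1 = card (B0 \<union> B1)" using fin disj by (simp add: card_Un_disjoint)
  also have "\<dots> = dim (B0 \<union> B1)"
  proof -
    have "0 \<notin> B0 \<union> B1" using B0(3) B1(3) by force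
    from pairwise_orthogonal_independent[OF po this] show ?thesis by (simp add: dim_eq_card_independent)
  qed
  also have "\<dots> = DIM('a) - 1"
  proof -
    have "?T = {v. x \<bullet> v = 0}" by (auto simp: tangent_sphere_def inner_commute)
    then show ?thesis using dim_hyperplane[OF \<open>x \<noteq> 0\<close>] by (metis dim_span span)
  qed
  finally have "card B0 + card B1 = DIM('a) - 1" .
  moreover have "norm e = 1" if "e \<in> B0 \<union> B1" for e using that B0(3) B1(3) by blast
  ultimately show ?thesis
    using fin disj \<open>B0 \<noteq> {}\<close> B0(1) B1(1,5) po span by (intro that[of B0 B1]) assumption+
qed

text \<open>Split off orthogonal blocks of dimension d. Among the sets V with d dividing
  \<open>dim V\<close> whose orthogonal complement is stable under Q, take one of largest dimension;
  a nonzero x orthogonal to it would allow \<open>Q x\<close> to be adjoined. Only dimensions and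
  inner products matter, so V and \<open>Q x\<close> may be spanning sets instead of
  subspaces.\<close>

lemma dvd_DIM_if_orthogonal_lines:
  fixes Q :: "'a::euclidean_space \<Rightarrow> 'a set"
  assumes self: "\<And>x. x \<in> Q x" and dim: "\<And>x. x \<noteq> 0 \<Longrightarrow> dim (Q x) = d"
    and orth: "\<And>x y z u. \<lbrakk>\<And>z. z \<in> Q x \<Longrightarrow> y \<bullet> z = 0; u \<in> Q y; z \<in> Q x\<rbrakk> \<Longrightarrow> u \<bullet> z = 0"
  shows "d dvd DIM('a)"
proof -
  define P where "P V \<longleftrightarrow> d dvd dim V \<and> (\<forall>y. (\<forall>v\<in>V. y \<bullet> v = 0) \<longrightarrow> (\<forall>u\<in>Q y. \<forall>v\<in>V. u \<bullet> v = 0))" for V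
  have "P {}" by (simp add: P_def)
  moreover have "dim V < DIM('a) + 1" for V :: "'a set" using dim_subset_UNIV[of V] by simp
  ultimately obtain V where V: "P V" and max: "\<And>V'. P V' \<Longrightarrow> dim V' \<le> dim V"
    using ex_has_greatest_nat[of P "{}" dim "DIM('a)+1"] by (metis less_imp_le)
  have "\<not> dim V < DIM('a)"
  proof
    assume "dim V < DIM('a)"
    then obtain x where x: "x \<noteq> 0" "\<And>y. y \<in> span V \<Longrightarrow> orthogonal x y"
      using orthogonal_to_subspace_exists by blast
    then have xV: "\<forall>v\<in>V. x \<bullet> v = 0" by (auto simp: orthogonal_def span_base)
    have dim': "dim (V \<union> Q x) = dim V + d"
      using V xV by (subst dim_orthogonal_sum) (auto simp: P_def dim x, metis inner_commute)
    have "P (V \<union> Q x)"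
      unfolding P_def dim'
    proof (intro conjI allI impI ballI)
      show "d dvd dim V + d" using V by (simp add: P_def)
    next
      fix y u v assume y: "\<forall>v\<in>V \<union> Q x. y \<bullet> v = 0" and "u \<in> Q y" "v \<in> V \<union> Q x"
      then show "u \<bullet> v = 0" using V orth[of x y u v] by (auto simp: P_def)
    qed
    from max[OF this] dim' have "d = 0" by simp
    moreover have "dim (Q x) \<noteq> 0" using self[of x] x(1) by (auto simp: dim_eq_0)
    ultimately show False using dim x(1) by simp
  qed
  then have "dim V = DIM('a)" using dim_subset_UNIV[of V] by simp
  with V show ?thesis by (simp add: P_def)
qed

lemma complex_structure_skew:
  assumes "orthogonal_transformation J" "\<And>x. J (J x) = - x"
  shows "J u \<bullet> v = - (u \<bullet> J v)"
proof -
  have "J u \<bullet> J (J v) = u \<bullet> J v" using assms(1) by (simp add: orthogonal_transformation_def)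
  then show ?thesis by (simp add: assms(2))
qed

lemma complex_Hopf_even:
  assumes "complex_Hopf (\<pi> :: 'a::euclidean_space \<Rightarrow> 'a set) p"
  shows "even p"
proof -
  obtain J :: "'a \<Rightarrow> 'a" where J: "orthogonal_transformation J" "\<And>x. J (J x) = - x"
    and D: "DIM('a) = p + 2" using assms unfolding complex_Hopf_def by blast
  note skew = complex_structure_skew[OF J]
  have iso: "J x \<bullet> J y = x \<bullet> y" for x y using J(1) by (simp add: orthogonal_transformation_def)
  have J0: "x \<bullet> J x = 0" "J x \<bullet> x = 0" for x using skew[of x x] by (simp_all add: inner_commute)
  have "2 dvd DIM('a)"
  proof (rule dvd_DIM_if_orthogonal_lines[where Q = "\<lambda>x. {x, J x}"])
    fix x :: 'a assume x: "x \<noteq> 0"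
    have nz: "J x \<noteq> 0" using iso[of x x] x by auto
    have ne: "x \<noteq> J x" using J0[of x] x by (metis inner_eq_zero_iff)
    have "independent {x, J x}"
      using x nz J0[of x] by (intro pairwise_orthogonal_independent) (auto simp: pairwise_def
          orthogonal_def)
    then show "dim {x, J x} = 2" using ne by (simp add: dim_eq_card_independent)
  next
    fix x y z u :: 'a
    assume h: "\<And>z. z \<in> {x, J x} \<Longrightarrow> y \<bullet> z = 0" "u \<in> {y, J y}" "z \<in> {x, J x}"
    then have "y \<bullet> x = 0" "y \<bullet> J x = 0" by auto
    with h(2,3) show "u \<bullet> z = 0" by (auto simp: skew J(2))
  qed auto
  with D show ?thesis by simp
qed

text \<open>With K = I J the blocks are x, I x, J x, K x. The three structures are skew and multiply
  like the quaternion units, which yields all orthogonality relations within a block and between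
  blocks.\<close>

lemma quaternionic_Hopf_dvd:
  assumes "quaternionic_Hopf (\<pi> :: 'a::euclidean_space \<Rightarrow> 'a set) p"
  shows "4 dvd p"
proof -
  obtain I J :: "'a \<Rightarrow> 'a" where I: "orthogonal_transformation I" "\<And>x. I (I x) = - x"
    and J: "orthogonal_transformation J" "\<And>x. J (J x) = - x" and IJ: "\<And>x. I (J x) = - J (I x)"
    and D: "DIM('a) = p + 4" using assms unfolding quaternionic_Hopf_def by blast
  define K where "K x = I (J x)" for x
  have lin: "linear I" "linear J" using I(1) J(1) by (auto simp: orthogonal_transformation_def)
  have neg: "I (- x) = - I x" "J (- x) = - J x" for x
    using lin by (simp_all add: linear_neg)
  have K1: "orthogonal_transformation K"
    using orthogonal_transformation_compose[OF I(1) J(1)] by (simp add: K_def[abs_def] o_def)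
  have K2: "K (K x) = - x" for x by (simp add: K_def IJ neg I(2) J(2))
  note K = K1 K2
  have mult: "J (I x) = - K x" "I (K x) = - J x" "K (I x) = J x" "J (K x) = I x" "K (J x) = - I x" for x
    by (simp_all add: K_def IJ neg I(2) J(2))
  note skew = complex_structure_skew[OF I] complex_structure_skew[OF J] complex_structure_skew[OF K]
  have self: "x \<bullet> I x = 0" "x \<bullet> J x = 0" "x \<bullet> K x = 0" for x
    using skew[of x x] by (simp_all add: inner_commute)
  have orthx: "pairwise orthogonal {x, I x, J x, K x}" for x
    using self[of x] by (auto simp: pairwise_def orthogonal_def skew mult I(2) J(2) K(2) K_def[symmetric])
  have norms: "norm (I x) = norm x" "norm (J x) = norm x" "norm (K x) = norm x" for x
    using I(1) J(1) K(1) by (auto simp: orthogonal_transformation)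
  have "4 dvd DIM('a)"
  proof (rule dvd_DIM_if_orthogonal_lines[where Q = "\<lambda>x. {x, I x, J x, K x}"])
    fix x :: 'a assume x: "x \<noteq> 0"
    have nz: "I x \<noteq> 0" "J x \<noteq> 0" "K x \<noteq> 0" using norms[of x] x by (metis norm_eq_zero)+
    have "x \<bullet> I x = 0" "x \<bullet> J x = 0" "x \<bullet> K x = 0" "I x \<bullet> J x = 0" "I x \<bullet> K x = 0" "J x \<bullet> K x = 0"
      using self[of x] by (auto simp: skew mult K_def[symmetric])
    then have ne: "x \<noteq> I x" "x \<noteq> J x" "x \<noteq> K x" "I x \<noteq> J x" "I x \<noteq> K x" "J x \<noteq> K x"
      using x nz by (metis inner_eq_zero_iff)+
    have "independent {x, I x, J x, K x}"
      using x nz by (intro pairwise_orthogonal_independent[OF orthx]) auto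
    then show "dim {x, I x, J x, K x} = 4" using ne by (simp add: dim_eq_card_independent)
  next
    fix x y z u :: 'a
    assume h: "\<And>z. z \<in> {x, I x, J x, K x} \<Longrightarrow> y \<bullet> z = 0" "u \<in> {y, I y, J y, K y}" "z \<in> {x, I x, J x, K x}"
    have "y \<bullet> x = 0" "y \<bullet> I x = 0" "y \<bullet> J x = 0" "y \<bullet> K x = 0" by (rule h(1); simp)+
    with h(2,3) show "u \<bullet> z = 0"
      by (auto simp: skew mult I(2) J(2) K(2) K_def[symmetric])
  qed auto
  with D show ?thesis by simp
qed

text \<open>In the complex case n = p + 1 with p even, and p = 2, 4 are the two exceptions. In the
  quaternionic case p is at least 4, so n = p + 3 is at least 7. The octonionic case has n =
  15.\<close>

lemma Hopf_fibration_dims: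
  assumes "Hopf_fibration (\<pi> :: 'a::euclidean_space \<Rightarrow> 'a set) p" and "DIM('a) = n + 1"
  shows "(n, p) = (3, 2) \<or> (n, p) = (5, 4) \<or> 7 \<le> n"
proof -
  have "0 < p" using assms by (simp add: Hopf_fibration_def)
  consider "complex_Hopf \<pi> p" | "quaternionic_Hopf \<pi> p" | "octonionic_Hopf \<pi> p"
    using assms by (auto simp: Hopf_fibration_def)
  then show ?thesis
  proof cases
    case 1
    then have "even p" "n = p + 1" using complex_Hopf_even assms(2) by (auto simp: complex_Hopf_def)
    then show ?thesis using \<open>0 < p\<close> by auto presburger?
  next
    case 2
    then have "4 dvd p" "n = p + 3"
      using quaternionic_Hopf_dvd[of \<pi> p] assms(2) by (simp, simp add: quaternionic_Hopf_def)
    then show ?thesis using \<open>0 < p\<close> dvd_imp_le[of 4 p] by auto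
  next
    case 3
    then show ?thesis using assms(2) by (auto simp: octonionic_Hopf_def)
  qed
qed

section \<open>The equation for the angle\<close>

text \<open>Parseval's identity: the remainder z of w after projection is orthogonal to a spanning
  set, hence zero. It permits computing a squared gradient in a frame adapted to f.\<close>

lemma orthonormal_basis_inner:
  fixes v w :: "'a::euclidean_space"
  assumes "finite S" "pairwise orthogonal S" "\<And>u. u \<in> S \<Longrightarrow> norm u = 1" "span S = UNIV"
  shows "v \<bullet> w = (\<Sum>u\<in>S. (v \<bullet> u) * (w \<bullet> u))"
proof -
  define z where "z = w - (\<Sum>u\<in>S. (w \<bullet> u) *\<^sub>R u)"
  have "z \<bullet> e = 0" if "e \<in> S" for e
  proof -
    have "(\<Sum>u\<in>S. (w \<bullet> u) * (u \<bullet> e)) = (\<Sum>u\<in>S. if u = e then w \<bullet> e else 0)"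
      using assms(2,3) that by (intro sum.cong) (auto simp: pairwise_def orthogonal_def norm_eq_1)
    also have "\<dots> = w \<bullet> e" using that assms(1) by simp
    finally show ?thesis by (simp add: z_def inner_diff_left inner_sum_left)
  qed
  note zS = this
  have "z \<bullet> y = 0" if "y \<in> span S" for y
    using that
  proof (induction rule: span_induct)
    case base
    show ?case by (simp add: subspace_def inner_right_distrib)
  qed (rule zS)
  then have "z \<bullet> z = 0" using assms(4) by blast
  then have "w = (\<Sum>u\<in>S. (w \<bullet> u) *\<^sub>R u)" by (simp add: z_def)
  then have "v \<bullet> w = v \<bullet> (\<Sum>u\<in>S. (w \<bullet> u) *\<^sub>R u)" by simp
  also have "\<dots> = (\<Sum>u\<in>S. (v \<bullet> u) * (w \<bullet> u))" by (simp add: inner_sum_right mult.commute)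
  finally show ?thesis .
qed

section \<open>Derivatives of radial extensions and of the graph map\<close>

lemma smooth_on_differentiable:
  assumes "smooth_on S f" "open S" "x \<in> S"
  shows "f differentiable (at x)"
proof -
  have "Ck_on (Suc 0) f S" using assms(1) unfolding smooth_on_def by blast
  then show ?thesis using assms(2,3) by (simp add: differentiable_on_eq_differentiable_at)
qed

lemma smooth_on_has_derivative:
  "smooth_on S f \<Longrightarrow> open S \<Longrightarrow> x \<in> S \<Longrightarrow> (f has_derivative frechet_derivative f (at x)) (at x)"
  by (simp add: smooth_on_differentiable frechet_derivative_works[symmetric])

lemma smooth_on_frechet_derivative:
  "smooth_on S f \<Longrightarrow> smooth_on S (\<lambda>x. frechet_derivative f (at x) v)"
  unfolding smooth_on_def
proof
  fix k assume "\<forall>k. Ck_on k f S"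
  then have "Ck_on (Suc k) f S" by blast
  then show "Ck_on k (\<lambda>x. frechet_derivative f (at x) v) S" by simp
qed

lemma smooth_on_continuous_on: "smooth_on S f \<Longrightarrow> continuous_on S f"
  unfolding smooth_on_def by (drule spec[of _ 0]) simp

text \<open>Differentiate K . K = 1 on S, which gives K . D e = 0 there, and differentiate this once
  more at x. Applied to f and to y / |y|, it trades their second derivatives for first ones.\<close>

lemma second_derivative_unit_length:
  fixes K :: "'a::euclidean_space \<Rightarrow> 'b::euclidean_space"
  assumes S: "open S" "x \<in> S" and unit: "\<And>y. y \<in> S \<Longrightarrow> norm (K y) = 1"
    and K: "\<And>y. y \<in> S \<Longrightarrow> (K has_derivative D y) (at y)"
    and D: "((\<lambda>y. D y e) has_derivative D2) (at x)"
  shows "K x \<bullet> D2 e = - (D x e \<bullet> D x e)"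
proof -
  have KD: "K y \<bullet> D y v = 0" if y: "y \<in> S" for y v
  proof -
    have "((\<lambda>y. K y \<bullet> K y) has_derivative (\<lambda>v. K y \<bullet> D y v + D y v \<bullet> K y)) (at y)"
      by (intro has_derivative_inner K y)
    moreover have "((\<lambda>y. K y \<bullet> K y) has_derivative (\<lambda>v. 0)) (at y)"
      by (rule has_derivative_transform_within_open[OF has_derivative_const[of 1] S(1) y])
        (use unit in \<open>simp add: norm_eq_1\<close>)
    ultimately have "(\<lambda>v. K y \<bullet> D y v + D y v \<bullet> K y) = (\<lambda>v. 0)" by (rule has_derivative_unique)
    from fun_cong[OF this, of v] show ?thesis by (simp add: inner_commute)
  qed
  have "((\<lambda>y. K y \<bullet> D y e) has_derivative (\<lambda>v. K x \<bullet> D2 v + D x v \<bullet> D x e)) (at x)"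
    by (intro has_derivative_inner K S D)
  moreover have "((\<lambda>y. K y \<bullet> D y e) has_derivative (\<lambda>v. 0)) (at x)"
    by (rule has_derivative_transform_within_open[OF has_derivative_const[of 0] S]) (simp add: KD)
  ultimately have "(\<lambda>v. K x \<bullet> D2 v + D x v \<bullet> D x e) = (\<lambda>v. 0)" by (rule has_derivative_unique)
  from fun_cong[OF this, of e] show ?thesis by simp
qed

text \<open>The derivative of y / |y| at y in direction v; y / |y| is the radial extension of the
  position vector of the sphere. At a unit y it is the projection of v to the tangent space.\<close>

definition normalize_deriv :: "'a::euclidean_space \<Rightarrow> 'a \<Rightarrow> 'a" where
  "normalize_deriv y v = inverse (norm y) *\<^sub>R v - ((y \<bullet> v) * inverse (norm y) ^ 3) *\<^sub>R y"

lemma has_derivative_normalize: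
  fixes y :: "'a::euclidean_space"
  assumes "y \<noteq> 0"
  shows "((\<lambda>y. y /\<^sub>R norm y) has_derivative normalize_deriv y) (at y)"
proof -
  have "((\<lambda>y. inverse (norm y) *\<^sub>R y) has_derivative
      (\<lambda>v. inverse (norm y) *\<^sub>R v + (- (inverse (norm y) * (v \<bullet> sgn y) * inverse (norm y))) *\<^sub>R y)) (at y)"
    by (rule has_derivative_scaleR[OF Deriv.has_derivative_inverse[OF _ has_derivative_norm[OF assms]]
          has_derivative_ident]) (use assms in auto)
  then show ?thesis
    by (rule has_derivative_eq_rhs)
      (simp add: fun_eq_iff normalize_deriv_def sgn_div_norm inner_commute power3_eq_cube)
qed

lemma normalize_deriv_differentiable:
  fixes x :: "'a::euclidean_space"
  assumes "x \<noteq> 0"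
  shows "(\<lambda>y. normalize_deriv y e) differentiable (at x)"
proof -
  have n: "(\<lambda>y::'a. inverse (norm y)) differentiable (at x)"
    using has_derivative_norm[OF assms] assms
    by (intro differentiable_inverse) (auto simp: differentiable_def)
  have i: "(\<lambda>y. y \<bullet> e) differentiable (at x)"
    by (intro differentiable_inner) simp_all
  show ?thesis unfolding normalize_deriv_def
    by (intro differentiable_diff differentiable_scaleR differentiable_mult differentiable_power n i)
      simp_all
qed

lemma smooth_on_sphereD:
  assumes "smooth_on_sphere f"
  shows "x \<noteq> 0 \<Longrightarrow> (radial_ext f has_derivative sphere_diff f x) (at x)"
    and "x \<noteq> 0 \<Longrightarrow> ((\<lambda>y. sphere_diff f y u) has_derivative sphere_diff2 f x u) (at x)"
proof -
  have o: "open (- {0::'a})" by (simp add: open_Compl)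
  have s: "smooth_on (- {0}) (radial_ext f)" using assms by (simp add: smooth_on_sphere_def)
  show "x \<noteq> 0 \<Longrightarrow> (radial_ext f has_derivative sphere_diff f x) (at x)"
    using smooth_on_has_derivative[OF s o] unfolding sphere_diff_def[abs_def] by simp
  show "x \<noteq> 0 \<Longrightarrow> ((\<lambda>y. sphere_diff f y u) has_derivative sphere_diff2 f x u) (at x)"
    using smooth_on_has_derivative[OF smooth_on_frechet_derivative[OF s] o]
    unfolding sphere_diff_def[abs_def] sphere_diff2_def[abs_def] by simp
qed

lemma linear_sphere_diff: "smooth_on_sphere f \<Longrightarrow> x \<noteq> 0 \<Longrightarrow> linear (sphere_diff f x)"
  by (rule has_derivative_linear[OF smooth_on_sphereD(1)])

lemma unit_radial_ext:
  assumes "f ` sphere 0 1 \<subseteq> sphere 0 1" "y \<noteq> 0"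
  shows "norm (radial_ext f y) = 1"
proof -
  have "y /\<^sub>R norm y \<in> sphere 0 1" using assms(2) by simp
  then have "f (y /\<^sub>R norm y) \<in> sphere 0 1" using assms(1) by blast
  then show ?thesis by (simp add: radial_ext_def)
qed

lemma radial_ext_unit: "norm x = 1 \<Longrightarrow> radial_ext f x = f x"
  by (simp add: radial_ext_def)

text \<open>The graph extends radially to (cos \<theta> y / |y|, sin \<theta> f (y / |y|)). Pairing
  its second derivative with the chosen normal only involves the second derivatives of y / |y| and
  of f along x and f x, and unit length turns each of these into minus a squared first
  derivative.\<close>

lemma LO_graph_derivatives:
  fixes f :: "'a::euclidean_space \<Rightarrow> 'b::euclidean_space"
  assumes f: "smooth_on_sphere f" and unit: "f ` sphere 0 1 \<subseteq> sphere 0 1" and x: "norm x = 1"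
  shows "v \<bullet> x = 0 \<Longrightarrow> sphere_diff (LO_graph f \<theta>) x v = (cos \<theta> *\<^sub>R v, sin \<theta> *\<^sub>R sphere_diff f x v)"
    and "e \<bullet> x = 0 \<Longrightarrow> sphere_diff2 (LO_graph f \<theta>) x e e \<bullet> (- sin \<theta> *\<^sub>R x, cos \<theta> *\<^sub>R f x)
       = sin \<theta> * cos \<theta> * (e \<bullet> e - sphere_diff f x e \<bullet> sphere_diff f x e)"
    and "f x \<bullet> sphere_diff f x v = 0"
proof -
  let ?S = "- {0::'a}" and ?G = "LO_graph f \<theta>"
  have o: "open ?S" by (simp add: open_Compl)
  have xS: "x \<in> ?S" using x by auto
  have x0: "x \<noteq> 0" using x by auto
  have dG: "(radial_ext ?G has_derivative (\<lambda>v. (cos \<theta> *\<^sub>R normalize_deriv y v, sin \<theta> *\<^sub>R sphere_diff f y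
      v))) (at y)"
    if "y \<noteq> 0" for y
    unfolding radial_ext_def[of ?G, abs_def] LO_graph_def radial_ext_def[of f, abs_def, symmetric]
    by (intro has_derivative_Pair has_derivative_scaleR_right has_derivative_normalize[OF that])
      (use smooth_on_sphereD(1)[OF f that] in \<open>simp add: radial_ext_def[abs_def]\<close>)
  have sG: "sphere_diff ?G y v = (cos \<theta> *\<^sub>R normalize_deriv y v, sin \<theta> *\<^sub>R sphere_diff f y v)"
    if "y \<noteq> 0" for y v
    using frechet_derivative_at[OF dG[OF that]] by (simp add: sphere_diff_def fun_eq_iff)
  show "sphere_diff ?G x v = (cos \<theta> *\<^sub>R v, sin \<theta> *\<^sub>R sphere_diff f x v)" if "v \<bullet> x = 0" for v
    using that x by (simp add: sG[OF x0] normalize_deriv_def inner_commute)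
  define N2 where "N2 e = frechet_derivative (\<lambda>y. normalize_deriv y e) (at x)" for e
  have N2: "((\<lambda>y. normalize_deriv y e) has_derivative N2 e) (at x)" for e
    using normalize_deriv_differentiable[OF x0] unfolding N2_def by (simp add: frechet_derivative_works)
  have G2: "sphere_diff2 ?G x e = (\<lambda>v. (cos \<theta> *\<^sub>R N2 e v, sin \<theta> *\<^sub>R sphere_diff2 f x e v))" for e
  proof -
    have "((\<lambda>y. sphere_diff ?G y e) has_derivative
        (\<lambda>v. (cos \<theta> *\<^sub>R N2 e v, sin \<theta> *\<^sub>R sphere_diff2 f x e v))) (at x)"
      by (rule has_derivative_transform_within_open[OF has_derivative_Pair[OF
            has_derivative_scaleR_right[OF N2] has_derivative_scaleR_right[OF smooth_on_sphereD(2)[OF f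
                x0]]] o xS])
        (simp add: sG)
    from frechet_derivative_at[OF this] show ?thesis
      by (simp add: sphere_diff2_def[abs_def] sphere_diff_def[abs_def])
  qed
  have F2: "f x \<bullet> sphere_diff2 f x e e = - (sphere_diff f x e \<bullet> sphere_diff f x e)" for e
    using second_derivative_unit_length[OF o xS unit_radial_ext[OF unit] smooth_on_sphereD(1)[OF f]
        smooth_on_sphereD(2)[OF f x0]] by (simp add: radial_ext_unit[OF x])
  have N2': "x \<bullet> N2 e e = - (e \<bullet> e)" if "e \<bullet> x = 0" for e
  proof -
    have "(x /\<^sub>R norm x) \<bullet> N2 e e = - (normalize_deriv x e \<bullet> normalize_deriv x e)"
      by (rule second_derivative_unit_length[OF o xS _ _ N2, where K = "\<lambda>y. y /\<^sub>R norm y"])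
        (auto intro: has_derivative_normalize)
    then show ?thesis using x that by (simp add: normalize_deriv_def inner_commute)
  qed
  show "sphere_diff2 ?G x e e \<bullet> (- sin \<theta> *\<^sub>R x, cos \<theta> *\<^sub>R f x)
       = sin \<theta> * cos \<theta> * (e \<bullet> e - sphere_diff f x e \<bullet> sphere_diff f x e)" if "e \<bullet> x = 0"
    using N2'[OF that] F2[of e] by (simp add: G2 inner_commute algebra_simps)
  have "((\<lambda>y. radial_ext f y \<bullet> radial_ext f y) has_derivative
      (\<lambda>v. radial_ext f x \<bullet> sphere_diff f x v + sphere_diff f x v \<bullet> radial_ext f x)) (at x)"
    by (intro has_derivative_inner smooth_on_sphereD(1)[OF f x0])
  moreover have "((\<lambda>y. radial_ext f y \<bullet> radial_ext f y) has_derivative (\<lambda>v. 0)) (at x)"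
    by (rule has_derivative_transform_within_open[OF has_derivative_const[of 1] o xS])
      (use unit_radial_ext[OF unit] in \<open>simp add: norm_eq_1\<close>)
  ultimately have "radial_ext f x \<bullet> sphere_diff f x v + sphere_diff f x v \<bullet> radial_ext f x = 0"
    by (blast dest: fun_cong has_derivative_unique)
  then show "f x \<bullet> sphere_diff f x v = 0" by (simp add: radial_ext_unit[OF x] inner_commute)
qed

text \<open>Take the trace of the second fundamental form over a frame that is orthonormal in the
  induced metric. Singular vectors stay orthogonal in that metric, so rescaling them
  suffices.\<close>

lemma LOM_angle_equation:
  fixes f :: "'a::euclidean_space \<Rightarrow> 'b::euclidean_space"
  assumes f: "smooth_on_sphere f" and unit: "f ` sphere 0 1 \<subseteq> sphere 0 1" and x: "norm x = 1"
    and ang: "LOM_angle f \<theta>"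
    and B: "finite B0" "finite B1" "B0 \<inter> B1 = {}"
      "B0 \<subseteq> singular_space f x 0" "B1 \<subseteq> singular_space f x lam"
      "\<And>e. e \<in> B0 \<union> B1 \<Longrightarrow> norm e = 1"
      "pairwise orthogonal (B0 \<union> B1)" "span (B0 \<union> B1) = tangent_sphere x"
  shows "real (card B0) * (1 + lam\<^sup>2 * (tan \<theta>)\<^sup>2) = real (card B1) * (lam\<^sup>2 - 1)"
proof -
  let ?A = "sphere_diff f x" and ?G = "LO_graph f \<theta>" and ?T = "tangent_sphere x"
  define c s d where "c = cos \<theta>" and "s = sin \<theta>" and "d = sqrt (c\<^sup>2 + s\<^sup>2 * lam\<^sup>2)"
  have th: "0 < \<theta>" "\<theta> < pi / 2" using ang by (auto simp: LOM_angle_def)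
  have c: "c > 0" and s: "s > 0" using th by (auto simp: c_def s_def cos_gt_zero sin_gt_zero2)
  have d2: "d\<^sup>2 = c\<^sup>2 + s\<^sup>2 * lam\<^sup>2" and d: "d > 0"
    using c by (auto simp: d_def add_pos_nonneg)
  have x0: "x \<noteq> 0" using x by auto
  note lin = linear_sphere_diff[OF f x0]
  have T: "e \<in> ?T" if "e \<in> B0 \<union> B1" for e using that B(8) by (metis span_base)
  have Tx: "v \<bullet> x = 0 \<longleftrightarrow> v \<in> ?T" for v by (simp add: tangent_sphere_def)
  note dG = LO_graph_derivatives(1)[OF f unit x, unfolded Tx, of _ \<theta>]
  note d2G = LO_graph_derivatives(2)[OF f unit x, unfolded Tx, of _ \<theta>]
  have sing: "?A e \<bullet> ?A e' = \<mu>\<^sup>2 * (e \<bullet> e')" if "e \<in> singular_space f x \<mu>" "e' \<in> ?T" for e e' \<mu>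
    using that unfolding singular_space_def by blast
  have A0: "?A e \<bullet> ?A e = 0" if "e \<in> B0" for e
    using sing[of e 0 e] B(4) T[of e] that by auto
  have A1: "?A e \<bullet> ?A e = lam\<^sup>2" if "e \<in> B1" for e
    using sing[of e lam e] B(5) B(6)[of e] T[of e] that by (auto simp: norm_eq_1)
  \<comment> \<open>The length of e in the induced metric: its square c^2 + s^2 |A e|^2 is c^2 on
    \<open>B0\<close> and d^2 on \<open>B1\<close>. Dividing by it turns the singular frame into an
    \<open>induced_onb\<close>.\<close>
  define w where "w e = (if e \<in> B0 then c else d)" for e
  have w: "w e > 0" for e using c d by (simp add: w_def)
  have wB: "(w e)\<^sup>2 = c\<^sup>2 + s\<^sup>2 * (?A e \<bullet> ?A e)" if "e \<in> B0 \<union> B1" for e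
  proof (cases "e \<in> B0")
    case True
    with A0[OF True] show ?thesis by (simp add: w_def)
  next
    case False
    with that have "?A e \<bullet> ?A e = lam\<^sup>2" using A1 by blast
    with False show ?thesis by (simp add: w_def d2)
  qed
  have orth: "e \<bullet> e' = 0 \<and> ?A e \<bullet> ?A e' = 0" if ee: "e \<in> B0 \<union> B1" "e' \<in> B0 \<union> B1" "e \<noteq> e'" for e e'
  proof -
    have "e \<bullet> e' = 0" using ee B(7) by (auto simp: pairwise_def orthogonal_def)
    moreover obtain \<mu> where "e \<in> singular_space f x \<mu>" using ee B(4,5) by blast
    then have "?A e \<bullet> ?A e' = \<mu>\<^sup>2 * (e \<bullet> e')" using T[OF ee(2)] by (rule sing)
    ultimately show ?thesis by simp
  qed
  define h where "h e = e /\<^sub>R w e" for e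
  have hT: "h e \<in> ?T" if "e \<in> B0 \<union> B1" for e
    using T[OF that] by (simp add: h_def tangent_sphere_def)
  have Ah: "?A (h e) = ?A e /\<^sub>R w e" for e by (simp add: h_def linear_cmul[OF lin])
  have inner_h: "sphere_diff ?G x (h e) \<bullet> sphere_diff ?G x (h e') = (if e = e' then 1 else 0)"
    if e: "e \<in> B0 \<union> B1" and e': "e' \<in> B0 \<union> B1" for e e'
  proof -
    have "sphere_diff ?G x (h e) \<bullet> sphere_diff ?G x (h e')
        = (c\<^sup>2 * (e \<bullet> e') + s\<^sup>2 * (?A e \<bullet> ?A e')) / (w e * w e')"
      using w[of e] w[of e'] unfolding dG[OF hT[OF e]] dG[OF hT[OF e']] Ah c_def[symmetric] s_def[symmetric]
      unfolding h_def by (simp add: divide_simps) (simp add: algebra_simps power2_eq_square)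
    also have "\<dots> = (if e = e' then 1 else 0)"
    proof (cases "e = e'")
      case True
      have "e \<bullet> e = 1" using B(6)[OF e] by (simp add: norm_eq_1)
      then have "c\<^sup>2 * (e \<bullet> e) + s\<^sup>2 * (?A e \<bullet> ?A e) = w e * w e"
        using wB[OF e] by (simp add: power2_eq_square)
      with True w[of e] show ?thesis by simp
    next
      case False
      with orth[OF e e'] show ?thesis by simp
    qed
    finally show ?thesis .
  qed
  have inj: "inj_on h (B0 \<union> B1)"
    by (rule inj_onI) (metis inner_h zero_neq_one)
  have onb: "induced_onb ?G x ?T (h ` (B0 \<union> B1))"
    unfolding induced_onb_def
  proof (intro conjI ballI)
    show "h ` (B0 \<union> B1) \<subseteq> ?T" using hT by blast
    then have "span (h ` (B0 \<union> B1)) \<subseteq> ?T"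
      using B(8) subspace_span by (metis span_minimal)
    moreover have "e \<in> span (h ` (B0 \<union> B1))" if "e \<in> B0 \<union> B1" for e
    proof -
      have "e = w e *\<^sub>R h e" using w[of e] by (simp add: h_def)
      then show ?thesis using that by (metis imageI span_base span_scale)
    qed
    then have "span (B0 \<union> B1) \<subseteq> span (h ` (B0 \<union> B1))"
      by (intro span_minimal) auto
    ultimately show "span (h ` (B0 \<union> B1)) = ?T" using B(8) by simp
  next
    fix u v assume "u \<in> h ` (B0 \<union> B1)" "v \<in> h ` (B0 \<union> B1)"
    then obtain e e' where ee: "e \<in> B0 \<union> B1" "u = h e" "e' \<in> B0 \<union> B1" "v = h e'" by blast
    then show "sphere_diff ?G x u \<bullet> sphere_diff ?G x v = (if u = v then 1 else 0)"
      using inner_h[OF ee(1,3)] inj by (auto simp: inj_on_def)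
  qed
  let ?\<nu> = "(- sin \<theta> *\<^sub>R x, cos \<theta> *\<^sub>R f x)"
  have fx: "f x \<bullet> f x = 1" using unit_radial_ext[OF unit x0] radial_ext_unit[OF x, of f]
      by (simp add: norm_eq_1)
  have nu: "spherical_normal ?G x ?T ?\<nu>"
    unfolding spherical_normal_def
  proof (intro conjI ballI)
    show "?\<nu> \<bullet> ?G x = 0" using x fx by (simp add: LO_graph_def norm_eq_1)
    fix v assume v: "v \<in> ?T"
    then have "x \<bullet> v = 0" by (simp add: tangent_sphere_def inner_commute)
    then show "?\<nu> \<bullet> sphere_diff ?G x v = 0"
      using LO_graph_derivatives(3)[OF f unit x, of v] by (simp add: dG[OF v])
  qed
  have "minimal_immersion_at ?G x ?T" using ang x by (auto simp: LOM_angle_def)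
  with onb nu have "(\<Sum>e\<in>h ` (B0 \<union> B1). sphere_diff2 ?G x e e \<bullet> ?\<nu>) = 0"
    unfolding minimal_immersion_at_def by blast
  then have "0 = (\<Sum>e\<in>B0 \<union> B1. sphere_diff2 ?G x (h e) (h e) \<bullet> ?\<nu>)"
    by (simp add: sum.reindex[OF inj])
  also have "\<dots> = (\<Sum>e\<in>B0 \<union> B1. s * c * (if e \<in> B0 then 1 / c\<^sup>2 else (1 - lam\<^sup>2) / d\<^sup>2))"
  proof (intro sum.cong refl)
    fix e assume e: "e \<in> B0 \<union> B1"
    have e1: "e \<bullet> e = 1" using B(6)[OF e] by (simp add: norm_eq_1)
    have "sphere_diff2 ?G x (h e) (h e) \<bullet> ?\<nu> = s * c * (1 - ?A e \<bullet> ?A e) / (w e)\<^sup>2"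
      using w[of e] unfolding d2G[OF hT[OF e]] unfolding Ah c_def[symmetric] s_def[symmetric]
      unfolding h_def by (simp add: e1 divide_simps) (simp add: algebra_simps power2_eq_square)
    also have "\<dots> = s * c * (if e \<in> B0 then 1 / c\<^sup>2 else (1 - lam\<^sup>2) / d\<^sup>2)"
    proof (cases "e \<in> B0")
      case True
      with A0[OF True] show ?thesis by (simp add: w_def)
    next
      case False
      with e have "?A e \<bullet> ?A e = lam\<^sup>2" using A1 by blast
      with False show ?thesis by (simp add: w_def)
    qed
    finally show "sphere_diff2 ?G x (h e) (h e) \<bullet> ?\<nu> = \<dots>" .
  qed
  also have "\<dots> = s * c * (real (card B0) / c\<^sup>2 + real (card B1) * ((1 - lam\<^sup>2) / d\<^sup>2))"
  proof -
    have "(\<Sum>e\<in>B1. if e \<in> B0 then 1 / c\<^sup>2 else (1 - lam\<^sup>2) / d\<^sup>2) = (\<Sum>e\<in>B1. (1 - lam\<^sup>2) / d\<^sup>2)"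
      using B(3) by (intro sum.cong) auto
    then show ?thesis unfolding sum_distrib_left[symmetric]
      by (simp add: sum.union_disjoint B(1-3))
  qed
  finally have "real (card B0) / c\<^sup>2 + real (card B1) * ((1 - lam\<^sup>2) / d\<^sup>2) = 0"
    using s c by simp
  then have "real (card B0) * (d\<^sup>2 / c\<^sup>2) = real (card B1) * (lam\<^sup>2 - 1)"
    using c d by (simp add: field_simps)
  moreover have "d\<^sup>2 / c\<^sup>2 = 1 + lam\<^sup>2 * (tan \<theta>)\<^sup>2"
    using c unfolding d2 by (simp add: tan_def c_def[symmetric] s_def[symmetric] power_divide field_simps)
  ultimately show ?thesis by simp
qed

section \<open>The equation for the singular value\<close>

text \<open>The second conclusion is there so that the lemma can be applied again to the directional
  derivatives.\<close>

lemma real_polynomial_function_has_derivative: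
  assumes "real_polynomial_function P"
  obtains D where "\<And>x. (P has_derivative D x) (at x)" "\<And>v. real_polynomial_function (\<lambda>x. D x v)"
  using assms
proof (induction arbitrary: thesis rule: real_polynomial_function.induct)
  case (linear f)
  show ?case
    by (rule linear.prems[of "\<lambda>x. f"])
      (auto intro: bounded_linear_imp_has_derivative linear.hyps)
next
  case (const c)
  show ?case by (rule const.prems[of "\<lambda>x v. 0"]) (auto intro: derivative_intros)
next
  case (add f g)
  obtain D E where "\<And>x. (f has_derivative D x) (at x)" "\<And>v. real_polynomial_function (\<lambda>x. D x v)"
    "\<And>x. (g has_derivative E x) (at x)" "\<And>v. real_polynomial_function (\<lambda>x. E x v)"
    using add.IH by metis
  then show ?case
    by (intro add.prems[of "\<lambda>x v. D x v + E x v"]) (auto intro: derivative_intros)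
next
  case (mult f g)
  obtain D E where "\<And>x. (f has_derivative D x) (at x)" "\<And>v. real_polynomial_function (\<lambda>x. D x v)"
    "\<And>x. (g has_derivative E x) (at x)" "\<And>v. real_polynomial_function (\<lambda>x. E x v)"
    using mult.IH by metis
  with mult.hyps show ?case
    by (intro mult.prems[of "\<lambda>x v. f x * E x v + D x v * g x"] has_derivative_mult
        real_polynomial_function.intros(3,4))
qed

lemma real_polynomial_function_second_derivative:
  assumes "real_polynomial_function P"
  shows "\<exists>D D2. (\<forall>y. (P has_derivative D y) (at y)) \<and> (\<forall>v y. ((\<lambda>y. D y v) has_derivative D2 v y) (at y))"
proof -
  obtain D where D: "\<And>y. (P has_derivative D y) (at y)" "\<And>v. real_polynomial_function (\<lambda>y. D y v)"
    using real_polynomial_function_has_derivative[OF assms] by blast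
  have "\<forall>v. \<exists>D2. \<forall>y. ((\<lambda>y. D y v) has_derivative D2 y) (at y)"
  proof
    fix v
    show "\<exists>D2. \<forall>y. ((\<lambda>y. D y v) has_derivative D2 y) (at y)"
      using real_polynomial_function_has_derivative[OF D(2)[of v]] by blast
  qed
  from choice[OF this] D(1) show ?thesis by blast
qed

lemma DERIV_along_line:
  fixes P :: "'a::real_normed_vector \<Rightarrow> real"
  assumes "(P has_derivative D) (at (x + t *\<^sub>R e))"
  shows "((\<lambda>t. P (x + t *\<^sub>R e)) has_real_derivative D e) (at t)"
proof -
  have "((\<lambda>t. x + t *\<^sub>R e) has_derivative (\<lambda>s. s *\<^sub>R e)) (at t)"
    by (auto intro!: derivative_eq_intros)
  from has_derivative_compose[OF this, of P D] assms
  have "((\<lambda>t. P (x + t *\<^sub>R e)) has_derivative (\<lambda>s. D (s *\<^sub>R e))) (at t)" by simp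
  moreover have "D (s *\<^sub>R e) = D e * s" for s
    using linear_cmul[OF has_derivative_linear[OF assms]] by simp
  ultimately show ?thesis by (simp add: has_field_derivative_def)
qed

text \<open>Since the \<open>P b\<close> are harmonic, the Laplacian of the sum of their squares at
  x is twice the total squared gradient. In the frame x, \<open>B0\<close>, \<open>B1\<close> the
  radial part of that gradient contributes k^2 by Euler's relation, and the tangential part is the
  squared norm of the differential of f, that is \<open>card B1 * lam^2\<close>. The Laplacian of
  |y|^(2k) at a unit point is 4 k (k - 1) + 2 k (n + 1).\<close>

lemma LOMSE_eigenvalue_equation:
  fixes f :: "'a::euclidean_space \<Rightarrow> 'b::euclidean_space"
  assumes f: "smooth_on_sphere f" and unit: "f ` sphere 0 1 \<subseteq> sphere 0 1" and x: "norm x = 1"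
    and sh: "\<And>b. b \<in> Basis \<Longrightarrow> spherical_harmonic k (\<lambda>x. f x \<bullet> b)" and k: "0 < k" "even k"
    and n: "DIM('a) = n + 1"
    and B: "finite B0" "finite B1" "B0 \<inter> B1 = {}"
      "B0 \<subseteq> singular_space f x 0" "B1 \<subseteq> singular_space f x lam"
      "\<And>e. e \<in> B0 \<union> B1 \<Longrightarrow> norm e = 1"
      "pairwise orthogonal (B0 \<union> B1)" "span (B0 \<union> B1) = tangent_sphere x"
  shows "real (card B1) * lam\<^sup>2 = real k * (real k + real n - 1)"
proof -
  let ?A = "sphere_diff f x"
  have x0: "x \<noteq> 0" using x by auto
  have T: "e \<bullet> x = 0" if "e \<in> B0 \<union> B1" for e
    using that B(8) span_base[of e "B0 \<union> B1"] by (auto simp: tangent_sphere_def)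
  have "\<forall>b\<in>Basis. \<exists>P. real_polynomial_function P \<and> (\<forall>c x. P (c *\<^sub>R x) = c ^ k * P x) \<and>
     (\<forall>x. laplacian P x = 0) \<and> (\<forall>x\<in>sphere 0 1. f x \<bullet> b = P x)"
    using sh by (auto simp: spherical_harmonic_def)
  from bchoice[OF this] obtain P where "\<forall>b\<in>Basis. real_polynomial_function (P b) \<and>
     (\<forall>c x. P b (c *\<^sub>R x) = c ^ k * P b x) \<and> (\<forall>x. laplacian (P b) x = 0) \<and>
     (\<forall>x\<in>sphere 0 1. f x \<bullet> b = P b x)" by blast
  then have P: "\<And>b. b \<in> Basis \<Longrightarrow> real_polynomial_function (P b)"
    "\<And>b c y. b \<in> Basis \<Longrightarrow> P b (c *\<^sub>R y) = c ^ k * P b y"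
    "\<And>b y. b \<in> Basis \<Longrightarrow> laplacian (P b) y = 0"
    "\<And>b y. b \<in> Basis \<Longrightarrow> norm y = 1 \<Longrightarrow> f y \<bullet> b = P b y"
    by simp_all
  have "\<forall>b\<in>Basis. \<exists>D D2. (\<forall>y. (P b has_derivative D y) (at y)) \<and>
      (\<forall>v y. ((\<lambda>y. D y v) has_derivative D2 v y) (at y))"
    using real_polynomial_function_second_derivative[OF P(1)] by blast
  from bchoice[OF this] obtain D where "\<forall>b\<in>Basis. \<exists>D2. (\<forall>y. (P b has_derivative D b y) (at y)) \<and>
      (\<forall>v y. ((\<lambda>y. D b y v) has_derivative D2 v y) (at y))" by blast
  from bchoice[OF this] obtain D2 where "\<forall>b\<in>Basis. (\<forall>y. (P b has_derivative D b y) (at y)) \<and>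
      (\<forall>v y. ((\<lambda>y. D b y v) has_derivative D2 b v y) (at y))" by blast
  then have D: "\<And>b y. b \<in> Basis \<Longrightarrow> (P b has_derivative D b y) (at y)"
    and D2: "\<And>b v y. b \<in> Basis \<Longrightarrow> ((\<lambda>y. D b y v) has_derivative D2 b v y) (at y)"
    by simp_all
  have Dfd: "frechet_derivative (P b) (at y) = D b y" if "b \<in> Basis" for b y
    using frechet_derivative_at[OF D[OF that]] by simp
  have lap: "(\<Sum>e\<in>Basis. D2 b e x e) = 0" if b: "b \<in> Basis" for b
  proof -
    have "frechet_derivative (\<lambda>y. D b y e) (at x) = D2 b e x" for e
      using frechet_derivative_at[OF D2[OF b]] by simp
    then show ?thesis using P(3)[OF b, of x] by (simp add: laplacian_def Dfd[OF b])
  qed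
  \<comment> \<open>Homogeneity carries |f| = 1 from the sphere to the whole space; at the origin k
    > 0 makes both sides vanish.\<close>
  have sq: "(\<Sum>b\<in>Basis. (P b y)\<^sup>2) = (y \<bullet> y) ^ k" for y
  proof (cases "y = 0")
    case True
    have "P b 0 = 0" if "b \<in> Basis" for b using P(2)[OF that, of 0 0] k by (simp add: power_0_left)
    with True k show ?thesis by simp
  next
    case False
    define u where "u = y /\<^sub>R norm y"
    have u: "norm u = 1" "y = norm y *\<^sub>R u" using False by (simp_all add: u_def)
    have "(\<Sum>b\<in>Basis. (P b y)\<^sup>2) = (\<Sum>b\<in>Basis. (norm y ^ k)\<^sup>2 * (f u \<bullet> b)\<^sup>2)"
    proof (intro sum.cong refl)
      fix b :: 'b assume b: "b \<in> Basis"
      have "P b y = norm y ^ k * (f u \<bullet> b)" using P(2)[OF b, of "norm y" u] u P(4)[OF b u(1)] by simp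
      then show "(P b y)\<^sup>2 = (norm y ^ k)\<^sup>2 * (f u \<bullet> b)\<^sup>2" by (simp add: power_mult_distrib)
    qed
    also have "\<dots> = (norm y ^ k)\<^sup>2 * (f u \<bullet> f u)"
      by (simp add: sum_distrib_left[symmetric] euclidean_inner[of "f u" "f u"] power2_eq_square)
    also have "f u \<bullet> f u = 1"
    proof -
      have "u \<noteq> 0" using u(1) by auto
      then show ?thesis using unit_radial_ext[OF unit, of u] radial_ext_unit[OF u(1), of f]
          by (simp add: norm_eq_1)
    qed
    finally show ?thesis
      by (simp add: power2_norm_eq_inner[symmetric] power_mult[symmetric] mult.commute)
  qed
  have xx: "x \<bullet> x = 1" using x by (simp add: norm_eq_1)
  \<comment> \<open>Second derivative at t = 0 of the preceding identity along x + t e. The right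
    side is \<open>q t ^ k\<close>, where q has value 1, first derivative 2 x . e and second
    derivative 2 e . e at 0.\<close>
  have line: "2 * (\<Sum>b\<in>Basis. (D b x e)\<^sup>2 + P b x * D2 b e x e)
      = real k * real (k - 1) * (2 * (x \<bullet> e))\<^sup>2 + 2 * real k * (e \<bullet> e)" for e
  proof -
    have d1: "((\<lambda>t. P b (x + t *\<^sub>R e)) has_real_derivative D b (x + t *\<^sub>R e) e) (at t)" if "b \<in> Basis"
        for b t
      by (rule DERIV_along_line[OF D[OF that]])
    have d2: "((\<lambda>t. D b (x + t *\<^sub>R e) e) has_real_derivative D2 b e (x + t *\<^sub>R e) e) (at t)" if "b \<in> Basis"
        for b t
      by (rule DERIV_along_line[OF D2[OF that]])
    define q where "q t = 1 + 2 * t * (x \<bullet> e) + t\<^sup>2 * (e \<bullet> e)" for t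
    define q' where "q' t = 2 * (x \<bullet> e) + 2 * t * (e \<bullet> e)" for t
    have q: "(x + t *\<^sub>R e) \<bullet> (x + t *\<^sub>R e) = q t" for t
      by (simp add: q_def xx inner_left_distrib inner_right_distrib inner_commute power2_eq_square
          algebra_simps)
    have dq: "(q has_real_derivative q' t) (at t)" for t
      unfolding q_def[abs_def] q'_def by (auto intro!: derivative_eq_intros)
    have dq': "(q' has_real_derivative 2 * (e \<bullet> e)) (at t)" for t
      unfolding q'_def[abs_def] by (auto intro!: derivative_eq_intros)
    have 1: "((\<lambda>t. \<Sum>b\<in>Basis. (P b (x + t *\<^sub>R e))\<^sup>2) has_real_derivative
        (\<Sum>b\<in>Basis. 2 * (P b (x + t *\<^sub>R e) * D b (x + t *\<^sub>R e) e))) (at t)" for t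
      by (auto intro!: derivative_eq_intros d1 simp: ac_simps)
    have 2: "((\<lambda>t. \<Sum>b\<in>Basis. (P b (x + t *\<^sub>R e))\<^sup>2) has_real_derivative real k * q t ^ (k - 1) * q' t) (at
        t)" for t
      unfolding sq q by (auto intro!: derivative_eq_intros dq)
    have eq: "(\<Sum>b\<in>Basis. 2 * (P b (x + t *\<^sub>R e) * D b (x + t *\<^sub>R e) e)) = real k * q t ^ (k - 1) * q' t"
        for t
      by (rule DERIV_unique[OF 1 2])
    have "((\<lambda>t. \<Sum>b\<in>Basis. 2 * (P b (x + t *\<^sub>R e) * D b (x + t *\<^sub>R e) e)) has_real_derivative
        (\<Sum>b\<in>Basis. 2 * (D b (x + 0 *\<^sub>R e) e * D b (x + 0 *\<^sub>R e) e
            + P b (x + 0 *\<^sub>R e) * D2 b e (x + 0 *\<^sub>R e) e))) (at 0)"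
      by (auto intro!: derivative_eq_intros d1[THEN DERIV_cong] d2[THEN DERIV_cong]
          simp: algebra_simps)
    moreover have "((\<lambda>t. \<Sum>b\<in>Basis. 2 * (P b (x + t *\<^sub>R e) * D b (x + t *\<^sub>R e) e)) has_real_derivative
        real k * (real (k - 1) * q 0 ^ (k - 1 - 1) * q' 0 * q' 0 + q 0 ^ (k - 1) * (2 * (e \<bullet> e)))) (at 0)"
      unfolding eq by (rule derivative_eq_intros dq dq' refl)+ (simp add: algebra_simps)
    ultimately have "(\<Sum>b\<in>Basis. 2 * (D b x e * D b x e + P b x * D2 b e x e))
        = real k * (real (k - 1) * q 0 ^ (k - 1 - 1) * q' 0 * q' 0 + q 0 ^ (k - 1) * (2 * (e \<bullet> e)))"
      using DERIV_unique by fastforce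
    then show ?thesis
      by (simp add: q_def q'_def sum_distrib_left power2_eq_square algebra_simps)
  qed
  have "2 * (\<Sum>b\<in>Basis. (\<Sum>e\<in>Basis. (D b x e)\<^sup>2)) =
      (\<Sum>e\<in>Basis. 2 * (\<Sum>b\<in>Basis. (D b x e)\<^sup>2 + P b x * D2 b e x e))"
    by (simp add: sum.distrib sum_distrib_left[symmetric] sum.swap[of _ "Basis :: 'b set" "Basis :: 'a set"]
        lap)
  also have "\<dots> = (\<Sum>e\<in>Basis. real k * real (k - 1) * 4 * (x \<bullet> e)\<^sup>2 + 2 * real k)"
    by (intro sum.cong refl) (simp add: line inner_Basis)
  also have "\<dots> = real k * real (k - 1) * 4 + 2 * real k * (real n + 1)"
    using xx euclidean_inner[of x x] n
    by (simp add: sum.distrib sum_distrib_left[symmetric] power2_eq_square)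
  finally have total: "2 * (\<Sum>b\<in>Basis. (\<Sum>e\<in>Basis. (D b x e)\<^sup>2)) = real k * real (k - 1) * 4 + 2 * real k *
      (real n + 1)" .
  let ?S = "insert x (B0 \<union> B1)"
  have xnot: "x \<notin> B0 \<union> B1" using T xx by force
  have orthS: "pairwise orthogonal ?S"
    using B(7) T by (auto simp: pairwise_insert orthogonal_def inner_commute)
  have spanS: "span ?S = UNIV"
  proof -
    have "y \<in> span ?S" for y
    proof -
      have "y - (y \<bullet> x) *\<^sub>R x \<in> tangent_sphere x" by (simp add: tangent_sphere_def inner_diff_left xx)
      then have "y - (y \<bullet> x) *\<^sub>R x \<in> span ?S" using B(8) by (metis span_mono subsetD subset_insertI)
      moreover have "(y \<bullet> x) *\<^sub>R x \<in> span ?S" by (simp add: span_base span_scale)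
      ultimately show ?thesis using span_add by fastforce
    qed
    then show ?thesis by auto
  qed
  have change: "(\<Sum>e\<in>Basis. (D b x e)\<^sup>2) = (real k * P b x)\<^sup>2 + (\<Sum>e\<in>B0 \<union> B1. (?A e \<bullet> b)\<^sup>2)" if b: "b \<in> Basis"
      for b
  proof -
    have lin: "linear (D b x)" using D[OF b] by (rule has_derivative_linear)
    define w where "w = (\<Sum>e\<in>Basis. D b x e *\<^sub>R e)"
    have w: "D b x v = v \<bullet> w" for v
    proof -
      have "D b x v = D b x (\<Sum>e\<in>Basis. (v \<bullet> e) *\<^sub>R e)" by (simp add: euclidean_representation)
      also have "\<dots> = v \<bullet> w" by (simp add: linear_sum[OF lin] linear_cmul[OF lin] w_def inner_sum_right
          mult.commute)
      finally show ?thesis .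
    qed
    have "(\<Sum>e\<in>Basis. (D b x e)\<^sup>2) = w \<bullet> w"
      by (simp add: w euclidean_inner[of w w] inner_commute power2_eq_square)
    also have "\<dots> = (\<Sum>u\<in>?S. (D b x u)\<^sup>2)"
      by (subst orthonormal_basis_inner[OF _ orthS _ spanS])
        (use B(1,2,6) x in \<open>auto simp: w inner_commute power2_eq_square\<close>)
    also have "\<dots> = (D b x x)\<^sup>2 + (\<Sum>u\<in>B0 \<union> B1. (D b x u)\<^sup>2)" using B(1,2) xnot by simp
    \<comment> \<open>Euler's relation, read off at t = 1 from homogeneity along the ray through
      x.\<close>
    also have "D b x x = real k * P b x"
    proof -
      have "((\<lambda>t. P b (0 + t *\<^sub>R x)) has_real_derivative D b (0 + 1 *\<^sub>R x) x) (at 1)"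
        by (rule DERIV_along_line[OF D[OF b]])
      moreover have "((\<lambda>t. P b (0 + t *\<^sub>R x)) has_real_derivative real k * P b x) (at 1)"
        unfolding add_0_left P(2)[OF b] by (auto intro!: derivative_eq_intros)
      ultimately show ?thesis using DERIV_unique by fastforce
    qed
    \<comment> \<open>Off the origin, component b of the radial extension of f is \<open>P b\<close>
      composed with y / |y|, and the derivative of y / |y| at x fixes the tangent vector u.\<close>
    also have "(\<Sum>u\<in>B0 \<union> B1. (D b x u)\<^sup>2) = (\<Sum>u\<in>B0 \<union> B1. (?A u \<bullet> b)\<^sup>2)"
    proof (intro sum.cong refl)
      fix u assume u: "u \<in> B0 \<union> B1"
      have o: "open (- {0::'a})" by (simp add: open_Compl)
      have nx: "x /\<^sub>R norm x = x" using x by simp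
      have "((\<lambda>y. P b (y /\<^sub>R norm y)) has_derivative (\<lambda>v. D b x (normalize_deriv x v))) (at x)"
        using has_derivative_compose[OF has_derivative_normalize[OF x0], of "P b" "D b x"] D[OF b] nx
            by simp
      then have "((\<lambda>y. radial_ext f y \<bullet> b) has_derivative (\<lambda>v. D b x (normalize_deriv x v))) (at x)"
        by (rule has_derivative_transform_within_open[OF _ o])
          (use x0 P(4)[OF b] in \<open>auto simp: radial_ext_def\<close>)
      moreover have "((\<lambda>y. radial_ext f y \<bullet> b) has_derivative (\<lambda>v. ?A v \<bullet> b)) (at x)"
        by (intro has_derivative_inner_left smooth_on_sphereD(1)[OF f x0])
      ultimately have "D b x (normalize_deriv x u) = ?A u \<bullet> b"
        by (blast dest: fun_cong has_derivative_unique)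
      moreover have "normalize_deriv x u = u"
        using T[OF u] x by (simp add: normalize_deriv_def inner_commute)
      ultimately show "(D b x u)\<^sup>2 = (?A u \<bullet> b)\<^sup>2" by simp
    qed
    finally show ?thesis .
  qed
  have A: "?A e \<bullet> ?A e = (if e \<in> B1 then lam\<^sup>2 else 0)" if e: "e \<in> B0 \<union> B1" for e
  proof -
    have eT: "e \<in> tangent_sphere x" "e \<bullet> e = 1" using T[OF e] B(6)[OF e]
        by (auto simp: tangent_sphere_def norm_eq_1)
    have sing: "?A e \<bullet> ?A e = \<mu>\<^sup>2" if "e \<in> singular_space f x \<mu>" for \<mu>
      using that eT unfolding singular_space_def by simp
    show ?thesis using sing[of lam] sing[of 0] e B(4,5) by auto
  qed
  have "(\<Sum>b\<in>Basis. (\<Sum>e\<in>Basis. (D b x e)\<^sup>2)) =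
      (\<Sum>b\<in>Basis. (real k * P b x)\<^sup>2) + (\<Sum>b\<in>Basis. \<Sum>e\<in>B0 \<union> B1. (?A e \<bullet> b)\<^sup>2)"
    by (simp add: change sum.distrib)
  also have "(\<Sum>b\<in>Basis. (real k * P b x)\<^sup>2) = (real k)\<^sup>2"
    using sq[of x] xx by (simp add: power_mult_distrib sum_distrib_left[symmetric])
  also have "(\<Sum>b\<in>Basis. \<Sum>e\<in>B0 \<union> B1. (?A e \<bullet> b)\<^sup>2) = (\<Sum>e\<in>B0 \<union> B1. ?A e \<bullet> ?A e)"
    by (subst sum.swap) (intro sum.cong refl, subst euclidean_inner, simp add: power2_eq_square)
  also have "\<dots> = (\<Sum>e\<in>B0 \<union> B1. if e \<in> B1 then lam\<^sup>2 else 0)"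
    by (intro sum.cong refl A)
  also have "\<dots> = (\<Sum>e\<in>B1. lam\<^sup>2)"
    using B(1-3) by (subst sum.inter_restrict[symmetric]) (auto intro: sum.cong)
  finally have "(\<Sum>b\<in>Basis. (\<Sum>e\<in>Basis. (D b x e)\<^sup>2)) = (real k)\<^sup>2 + real (card B1) * lam\<^sup>2" by simp
  with total k show ?thesis by (simp add: of_nat_diff power2_eq_square algebra_simps)
qed

section \<open>Partial derivatives of smooth variations\<close>

lemma has_vector_derivative_slices:
  fixes g :: "real \<times> real \<Rightarrow> 'c::real_normed_vector"
  assumes "(g has_derivative D) (at (s, t))"
  shows "((\<lambda>s. g (s, t)) has_vector_derivative D (1, 0)) (at s)"
    and "((\<lambda>t. g (s, t)) has_vector_derivative D (0, 1)) (at t)"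
proof -
  have lin: "linear D" using assms by (rule has_derivative_linear)
  have "((\<lambda>s. (s, t)) has_derivative (\<lambda>h. (h, 0))) (at s)"
    by (auto intro!: derivative_eq_intros)
  from has_derivative_compose[OF this, of g D] assms
  have "((\<lambda>s. g (s, t)) has_derivative (\<lambda>h. D (h, 0))) (at s)" by simp
  moreover have "(\<lambda>h. D (h, 0)) = (\<lambda>h. h *\<^sub>R D (1, 0))"
  proof
    show "D (h, 0) = h *\<^sub>R D (1, 0)" for h using linear_cmul[OF lin, of h "(1, 0)"] by simp
  qed
  ultimately show "((\<lambda>s. g (s, t)) has_vector_derivative D (1, 0)) (at s)"
    by (simp add: has_vector_derivative_def)
  have "((\<lambda>t. (s, t)) has_derivative (\<lambda>h. (0, h))) (at t)"
    by (auto intro!: derivative_eq_intros)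
  from has_derivative_compose[OF this, of g D] assms
  have "((\<lambda>t. g (s, t)) has_derivative (\<lambda>h. D (0, h))) (at t)" by simp
  moreover have "(\<lambda>h. D (0, h)) = (\<lambda>h. h *\<^sub>R D (0, 1))"
  proof
    show "D (0, h) = h *\<^sub>R D (0, 1)" for h using linear_cmul[OF lin, of h "(0, 1)"] by simp
  qed
  ultimately show "((\<lambda>t. g (s, t)) has_vector_derivative D (0, 1)) (at t)"
    by (simp add: has_vector_derivative_def)
qed

text \<open>Compare the two \<open>s\<close>-derivatives of \<open>g (s, t) - g (s, t0) = \<integral> V (s, u) du\<close>, then differentiate in \<open>t\<close>.\<close>

lemma mixed_partials_commute:
  fixes g :: "real \<times> real \<Rightarrow> 'c::euclidean_space"
  assumes S: "open S" "(s0, t0) \<in> S"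
    and g1: "\<And>s t. (s, t) \<in> S \<Longrightarrow> ((\<lambda>s. g (s, t)) has_vector_derivative X (s, t)) (at s)"
    and g2: "\<And>s t. (s, t) \<in> S \<Longrightarrow> ((\<lambda>t. g (s, t)) has_vector_derivative V (s, t)) (at t)"
    and V1: "\<And>s t. (s, t) \<in> S \<Longrightarrow> ((\<lambda>s. V (s, t)) has_vector_derivative V' (s, t)) (at s)"
    and X2: "((\<lambda>t. X (s0, t)) has_vector_derivative X') (at t0)"
    and cont: "continuous_on S V" "continuous_on S V'"
  shows "V' (s0, t0) = X'"
proof -
  obtain A B where AB: "open A" "open B" "s0 \<in> A" "t0 \<in> B" "A \<times> B \<subseteq> S"
    using open_prod_elim[OF S] by (metis mem_Sigma_iff)
  obtain d1 where d1: "d1 > 0" "cball s0 d1 \<subseteq> A" using AB open_contains_cball by blast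
  obtain d2 where d2: "d2 > 0" "cball t0 d2 \<subseteq> B" using AB open_contains_cball by blast
  define U where "U = {s0 - d1..s0 + d1}"
  have inS: "(s, t) \<in> S" if "s \<in> U" "t \<in> {t0..t0 + d2}" for s t
    using that AB d1 d2 by (auto simp: U_def subset_iff dist_real_def)
  have U: "convex U" "s0 \<in> U" using d1 by (auto simp: U_def)
  have sub: "U \<times> {t0..t} \<subseteq> S" if "t \<in> {t0..t0 + d2}" for t using inS that by auto
  have contV: "continuous_on {t0..t} (\<lambda>t. V (s, t))" if "s \<in> U" "t \<in> {t0..t0 + d2}" for s t
    by (rule continuous_on_compose2[OF cont(1), of _ "\<lambda>t. (s, t)"])
      (use that inS in \<open>auto intro!: continuous_intros\<close>)
  have contV': "continuous_on {t0..t0+d2} (\<lambda>t. V' (s0, t))"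
    by (rule continuous_on_compose2[OF cont(2), of _ "\<lambda>t. (s0, t)"])
      (use inS U in \<open>auto intro!: continuous_intros\<close>)
  have eq: "X (s0, t) = X (s0, t0) + integral {t0..t} (\<lambda>t. V' (s0, t))" if t: "t \<in> {t0..t0 + d2}" for t
  proof -
    have I: "integral {t0..t} (\<lambda>t. V (s, t)) = g (s, t) - g (s, t0)" if "s \<in> U" for s
      by (rule integral_unique, rule fundamental_theorem_of_calculus)
        (use t that inS in \<open>auto intro!: has_vector_derivative_at_within[OF g2]\<close>)
    have A: "((\<lambda>s. V (s, t')) has_vector_derivative V' (s, t')) (at s within U)"
      if "s \<in> U" "t' \<in> cbox t0 t" for s t'
    proof -
      have "(s, t') \<in> S" using that t by (intro inS) auto
      then show ?thesis by (rule has_vector_derivative_at_within[OF V1])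
    qed
    have B: "(\<lambda>t. V (s, t)) integrable_on cbox t0 t" if "s \<in> U" for s
      using contV[OF that t] by (simp add: integrable_continuous_real)
    have C: "continuous_on (U \<times> cbox t0 t) (\<lambda>(s, t). V' (s, t))"
      using continuous_on_subset[OF cont(2) sub[OF t]] by simp
    have "((\<lambda>s. integral (cbox t0 t) (\<lambda>t. V (s, t))) has_vector_derivative
        integral (cbox t0 t) (\<lambda>t. V' (s0, t))) (at s0 within U)"
      by (rule leibniz_rule_vector_derivative[where f = "\<lambda>s t. V (s, t)" and fx = "\<lambda>s t. V' (s, t)",
            OF A B C U(2,1)])
    then have "((\<lambda>s. integral {t0..t} (\<lambda>t. V (s, t))) has_vector_derivative
        integral {t0..t} (\<lambda>t. V' (s0, t))) (at s0 within U)" by simp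
    then have "((\<lambda>s. g (s, t) - g (s, t0)) has_vector_derivative
        integral {t0..t} (\<lambda>t. V' (s0, t))) (at s0 within U)"
      by (rule has_vector_derivative_transform[OF U(2), rotated]) (simp add: I)
    moreover have "((\<lambda>s. g (s, t) - g (s, t0)) has_vector_derivative X (s0, t) - X (s0, t0)) (at s0 within
        U)"
      using t inS U d2 by (intro has_vector_derivative_diff has_vector_derivative_at_within[OF g1]) auto
    moreover have "at s0 within U \<noteq> bot"
      using d1 by (simp add: U_def trivial_limit_within islimpt_Icc)
    ultimately have "X (s0, t) - X (s0, t0) = integral {t0..t} (\<lambda>t. V' (s0, t))"
      using vector_derivative_unique_within by blast
    then show ?thesis by (simp add: algebra_simps)
  qed
  have "((\<lambda>u. integral {t0..u} (\<lambda>t. V' (s0, t))) has_vector_derivative V' (s0, t0)) (at t0 within {t0..t0 +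
      d2})"
    using contV' d2 by (intro integral_has_vector_derivative) auto
  then have "((\<lambda>t. X (s0, t0) + integral {t0..t} (\<lambda>t. V' (s0, t))) has_vector_derivative V' (s0, t0))
      (at t0 within {t0..t0 + d2})"
    using has_vector_derivative_add[OF has_vector_derivative_const[of "X (s0, t0)"]] by fastforce
  then have "((\<lambda>t. X (s0, t)) has_vector_derivative V' (s0, t0)) (at t0 within {t0..t0 + d2})"
    by (rule has_vector_derivative_transform[rotated 2, OF _ _ eq]) (use d2 in simp)
  moreover have "((\<lambda>t. X (s0, t)) has_vector_derivative X') (at t0 within {t0..t0 + d2})"
    using X2 by (rule has_vector_derivative_at_within)
  moreover have "at t0 within {t0..t0 + d2} \<noteq> bot"
    using d2 by (simp add: trivial_limit_within islimpt_Icc)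
  ultimately show ?thesis using vector_derivative_unique_within by blast
qed

text \<open>X and Y are the first and second variation fields, V is the velocity of the curves. The
  point is the double role of X' and Y': as s-derivatives of V and of X' they serve to differentiate
  the speed, as t-derivatives of X and of Y they serve to integrate by parts.\<close>

lemma smooth_on_partials:
  fixes g :: "real \<times> real \<Rightarrow> 'c::euclidean_space"
  assumes g: "smooth_on S g" and S: "open S"
  obtains X Y V X' Y' where "continuous_on S X" "continuous_on S Y" "continuous_on S V"
    "continuous_on S X'" "continuous_on S Y'"
    "\<And>s t. (s, t) \<in> S \<Longrightarrow> ((\<lambda>s. g (s, t)) has_vector_derivative X (s, t)) (at s)"
    "\<And>s t. (s, t) \<in> S \<Longrightarrow> ((\<lambda>s. X (s, t)) has_vector_derivative Y (s, t)) (at s)"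
    "\<And>s t. (s, t) \<in> S \<Longrightarrow> ((\<lambda>t. g (s, t)) has_vector_derivative V (s, t)) (at t)"
    "\<And>s t. (s, t) \<in> S \<Longrightarrow> ((\<lambda>t. X (s, t)) has_vector_derivative X' (s, t)) (at t)"
    "\<And>s t. (s, t) \<in> S \<Longrightarrow> ((\<lambda>t. Y (s, t)) has_vector_derivative Y' (s, t)) (at t)"
    "\<And>s t. (s, t) \<in> S \<Longrightarrow> ((\<lambda>s. V (s, t)) has_vector_derivative X' (s, t)) (at s)"
    "\<And>s t. (s, t) \<in> S \<Longrightarrow> ((\<lambda>s. X' (s, t)) has_vector_derivative Y' (s, t)) (at s)"
proof -
  define Ps :: "(real \<times> real \<Rightarrow> 'c) \<Rightarrow> real \<times> real \<Rightarrow> 'c"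
    where "Ps h z = frechet_derivative h (at z) (1, 0)" for h z
  define Pt :: "(real \<times> real \<Rightarrow> 'c) \<Rightarrow> real \<times> real \<Rightarrow> 'c"
    where "Pt h z = frechet_derivative h (at z) (0, 1)" for h z
  have sm: "smooth_on S (Ps h)" "smooth_on S (Pt h)" if "smooth_on S h" for h
    using smooth_on_frechet_derivative[OF that] unfolding Ps_def[abs_def] Pt_def[abs_def] by auto
  have ds: "((\<lambda>s. h (s, t)) has_vector_derivative Ps h (s, t)) (at s)"
    and dt: "((\<lambda>t. h (s, t)) has_vector_derivative Pt h (s, t)) (at t)"
    if "smooth_on S h" "(s, t) \<in> S" for h s t
    using has_vector_derivative_slices[OF smooth_on_has_derivative[OF that(1) S that(2)]]
    by (auto simp: Ps_def Pt_def)
  have comm: "Ps (Pt h) z = Pt (Ps h) z" if h: "smooth_on S h" and z: "z \<in> S" for h z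
  proof -
    obtain s t where [simp]: "z = (s, t)" by (cases z)
    show ?thesis
      using mixed_partials_commute[OF S _ ds[OF h] dt[OF h] ds[OF sm(2)[OF h]] dt[OF sm(1)[OF h]]
          smooth_on_continuous_on[OF sm(2)[OF h]] smooth_on_continuous_on[OF sm(1)[OF sm(2)[OF h]]]] z
      by simp
  qed
  note g1 = sm[OF g] and g2 = sm(1)[OF sm(1)[OF g]]
  have Vs: "((\<lambda>s. Pt g (s, t)) has_vector_derivative Pt (Ps g) (s, t)) (at s)" if "(s, t) \<in> S" for s t
    using ds[OF g1(2) that] comm[OF g that] by simp
  have X's: "((\<lambda>s. Pt (Ps g) (s, t)) has_vector_derivative Pt (Ps (Ps g)) (s, t)) (at s)" if "(s, t) \<in> S"
      for s t
    using ds[OF sm(2)[OF g1(1)] that] comm[OF g1(1) that] by simp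
  show ?thesis
    by (rule that[of "Ps g" "Ps (Ps g)" "Pt g" "Pt (Ps g)" "Pt (Ps (Ps g))"])
      (auto intro: smooth_on_continuous_on sm g g1 g2 ds dt Vs X's)
qed

section \<open>The length density in logarithmic form and its second derivative\<close>

lemma exp_half_log_weight:
  fixes m r w :: real
  assumes "0 < m" "0 < r" "0 < w"
  shows "exp ((real p * ln m + 2 * real q * ln r + ln w) / 2) = sqrt (m ^ p * r ^ (2 * q) * w)"
proof -
  have "exp ((real p * ln m + 2 * real q * ln r + ln w) / 2) ^ 2
      = exp (real p * ln m + real (2 * q) * ln r + ln w)"
    by (simp add: power2_eq_square exp_add[symmetric])
  also have "\<dots> = m ^ p * r ^ (2 * q) * w"
    using assms by (simp only: exp_add exp_of_nat_mult exp_ln)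
  finally show ?thesis by (metis exp_ge_zero real_sqrt_unique)
qed

text \<open>For F = exp L one has F_s = F L_s and F_ss = F (L_s^2 + L_ss). As L is linear in p and
  q, no power of m or r has to be differentiated.\<close>

lemma log_weight_derivatives:
  fixes m r w m1 r1 w1 :: "real \<Rightarrow> real"
  assumes pos: "0 < m s" "0 < r s" "0 < w s"
    and d: "(m has_real_derivative m1 s) (at s)" "(r has_real_derivative r1 s) (at s)"
      "(w has_real_derivative w1 s) (at s)"
  shows "((\<lambda>s. exp ((p * ln (m s) + 2 * q * ln (r s) + ln (w s)) / 2)) has_real_derivative
      exp ((p * ln (m s) + 2 * q * ln (r s) + ln (w s)) / 2)
        * ((p * (m1 s / m s) + 2 * q * (r1 s / r s) + w1 s / w s) / 2)) (at s)"
    and "\<lbrakk>(m1 has_real_derivative m2) (at s); (r1 has_real_derivative r2) (at s);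
        (w1 has_real_derivative w2) (at s)\<rbrakk> \<Longrightarrow>
      ((\<lambda>s. (p * (m1 s / m s) + 2 * q * (r1 s / r s) + w1 s / w s) / 2) has_real_derivative
      (p * (m2 / m s - (m1 s / m s)\<^sup>2) + 2 * q * (r2 / r s - (r1 s / r s)\<^sup>2) + (w2 / w s - (w1 s / w s)\<^sup>2))
          / 2) (at s)"
proof -
  show "((\<lambda>s. exp ((p * ln (m s) + 2 * q * ln (r s) + ln (w s)) / 2)) has_real_derivative
      exp ((p * ln (m s) + 2 * q * ln (r s) + ln (w s)) / 2)
        * ((p * (m1 s / m s) + 2 * q * (r1 s / r s) + w1 s / w s) / 2)) (at s)"
    by (rule derivative_eq_intros d refl pos | simp)+ (use pos in \<open>simp add: field_simps\<close>)
  have quot: "((\<lambda>s. h1 s / h s) has_real_derivative h2 / h s - (h1 s / h s)\<^sup>2) (at s)"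
    if "0 < h s" "(h has_real_derivative h1 s) (at s)" "(h1 has_real_derivative h2) (at s)"
        for h h1 :: "real \<Rightarrow> real" and h2
    by (rule DERIV_cong[OF DERIV_divide[OF that(3,2)]])
      (use that(1) in \<open>auto simp: field_simps power2_eq_square\<close>)
  show "((\<lambda>s. (p * (m1 s / m s) + 2 * q * (r1 s / r s) + w1 s / w s) / 2) has_real_derivative
      (p * (m2 / m s - (m1 s / m s)\<^sup>2) + 2 * q * (r2 / r s - (r1 s / r s)\<^sup>2) + (w2 / w s - (w1 s / w s)\<^sup>2))
          / 2) (at s)"
    if "(m1 has_real_derivative m2) (at s)" "(r1 has_real_derivative r2) (at s)" "(w1 has_real_derivative
        w2) (at s)"
    by (intro DERIV_cdivide DERIV_add DERIV_cmult quot pos d that)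
qed

text \<open>The angle equation gives q T = p - n / A and turns p times the quotient into q + n / A,
  so that both sides become rational in p, q, A. Here A stands for \<open>lam^2\<close> and T for
  the square of tan \<theta>; the left side is minus the coefficient of y^2 in the second
  variation.\<close>

lemma curvature_identity:
  fixes p q n A T :: real
  assumes pos: "0 < p" "0 < q" "0 < A" and n: "n = p + q" and T0: "0 \<le> T"
    and ang: "q * (1 + A * T) = p * (A - 1)"
  shows "2 * q\<^sup>2 * T / p + q * T - p * ((T + A) / (1 + A * T)) = n - 2 * n\<^sup>2 / (p * A)"
proof -
  have T: "T = (p * A - n) / (q * A)" using ang pos n by (simp add: field_simps)
  have qT: "q * T = p - n / A" using pos by (simp add: T field_simps)
  have E: "1 + A * T = p * (A - 1) / q" using ang pos by (simp add: field_simps)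
  \<comment> \<open>The left side of the angle equation is positive, which excludes A = 1 and
    permits division by A - 1.\<close>
  have "0 < q * (1 + A * T)" using pos T0 by (simp add: add_pos_nonneg)
  then have False: "A \<noteq> 1" using ang by auto
  have "p * ((T + A) / (1 + A * T)) = q * (T + A) / (A - 1)"
    using False pos by (simp add: E field_simps)
  also have "q * (T + A) = (A - 1) * (q + n / A)"
    using pos n by (simp add: distrib_left qT) (simp add: field_simps)
  finally have g: "p * ((T + A) / (1 + A * T)) = q + n / A" using False by simp
  have "2 * q\<^sup>2 * T / p + q * T = (q * T) * (2 * q / p + 1)"
    using pos by (simp add: field_simps power2_eq_square)
  also have "\<dots> = (p - n / A) * (2 * q / p + 1)" by (simp only: qT)
  finally have qT2: "2 * q\<^sup>2 * T / p + q * T = (p - n / A) * (2 * q / p + 1)" .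
  show ?thesis unfolding g qT2 n using pos
    by (simp add: field_simps power2_eq_square)
qed

text \<open>
  At a point \<open>t\<close> of the ray \<open>(t, \<tau> t)\<close>, the first and second variations are split into the
  components \<open>x\<close>, \<open>x2\<close> along and \<open>y\<close>, \<open>y2\<close> across the ray, with a prime for \<open>t\<close>-derivatives. The left
  side is \<open>F\<^sub>s\<^sub>s / F\<close> for the length density \<open>F\<close>, computed from the logarithmic derivative of \<open>F\<close>.
\<close>

lemma second_variation_density:
  fixes p q n A \<tau> t x y x2 y2 x' y' x2' y2' :: real
  assumes pos: "0 < p" "0 < q" "0 < A" "0 < t" and n: "n = p + q"
    and ang: "q * (1 + A * \<tau>\<^sup>2) = p * (A - 1)"
  defines "r1 \<equiv> x - \<tau> * y" and "r2 \<equiv> x2 - \<tau> * y2" and "\<rho>1 \<equiv> \<tau> * x + y" and "\<rho>2 \<equiv> \<tau> * x2 + y2"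
    and "v1 \<equiv> x' - \<tau> * y'" and "v2 \<equiv> x2' - \<tau> * y2'" and "w1 \<equiv> \<tau> * x' + y'" and "w2 \<equiv> \<tau> * x2' + y2'"
    and "m \<equiv> t\<^sup>2 + A * (\<tau> * t)\<^sup>2"
  defines "m1 \<equiv> 2 * (t * r1 + A * (\<tau> * t * \<rho>1))"
    and "m2 \<equiv> 2 * (r1\<^sup>2 + t * r2 + A * (\<rho>1\<^sup>2 + \<tau> * t * \<rho>2))"
    and "c1 \<equiv> 2 * (1 * v1 + \<tau> * w1)"
    and "c2 \<equiv> 2 * (v1\<^sup>2 + 1 * v2 + (w1\<^sup>2 + \<tau> * w2))"
  shows "((p * (m1 / m) + 2 * q * (r1 / t) + c1 / (1 + \<tau>\<^sup>2)) / 2)\<^sup>2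
      + (p * (m2 / m - (m1 / m)\<^sup>2) + 2 * q * (r2 / t - (r1 / t)\<^sup>2) + (c2 / (1 + \<tau>\<^sup>2) - (c1 / (1 + \<tau>\<^sup>2))\<^sup>2))
          / 2
      = ((n\<^sup>2 - n) * x\<^sup>2 + n * t * x2 + 2 * n * t * x * x' + t\<^sup>2 * x2' + t\<^sup>2 * y'\<^sup>2
          - (n - 2 * n\<^sup>2 / (p * A)) * y\<^sup>2) / t\<^sup>2"
proof -
  define E where "E = 1 + A * \<tau>\<^sup>2"
  have E: "E > 0" using pos by (simp add: E_def add_pos_nonneg)
  have Q: "1 + \<tau>\<^sup>2 > 0" by (simp add: add_pos_nonneg)
  \<comment> \<open>The relative change of m is m1 / m = 2 (x + b y) / t, so b measures how m varies
    across the ray. Its value is fixed by the angle equation. Likewise g is the coefficient of y^2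
    in the second derivative.\<close>
  define b where "b = q * \<tau> / p"
  define g where "g = (\<tau>\<^sup>2 + A) / E"
  have pb: "p * b = q * \<tau>" using pos by (simp add: b_def)
  have bE: "b * E = \<tau> * (A - 1)"
  proof -
    have "p * (b * E) = \<tau> * (q * E)" using pb by (simp add: algebra_simps)
    also have "\<dots> = p * (\<tau> * (A - 1))" using ang by (simp add: E_def)
    finally show ?thesis using pos by simp
  qed
  have gE: "g * E = \<tau>\<^sup>2 + A" using E by (simp add: g_def)
  have m: "m = E * t\<^sup>2" by (simp add: m_def E_def power2_eq_square algebra_simps)
  have "m1 = 2 * t * (E * x + \<tau> * (A - 1) * y)"
    by (simp add: m1_def r1_def \<rho>1_def E_def power2_eq_square algebra_simps)
  also have "\<dots> = 2 * t * (E * x + b * E * y)" by (simp only: bE)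
  finally have mm1: "m1 / m = 2 * (x + b * y) / t"
    using pos E by (simp add: m field_simps power2_eq_square)
  have "m2 = 2 * (E * x\<^sup>2 + 2 * (\<tau> * (A - 1)) * x * y + (\<tau>\<^sup>2 + A) * y\<^sup>2 + t * (E * x2 + \<tau> * (A - 1) * y2))"
    by (simp add: m2_def r1_def \<rho>1_def r2_def \<rho>2_def E_def power2_eq_square algebra_simps)
  also have "\<dots> = 2 * (E * x\<^sup>2 + 2 * (b * E) * x * y + (g * E) * y\<^sup>2 + t * (E * x2 + b * E * y2))"
    by (simp only: bE gE)
  also have "\<dots> = E * (2 * (x\<^sup>2 + 2 * b * x * y + g * y\<^sup>2 + t * x2 + t * b * y2))"
    by (simp add: algebra_simps)
  finally have mm2: "m2 / m = 2 * (x\<^sup>2 + 2 * b * x * y + g * y\<^sup>2 + t * x2 + t * b * y2) / t\<^sup>2"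
    using E by (simp add: m)
  have "c1 = (1 + \<tau>\<^sup>2) * (2 * x')" by (simp add: c1_def v1_def w1_def power2_eq_square algebra_simps)
  then have cc1: "c1 / (1 + \<tau>\<^sup>2) = 2 * x'" using Q by simp
  have "c2 = (1 + \<tau>\<^sup>2) * (2 * (x'\<^sup>2 + y'\<^sup>2 + x2'))"
    by (simp add: c2_def v1_def w1_def v2_def w2_def power2_eq_square algebra_simps)
  then have cc2: "c2 / (1 + \<tau>\<^sup>2) = 2 * (x'\<^sup>2 + y'\<^sup>2 + x2')" using Q by simp
  \<comment> \<open>The normal component y cancels because p b = q \<tau>; this is the geodesic
    property of the ray.\<close>
  have L: "(p * (m1 / m) + 2 * q * (r1 / t) + c1 / (1 + \<tau>\<^sup>2)) / 2 = (n * x + t * x') / t"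
  proof -
    have "p * (m1 / m) + 2 * q * (r1 / t) + c1 / (1 + \<tau>\<^sup>2)
        = 2 * ((n * x + t * x' + (p * b - q * \<tau>) * y) / t)"
      unfolding mm1 cc1 r1_def n using pos by (simp add: field_simps)
    also have "\<dots> = 2 * ((n * x + t * x') / t)" by (simp add: pb)
    finally have S: "p * (m1 / m) + 2 * q * (r1 / t) + c1 / (1 + \<tau>\<^sup>2) = 2 * ((n * x + t * x') / t)" .
    show ?thesis unfolding S by (rule nonzero_mult_div_cancel_left) simp
  qed
  have kappa: "q * \<tau>\<^sup>2 + 2 * p * b\<^sup>2 - p * g = n - 2 * n\<^sup>2 / (p * A)"
    using curvature_identity[OF pos(1-3) n zero_le_power2 ang] pos
    by (simp add: b_def g_def E_def power2_eq_square field_simps)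
  have "(p * (m2 / m - (m1 / m)\<^sup>2) + 2 * q * (r2 / t - (r1 / t)\<^sup>2) + (c2 / (1 + \<tau>\<^sup>2) - (c1 / (1 + \<tau>\<^sup>2))\<^sup>2))
      / 2
      = (- n * x\<^sup>2 + n * t * x2 - 2 * (p * b - q * \<tau>) * x * y + t * (p * b - q * \<tau>) * y2
          - (q * \<tau>\<^sup>2 + 2 * p * b\<^sup>2 - p * g) * y\<^sup>2 + t\<^sup>2 * (y'\<^sup>2 + x2' - x'\<^sup>2)) / t\<^sup>2"
    unfolding mm1 mm2 cc1 cc2 r1_def r2_def n using pos
    by (simp add: field_simps power2_eq_square)
  also have "\<dots> = (- n * x\<^sup>2 + n * t * x2 - (n - 2 * n\<^sup>2 / (p * A)) * y\<^sup>2 + t\<^sup>2 * (y'\<^sup>2 + x2' - x'\<^sup>2)) / t\<^sup>2"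
    by (simp add: kappa pb)
  finally have L': "(p * (m2 / m - (m1 / m)\<^sup>2) + 2 * q * (r2 / t - (r1 / t)\<^sup>2)
        + (c2 / (1 + \<tau>\<^sup>2) - (c1 / (1 + \<tau>\<^sup>2))\<^sup>2)) / 2
      = (- n * x\<^sup>2 + n * t * x2 - (n - 2 * n\<^sup>2 / (p * A)) * y\<^sup>2 + t\<^sup>2 * (y'\<^sup>2 + x2' - x'\<^sup>2)) / t\<^sup>2" .
  show ?thesis
    unfolding L L' unfolding power_divide add_divide_distrib[symmetric]
    by (rule arg_cong[where f = "\<lambda>u. u / t\<^sup>2"]) (simp add: power2_eq_square algebra_simps)
qed

section \<open>The second variation formula\<close>

lemma continuous_on_g0:
  assumes "continuous_on S c" "continuous_on S v"
  shows "continuous_on S (\<lambda>t. sqrt (g0 n p lam (c t) (v t) (v t)))"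
  unfolding g0_def by (intro continuous_intros assms)

text \<open>The outer pieces follow the ray, so their length does not depend on the variation. The
  strict inequalities keep them off the closed interval [a0, b0]; its complement is open, so the
  velocities agree there too.\<close>

lemma g0_length_split:
  fixes c :: "real \<Rightarrow> real \<times> real" and n p :: nat and lam \<theta> :: real
  assumes ab: "0 < a" "a < a0" "a0 \<le> b0" "b0 < b" "b < 1"
    and c: "\<And>t. 0 < t \<Longrightarrow> t < 1 \<Longrightarrow> (c has_vector_derivative v t) (at t)"
    and loc: "\<And>t. 0 < t \<Longrightarrow> t < 1 \<Longrightarrow> t \<notin> {a0..b0} \<Longrightarrow> c t = LOC_segment \<theta> t"
    and v: "continuous_on {a..b} v"
  defines "\<phi> \<equiv> \<lambda>t. sqrt (g0 n p lam (LOC_segment \<theta> t) (1, tan \<theta>) (1, tan \<theta>))"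
  shows "g0_length n p lam c = integral {0..a} \<phi>
    + integral {a..b} (\<lambda>t. sqrt (g0 n p lam (c t) (v t) (v t))) + integral {b..1} \<phi>"
proof -
  define h where "h t = (let c' = vector_derivative c (at t within {0<..1}) in sqrt (g0 n p lam (c t) c'
      c'))" for t
  have vd: "vector_derivative c (at t within {0<..1}) = v t" if "0 < t" "t < 1" for t
  proof -
    have "t \<in> interior {0<..1::real}"
      using that interior_maximal[of "{0<..<1::real}" "{0<..1}"] by auto
    then have "at t within {0<..1} = at t" by (rule at_within_interior)
    then show ?thesis using c[OF that] by (simp add: vector_derivative_at)
  qed
  have vloc: "v t = (1, tan \<theta>)" if t: "0 < t" "t < 1" "t \<notin> {a0..b0}" for t
  proof -
    have "(LOC_segment \<theta> has_vector_derivative (1, tan \<theta>)) (at t)"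
      unfolding LOC_segment_def[abs_def] has_vector_derivative_def
      by (auto intro!: derivative_eq_intros)
    moreover have "open ({0<..<1} - {a0..b0})" by (intro open_Diff) auto
    ultimately have "(c has_vector_derivative (1, tan \<theta>)) (at t)"
      by (rule has_vector_derivative_transform_within_open) (use t loc in auto)
    with c[OF t(1,2)] show ?thesis by (rule vector_derivative_unique_at)
  qed
  have cont_\<phi>: "continuous_on X \<phi>" for X
    unfolding \<phi>_def LOC_segment_def by (intro continuous_on_g0 continuous_intros)
  have I\<phi>: "(\<phi> has_integral integral {u..w} \<phi>) {u..w}" for u w
    by (intro integrable_integral integrable_continuous_real cont_\<phi>)
  \<comment> \<open>The endpoints are treated as null sets: nothing is known about c at 0, and its
    one-sided derivative at 1 is not determined by the hypotheses.\<close>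
  have "(h has_integral integral {0..a} \<phi>) {0..a}"
    by (rule has_integral_spike_finite[where S = "{0}" and f = \<phi>])
      (use ab loc vd vloc I\<phi> in \<open>auto simp: h_def \<phi>_def Let_def\<close>)
  moreover have "(h has_integral integral {b..1} \<phi>) {b..1}"
    by (rule has_integral_spike_finite[where S = "{1}" and f = \<phi>])
      (use ab loc vd vloc I\<phi> in \<open>auto simp: h_def \<phi>_def Let_def\<close>)
  moreover have "(h has_integral integral {a..b} (\<lambda>t. sqrt (g0 n p lam (c t) (v t) (v t)))) {a..b}"
  proof (rule has_integral_spike_finite[where S = "{}" and f = "\<lambda>t. sqrt (g0 n p lam (c t) (v t) (v t))"])
    have "continuous_on {a..b} c"
      using ab by (intro continuous_at_imp_continuous_on ballI has_vector_derivative_continuous[OF c]) auto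
    then show "((\<lambda>t. sqrt (g0 n p lam (c t) (v t) (v t))) has_integral
        integral {a..b} (\<lambda>t. sqrt (g0 n p lam (c t) (v t) (v t)))) {a..b}"
      by (intro integrable_integral integrable_continuous_real continuous_on_g0 v)
  qed (use ab vd in \<open>auto simp: h_def Let_def\<close>)
  ultimately have "(h has_integral integral {0..a} \<phi>
    + integral {a..b} (\<lambda>t. sqrt (g0 n p lam (c t) (v t) (v t))) + integral {b..1} \<phi>) {0..1}"
    using ab by (intro has_integral_combine[of 0 b 1] has_integral_combine[of 0 a b]) auto
  then have "integral {0..1} h = integral {0..a} \<phi>
    + integral {a..b} (\<lambda>t. sqrt (g0 n p lam (c t) (v t) (v t))) + integral {b..1} \<phi>"
    by (rule integral_unique)
  moreover have "integral {0<..1} h = integral {0..1} h"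
  proof (rule integral_spike_set)
    have "{x \<in> {0..1} - {0<..1}. h x \<noteq> 0} \<subseteq> {0}" by auto
    then show "negligible {x \<in> {0..1} - {0<..1}. h x \<noteq> 0}" by (rule negligible_subset[rotated]) simp
    have "{x \<in> {0<..1} - {0..1}. h x \<noteq> 0} = {}" by auto
    then show "negligible {x \<in> {0<..1} - {0..1}. h x \<noteq> 0}" by (metis negligible_empty)
  qed
  ultimately show ?thesis by (simp add: g0_length_def h_def[abs_def])
qed

text \<open>Leibniz's rule twice. The representation of L is required on a neighbourhood of 0
  because the outer derivative sees \<open>deriv L\<close> near 0 and not only at 0; k collects the
  unvaried pieces of the length.\<close>

lemma second_deriv_under_integral:
  fixes F :: "real \<Rightarrow> real \<Rightarrow> real"
  assumes \<delta>: "0 < \<delta>"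
    and L: "\<And>s. \<bar>s\<bar> < \<delta> \<Longrightarrow> L s = k + integral {a..b} (F s)"
    and F: "\<And>s t. \<bar>s\<bar> < \<delta> \<Longrightarrow> t \<in> {a..b} \<Longrightarrow> ((\<lambda>s. F s t) has_real_derivative F1 s t) (at s)"
    and F1: "\<And>s t. \<bar>s\<bar> < \<delta> \<Longrightarrow> t \<in> {a..b} \<Longrightarrow> ((\<lambda>s. F1 s t) has_real_derivative F2 s t) (at s)"
    and cont: "continuous_on ({-\<delta><..<\<delta>} \<times> {a..b}) (\<lambda>(s, t). F s t)"
      "continuous_on ({-\<delta><..<\<delta>} \<times> {a..b}) (\<lambda>(s, t). F1 s t)"
      "continuous_on ({-\<delta><..<\<delta>} \<times> {a..b}) (\<lambda>(s, t). F2 s t)"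
  shows "deriv (deriv L) 0 = integral {a..b} (F2 0)"
proof -
  let ?U = "{-\<delta><..<\<delta>}"
  have U: "open ?U" "convex ?U" "0 \<in> ?U" using \<delta> by auto
  have slice: "h s integrable_on cbox a b"
    if "continuous_on (?U \<times> {a..b}) (\<lambda>(s, t). h s t)" "s \<in> ?U" for h :: "real \<Rightarrow> real \<Rightarrow> real" and s
  proof -
    have "continuous_on {a..b} (\<lambda>t. (\<lambda>(s, t). h s t) (s, t))"
      by (rule continuous_on_compose2[OF that(1)]) (use that(2) in \<open>auto intro!: continuous_intros\<close>)
    then show ?thesis by (simp add: integrable_continuous_real)
  qed
  have d1: "((\<lambda>s. integral {a..b} (F s)) has_real_derivative integral {a..b} (F1 s)) (at s)" if "s \<in> ?U"
      for s
  proof -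
    have "((\<lambda>s. integral (cbox a b) (F s)) has_real_derivative integral (cbox a b) (F1 s)) (at s within ?U)"
    proof (rule leibniz_rule_field_derivative[OF _ slice[OF cont(1)] _ that U(2)])
      show "((\<lambda>s. F s t) has_real_derivative F1 s t) (at s within ?U)" if "s \<in> ?U" "t \<in> cbox a b" for s t
        using that by (intro has_field_derivative_at_within[OF F]) auto
    qed (use cont in auto)
    then show ?thesis using at_within_open[OF that U(1)] by simp
  qed
  have d2: "((\<lambda>s. integral {a..b} (F1 s)) has_real_derivative integral {a..b} (F2 0)) (at 0)"
  proof -
    have "((\<lambda>s. integral (cbox a b) (F1 s)) has_real_derivative integral (cbox a b) (F2 0)) (at 0 within
        ?U)"
    proof (rule leibniz_rule_field_derivative[OF _ slice[OF cont(2)] _ U(3,2)])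
      show "((\<lambda>s. F1 s t) has_real_derivative F2 s t) (at s within ?U)" if "s \<in> ?U" "t \<in> cbox a b" for s t
        using that by (intro has_field_derivative_at_within[OF F1]) auto
    qed (use cont in auto)
    then show ?thesis using at_within_open[OF U(3,1)] by simp
  qed
  have "deriv L s = integral {a..b} (F1 s)" if "s \<in> ?U" for s
  proof (rule DERIV_imp_deriv)
    have "((\<lambda>s. k + integral {a..b} (F s)) has_real_derivative integral {a..b} (F1 s)) (at s)"
      using d1[OF that] by (auto intro!: derivative_eq_intros)
    then show "(L has_real_derivative integral {a..b} (F1 s)) (at s)"
      by (rule has_field_derivative_transform_within_open[OF _ U(1) that]) (use L in auto)
  qed
  then have "(deriv L has_real_derivative integral {a..b} (F2 0)) (at 0)"
    by (intro has_field_derivative_transform_within_open[OF d2 U(1,3)]) simp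
  then show ?thesis by (rule DERIV_imp_deriv)
qed

text \<open>Uniform continuity on a compact rectangle gives one \<delta> for all t. The lemma is
  applied to the squared speed, which is 1 + \<tau>^2 on the ray; hence the bound 1.\<close>

lemma uniform_tube_positive:
  fixes Q :: "real \<times> real \<Rightarrow> real"
  assumes "continuous_on ({-\<epsilon><..<\<epsilon>} \<times> {a..b}) Q" "0 < \<epsilon>" and pos: "\<And>t. t \<in> {a..b} \<Longrightarrow> 1 \<le> Q (0, t)"
  obtains \<delta> where "0 < \<delta>" "\<delta> \<le> \<epsilon>" "\<And>s t. \<bar>s\<bar> < \<delta> \<Longrightarrow> t \<in> {a..b} \<Longrightarrow> 0 < Q (s, t)"
proof -
  let ?K = "{-\<epsilon>/2..\<epsilon>/2} \<times> {a..b}"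
  have "continuous_on ?K Q" by (rule continuous_on_subset[OF assms(1)]) (use assms(2) in auto)
  moreover have "compact ?K" by (intro compact_Times) auto
  ultimately have "uniformly_continuous_on ?K Q" by (rule compact_uniformly_continuous)
  then obtain d where d: "d > 0" "\<And>z z'. z \<in> ?K \<Longrightarrow> z' \<in> ?K \<Longrightarrow> dist z' z < d \<Longrightarrow> dist (Q z') (Q z) < 1"
    unfolding uniformly_continuous_on_def by (metis zero_less_one)
  show ?thesis
  proof (rule that[of "min d (\<epsilon>/2)"])
    fix s t assume st: "\<bar>s\<bar> < min d (\<epsilon>/2)" "t \<in> {a..b}"
    have "dist (Q (s, t)) (Q (0, t)) < 1"
      using st assms(2) by (intro d(2)) (auto simp: dist_Pair_Pair dist_real_def)
    with pos[OF st(2)] show "0 < Q (s, t)" by (auto simp: dist_real_def)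
  qed (use d assms(2) in auto)
qed

lemma sphere_volume_pos: "0 < sphere_volume n"
  by (simp add: sphere_volume_def)

text \<open>Only the normal component z survives, and any window [a, b] around its support may be
  used. The derivative condition determines z from \<Gamma>, so a variation built from a prescribed
  function can be matched with it; the factor there is the squared length of the normal vector (-
  tan \<theta>, 1).\<close>

lemma second_variation_formula:
  fixes \<Gamma> :: "real \<Rightarrow> real \<Rightarrow> real \<times> real"
  assumes cv: "compact_variation \<theta> \<Gamma>" and pn: "0 < p" "p < n" and lam: "0 < lam"
    and ang: "real (n - p) * (1 + lam\<^sup>2 * (tan \<theta>)\<^sup>2) = real p * (lam\<^sup>2 - 1)"
  shows "\<exists>a0 b0 z z'. 0 < a0 \<and> a0 < b0 \<and> b0 < 1 \<and>
    (\<forall>t. 0 < t \<longrightarrow> t < 1 \<longrightarrow>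
      ((\<lambda>s. snd (\<Gamma> s t) - tan \<theta> * fst (\<Gamma> s t)) has_real_derivative (1 + (tan \<theta>)\<^sup>2) * z t) (at 0)) \<and>
    (\<forall>t. 0 < t \<longrightarrow> t < 1 \<longrightarrow> (z has_real_derivative z' t) (at t)) \<and>
    continuous_on {0<..<1} z' \<and>
    (\<forall>t. 0 < t \<longrightarrow> t < 1 \<longrightarrow> t \<notin> {a0..b0} \<longrightarrow> z t = 0) \<and>
    (\<forall>a b. 0 < a \<longrightarrow> a < a0 \<longrightarrow> b0 < b \<longrightarrow> b < 1 \<longrightarrow> second_variation n p lam \<Gamma> =
      sphere_volume n * sqrt ((1 + lam\<^sup>2 * (tan \<theta>)\<^sup>2) ^ p * (1 + (tan \<theta>)\<^sup>2)) *
      integral {a..b} (\<lambda>t. t ^ n * (z' t)\<^sup>2 - (real n - 2 * (real n)\<^sup>2 / (real p * lam\<^sup>2)) * (t ^ (n - 2) *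
          (z t)\<^sup>2)))"
proof -
  define \<tau> where "\<tau> = tan \<theta>"
  define q where "q = n - p"
  define A where "A = lam\<^sup>2"
  have q: "0 < q" "n = p + q" using pn by (auto simp: q_def)
  have A: "0 < A" using lam by (simp add: A_def)
  have ang': "real q * (1 + A * \<tau>\<^sup>2) = real p * (A - 1)" using ang by (simp add: q_def A_def \<tau>_def)
  from cv obtain \<epsilon> a0 b0 where \<epsilon>: "0 < \<epsilon>" and ab0: "0 < a0" "a0 < b0" "b0 < 1"
    and sm: "smooth_on ({-\<epsilon><..<\<epsilon>} \<times> {0<..<1}) (\<lambda>(s, t). \<Gamma> s t)"
    and \<Gamma>0: "\<And>t. t \<in> {0<..1} \<Longrightarrow> \<Gamma> 0 t = LOC_segment \<theta> t"
    and \<Gamma>pos: "\<And>s t. s \<in> {-\<epsilon><..<\<epsilon>} \<Longrightarrow> t \<in> {0<..1} \<Longrightarrow> 0 < fst (\<Gamma> s t)"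
    and \<Gamma>loc: "\<And>s t. s \<in> {-\<epsilon><..<\<epsilon>} \<Longrightarrow> t \<in> {0<..1} \<Longrightarrow> t \<notin> {a0..b0} \<Longrightarrow> \<Gamma> s t = LOC_segment \<theta> t"
    unfolding compact_variation_def by blast
  let ?S = "{-\<epsilon><..<\<epsilon>} \<times> {0<..<1::real}"
  have S: "open ?S" by (intro open_Times) auto
  define g where "g = (\<lambda>(s, t). \<Gamma> s t)"
  have g: "smooth_on ?S g" using sm by (simp add: g_def)
  obtain X Y V X' Y' where cont: "continuous_on ?S X" "continuous_on ?S Y" "continuous_on ?S V"
    "continuous_on ?S X'" "continuous_on ?S Y'"
    and dX: "\<And>s t. (s, t) \<in> ?S \<Longrightarrow> ((\<lambda>s. g (s, t)) has_vector_derivative X (s, t)) (at s)"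
    and dY: "\<And>s t. (s, t) \<in> ?S \<Longrightarrow> ((\<lambda>s. X (s, t)) has_vector_derivative Y (s, t)) (at s)"
    and dV: "\<And>s t. (s, t) \<in> ?S \<Longrightarrow> ((\<lambda>t. g (s, t)) has_vector_derivative V (s, t)) (at t)"
    and dX': "\<And>s t. (s, t) \<in> ?S \<Longrightarrow> ((\<lambda>t. X (s, t)) has_vector_derivative X' (s, t)) (at t)"
    and dY': "\<And>s t. (s, t) \<in> ?S \<Longrightarrow> ((\<lambda>t. Y (s, t)) has_vector_derivative Y' (s, t)) (at t)"
    and dVs: "\<And>s t. (s, t) \<in> ?S \<Longrightarrow> ((\<lambda>s. V (s, t)) has_vector_derivative X' (s, t)) (at s)"
    and dX's: "\<And>s t. (s, t) \<in> ?S \<Longrightarrow> ((\<lambda>s. X' (s, t)) has_vector_derivative Y' (s, t)) (at s)"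
    using smooth_on_partials[OF g S] by blast
  note cont_g = smooth_on_continuous_on[OF g]
  have fs: "((\<lambda>u. fst (h u)) has_real_derivative fst D) (at u)"
    and sn: "((\<lambda>u. snd (h u)) has_real_derivative snd D) (at u)"
    if "(h has_vector_derivative D) (at u)" for h :: "real \<Rightarrow> real \<times> real" and D u
    using bounded_linear.has_vector_derivative[OF bounded_linear_fst that]
      bounded_linear.has_vector_derivative[OF bounded_linear_snd that]
    by (simp_all add: has_real_derivative_iff_has_vector_derivative)
  \<comment> \<open>The fields X and Y vanish where the curves do not move; this supplies the
    boundary values for the integration by parts.\<close>
  have X0: "X (s, t) = 0" if st: "(s, t) \<in> ?S" "t \<notin> {a0..b0}" for s t
  proof -
    have "((\<lambda>s. g (s, t)) has_vector_derivative 0) (at s)"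
      by (rule has_vector_derivative_transform_within_open[OF has_vector_derivative_const[of "LOC_segment \<theta>
          t"],
            of "{-\<epsilon><..<\<epsilon>}"])
        (use st \<Gamma>loc in \<open>auto simp: g_def\<close>)
    with dX[OF st(1)] show ?thesis by (rule vector_derivative_unique_at)
  qed
  have Y0: "Y (s, t) = 0" if st: "(s, t) \<in> ?S" "t \<notin> {a0..b0}" for s t
  proof -
    have "((\<lambda>s. X (s, t)) has_vector_derivative 0) (at s)"
      by (rule has_vector_derivative_transform_within_open[OF has_vector_derivative_const[of 0],
            of "{-\<epsilon><..<\<epsilon>}"])
        (use st X0 in \<open>auto simp: g_def\<close>)
    with dY[OF st(1)] show ?thesis by (rule vector_derivative_unique_at)
  qed
  have V0: "V (0, t) = (1, \<tau>)" if t: "t \<in> {0<..<1}" for t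
  proof -
    have "(LOC_segment \<theta> has_vector_derivative (1, \<tau>)) (at t)"
      unfolding LOC_segment_def[abs_def] has_vector_derivative_def
      by (auto intro!: derivative_eq_intros simp: \<tau>_def)
    then have "((\<lambda>t. g (0, t)) has_vector_derivative (1, \<tau>)) (at t)"
      by (rule has_vector_derivative_transform_within_open[of _ _ _ "{0<..<1}"])
        (use t \<Gamma>0 in \<open>auto simp: g_def\<close>)
    then show ?thesis using vector_derivative_unique_at[OF dV[of 0 t]] t \<epsilon> by auto
  qed
  have g0: "g (0, t) = (t, \<tau> * t)" if "t \<in> {0<..<1}" for t
    using \<Gamma>0[of t] that by (auto simp: g_def LOC_segment_def \<tau>_def)

  \<comment> \<open>The squared density is a constant times powers of m and of r = fst g, times the
    squared speed c. Suffixes 1 and 2 mark s-derivatives.\<close>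
  define m where "m w = (fst (g w))\<^sup>2 + A * (snd (g w))\<^sup>2" for w
  define m1 where "m1 w = 2 * (fst (g w) * fst (X w) + A * (snd (g w) * snd (X w)))" for w
  define m2 where "m2 w = 2 * ((fst (X w))\<^sup>2 + fst (g w) * fst (Y w) + A * ((snd (X w))\<^sup>2 + snd (g w) * snd
      (Y w)))" for w
  define c where "c w = (fst (V w))\<^sup>2 + (snd (V w))\<^sup>2" for w
  define c1 where "c1 w = 2 * (fst (V w) * fst (X' w) + snd (V w) * snd (X' w))" for w
  define c2 where "c2 w = 2 * ((fst (X' w))\<^sup>2 + fst (V w) * fst (Y' w) + ((snd (X' w))\<^sup>2 + snd (V w) * snd
      (Y' w)))" for w
  have conts: "continuous_on ?S m" "continuous_on ?S m1" "continuous_on ?S m2"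
    "continuous_on ?S c" "continuous_on ?S c1" "continuous_on ?S c2"
    "continuous_on ?S (\<lambda>w. fst (g w))" "continuous_on ?S (\<lambda>w. fst (X w))" "continuous_on ?S (\<lambda>w. fst (Y w))"
    unfolding m_def[abs_def] m1_def[abs_def] m2_def[abs_def] c_def[abs_def] c1_def[abs_def] c2_def[abs_def]
    by (intro continuous_intros cont cont_g)+
  have dm: "((\<lambda>s. m (s, t)) has_real_derivative m1 (s, t)) (at s)"
    and dm1: "((\<lambda>s. m1 (s, t)) has_real_derivative m2 (s, t)) (at s)"
    and dc: "((\<lambda>s. c (s, t)) has_real_derivative c1 (s, t)) (at s)"
    and dc1: "((\<lambda>s. c1 (s, t)) has_real_derivative c2 (s, t)) (at s)"
    if st: "(s, t) \<in> ?S" for s t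
  proof -
    note d = fs[OF dX[OF st]] sn[OF dX[OF st]] fs[OF dY[OF st]] sn[OF dY[OF st]]
      fs[OF dVs[OF st]] sn[OF dVs[OF st]] fs[OF dX's[OF st]] sn[OF dX's[OF st]]
    show "((\<lambda>s. m (s, t)) has_real_derivative m1 (s, t)) (at s)"
      unfolding m_def m1_def by (rule derivative_eq_intros d refl)+ (simp add: algebra_simps)
    show "((\<lambda>s. m1 (s, t)) has_real_derivative m2 (s, t)) (at s)"
      unfolding m1_def m2_def by (rule derivative_eq_intros d refl)+ (simp add: power2_eq_square
          algebra_simps)
    show "((\<lambda>s. c (s, t)) has_real_derivative c1 (s, t)) (at s)"
      unfolding c_def c1_def by (rule derivative_eq_intros d refl)+ (simp add: algebra_simps)
    show "((\<lambda>s. c1 (s, t)) has_real_derivative c2 (s, t)) (at s)"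
      unfolding c1_def c2_def by (rule derivative_eq_intros d refl)+ (simp add: power2_eq_square
          algebra_simps)
  qed
  have c0: "c (0, t) = 1 + \<tau>\<^sup>2" if "t \<in> {0<..<1}" for t using V0[OF that] by (simp add: c_def)
  \<comment> \<open>Components in the orthogonal basis (1, \<tau>), (- \<tau>, 1), whose vectors
    both have squared length 1 + \<tau>^2.\<close>
  define x where "x t = (fst (X (0, t)) + \<tau> * snd (X (0, t))) / (1 + \<tau>\<^sup>2)" for t
  define z where "z t = (snd (X (0, t)) - \<tau> * fst (X (0, t))) / (1 + \<tau>\<^sup>2)" for t
  define x2 where "x2 t = (fst (Y (0, t)) + \<tau> * snd (Y (0, t))) / (1 + \<tau>\<^sup>2)" for t
  define z2 where "z2 t = (snd (Y (0, t)) - \<tau> * fst (Y (0, t))) / (1 + \<tau>\<^sup>2)" for t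
  define x' where "x' t = (fst (X' (0, t)) + \<tau> * snd (X' (0, t))) / (1 + \<tau>\<^sup>2)" for t
  define z' where "z' t = (snd (X' (0, t)) - \<tau> * fst (X' (0, t))) / (1 + \<tau>\<^sup>2)" for t
  define x2' where "x2' t = (fst (Y' (0, t)) + \<tau> * snd (Y' (0, t))) / (1 + \<tau>\<^sup>2)" for t
  define z2' where "z2' t = (snd (Y' (0, t)) - \<tau> * fst (Y' (0, t))) / (1 + \<tau>\<^sup>2)" for t
  have Q: "1 + \<tau>\<^sup>2 > 0" by (simp add: add_pos_nonneg)
  have rot: "r = (r + \<tau> * \<rho>) / (1 + \<tau>\<^sup>2) - \<tau> * ((\<rho> - \<tau> * r) / (1 + \<tau>\<^sup>2))"
    "\<rho> = \<tau> * ((r + \<tau> * \<rho>) / (1 + \<tau>\<^sup>2)) + (\<rho> - \<tau> * r) / (1 + \<tau>\<^sup>2)" for r \<rho>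
  proof -
    have "(r + \<tau> * \<rho>) - \<tau> * (\<rho> - \<tau> * r) = r * (1 + \<tau>\<^sup>2)" "\<tau> * (r + \<tau> * \<rho>) + (\<rho> - \<tau> * r) = \<rho> * (1 + \<tau>\<^sup>2)"
      by (simp_all add: power2_eq_square algebra_simps)
    then have "((r + \<tau> * \<rho>) - \<tau> * (\<rho> - \<tau> * r)) / (1 + \<tau>\<^sup>2) = r" "(\<tau> * (r + \<tau> * \<rho>) + (\<rho> - \<tau> * r)) / (1 + \<tau>\<^sup>2)
        = \<rho>"
      using Q by simp_all
    then show "r = (r + \<tau> * \<rho>) / (1 + \<tau>\<^sup>2) - \<tau> * ((\<rho> - \<tau> * r) / (1 + \<tau>\<^sup>2))"
      "\<rho> = \<tau> * ((r + \<tau> * \<rho>) / (1 + \<tau>\<^sup>2)) + (\<rho> - \<tau> * r) / (1 + \<tau>\<^sup>2)"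
      by (simp_all only: times_divide_eq_right diff_divide_distrib[symmetric] add_divide_distrib[symmetric])
  qed
  have comps: "fst (X (0, t)) = x t - \<tau> * z t" "snd (X (0, t)) = \<tau> * x t + z t"
    "fst (Y (0, t)) = x2 t - \<tau> * z2 t" "snd (Y (0, t)) = \<tau> * x2 t + z2 t"
    "fst (X' (0, t)) = x' t - \<tau> * z' t" "snd (X' (0, t)) = \<tau> * x' t + z' t"
    "fst (Y' (0, t)) = x2' t - \<tau> * z2' t" "snd (Y' (0, t)) = \<tau> * x2' t + z2' t" for t
    unfolding x_def z_def x2_def z2_def x'_def z'_def x2'_def z2'_def by (rule rot)+
  define C where "C = sqrt ((1 + A * \<tau>\<^sup>2) ^ p * (1 + \<tau>\<^sup>2))"
  define \<kappa> where "\<kappa> = real n - 2 * (real n)\<^sup>2 / (real p * A)"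
  have n2: "2 \<le> n" using pn by simp
  have S0: "(0, t) \<in> ?S" if "0 < t" "t < 1" for t using that \<epsilon> by auto
  have dx: "(x has_real_derivative x' t) (at t)" and dx2: "(x2 has_real_derivative x2' t) (at t)"
    and dz: "(z has_real_derivative z' t) (at t)"
    if "0 < t" "t < 1" for t
  proof -
    note d = fs[OF dX'[OF S0[OF that]]] sn[OF dX'[OF S0[OF that]]] fs[OF dY'[OF S0[OF that]]] sn[OF dY'[OF
        S0[OF that]]]
    show "(x has_real_derivative x' t) (at t)" "(x2 has_real_derivative x2' t) (at t)" "(z
        has_real_derivative z' t) (at t)"
      unfolding x_def[abs_def] x'_def x2_def[abs_def] x2'_def z_def[abs_def] z'_def
      by (intro DERIV_cdivide DERIV_add DERIV_diff DERIV_cmult d)+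
  qed
  have contX': "continuous_on {0<..<1} (\<lambda>t. X' (0, t))"
    by (rule continuous_on_compose2[OF cont(4)]) (use \<epsilon> in \<open>auto intro!: continuous_intros\<close>)
  have contz': "continuous_on {0<..<1} z'"
    unfolding z'_def[abs_def] by (intro continuous_intros contX') (use Q in auto)
  define \<sigma> where "\<sigma> = sphere_volume n"
  have formula: "second_variation n p lam \<Gamma> = \<sigma> * C *
      integral {a..b} (\<lambda>t. t ^ n * (z' t)\<^sup>2 - \<kappa> * (t ^ (n - 2) * (z t)\<^sup>2))"
    if ab': "0 < a" "a < a0" "b0 < b" "b < 1" for a b
  proof -
    have ab: "0 < a" "a < a0" "a0 \<le> b0" "b0 < b" "b < 1" "a < b" using ab0 ab' by auto
    have subS: "{-\<epsilon><..<\<epsilon>} \<times> {a..b} \<subseteq> ?S" using ab by auto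
    \<comment> \<open>The logarithm of the squared speed needs c > 0, which a variation does not
      guarantee for all s; for small s it follows by compactness.\<close>
    obtain \<delta> where \<delta>: "0 < \<delta>" "\<delta> \<le> \<epsilon>" and cpos: "\<And>s t. \<bar>s\<bar> < \<delta> \<Longrightarrow> t \<in> {a..b} \<Longrightarrow> 0 < c (s, t)"
      by (rule uniform_tube_positive[OF continuous_on_subset[OF conts(4) subS] \<epsilon>]) (use c0 ab in auto)
    let ?K = "{-\<delta><..<\<delta>} \<times> {a..b}"
    have KS: "?K \<subseteq> ?S" using \<delta>(2) ab by (intro Sigma_mono) auto
    have rpos: "0 < fst (g (s, t))" if "(s, t) \<in> ?S" for s t
      using \<Gamma>pos[of s t] that by (auto simp: g_def)
    have mpos: "0 < m (s, t)" if "(s, t) \<in> ?S" for s t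
      using rpos[OF that] A by (simp add: m_def add_pos_nonneg)
    have posK: "0 < m w" "0 < fst (g w)" "0 < c w" if "w \<in> ?K" for w
    proof -
      obtain s t where w: "w = (s, t)" by (cases w)
      have wS: "(s, t) \<in> ?S" using that KS unfolding w by (rule rev_subsetD)
      have st: "\<bar>s\<bar> < \<delta>" "t \<in> {a..b}" using that unfolding w by auto
      show "0 < m w" "0 < fst (g w)" "0 < c w"
        unfolding w by (rule mpos[OF wS] rpos[OF wS] cpos[OF st])+
    qed

    define F where "F w = exp ((real p * ln (m w) + 2 * real q * ln (fst (g w)) + ln (c w)) / 2)" for w
    define \<Lambda> where "\<Lambda> w = (real p * (m1 w / m w) + 2 * real q * (fst (X w) / fst (g w)) + c1 w / c w) / 2"
        for w
    define \<Lambda>' where "\<Lambda>' w = (real p * (m2 w / m w - (m1 w / m w)\<^sup>2)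
        + 2 * real q * (fst (Y w) / fst (g w) - (fst (X w) / fst (g w))\<^sup>2)
        + (c2 w / c w - (c1 w / c w)\<^sup>2)) / 2" for w
    note contsK = conts[THEN continuous_on_subset, OF KS]
    have "m w \<noteq> 0" "fst (g w) \<noteq> 0" "c w \<noteq> 0" if "w \<in> ?K" for w
      using posK[OF that] by simp_all
    with posK have "\<forall>w\<in>?K. m w \<noteq> 0" "\<forall>w\<in>?K. fst (g w) \<noteq> 0" "\<forall>w\<in>?K. c w \<noteq> 0"
      "\<forall>w\<in>?K. 0 < m w" "\<forall>w\<in>?K. 0 < fst (g w)" "\<forall>w\<in>?K. 0 < c w" by blast+
    note ne = this
    have contF: "continuous_on ?K F" "continuous_on ?K \<Lambda>" "continuous_on ?K \<Lambda>'"
      unfolding F_def[abs_def] \<Lambda>_def[abs_def] \<Lambda>'_def[abs_def]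
      by (intro continuous_on_exp continuous_on_ln continuous_intros contsK ne; simp)+
    have dF: "((\<lambda>s. F (s, t)) has_real_derivative F (s, t) * \<Lambda> (s, t)) (at s)"
      and d\<Lambda>: "((\<lambda>s. \<Lambda> (s, t)) has_real_derivative \<Lambda>' (s, t)) (at s)"
      if st: "\<bar>s\<bar> < \<delta>" "t \<in> {a..b}" for s t
    proof -
      have K: "(s, t) \<in> ?K" using st by auto
      then have stS: "(s, t) \<in> ?S" using KS by blast
      note p = posK[OF K]
      note d = dm[OF stS] fs[OF dX[OF stS]] dc[OF stS]
      show "((\<lambda>s. F (s, t)) has_real_derivative F (s, t) * \<Lambda> (s, t)) (at s)"
        unfolding F_def \<Lambda>_def
        by (rule log_weight_derivatives(1)[where m = "\<lambda>s. m (s, t)" and r = "\<lambda>s. fst (g (s, t))" and w =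
            "\<lambda>s. c (s, t)"
            and ?m1.0 = "\<lambda>s. m1 (s, t)" and ?r1.0 = "\<lambda>s. fst (X (s, t))" and ?w1.0 = "\<lambda>s. c1 (s, t)", OF p
                d])
      show "((\<lambda>s. \<Lambda> (s, t)) has_real_derivative \<Lambda>' (s, t)) (at s)"
        unfolding \<Lambda>_def \<Lambda>'_def
        by (rule log_weight_derivatives(2)[where m = "\<lambda>s. m (s, t)" and r = "\<lambda>s. fst (g (s, t))" and w =
            "\<lambda>s. c (s, t)"
            and ?m1.0 = "\<lambda>s. m1 (s, t)" and ?r1.0 = "\<lambda>s. fst (X (s, t))" and ?w1.0 = "\<lambda>s. c1 (s, t)",
            OF p d dm1[OF stS] fs[OF dY[OF stS]] dc1[OF stS]])
    qed
    have area: "sqrt (g0 n p lam (g (s, t)) (V (s, t)) (V (s, t))) = \<sigma> * F (s, t)"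
      if st: "\<bar>s\<bar> < \<delta>" "t \<in> {a..b}" for s t
    proof -
      have K: "(s, t) \<in> ?K" using st by auto
      have "sqrt (g0 n p lam (g (s, t)) (V (s, t)) (V (s, t)))
          = sqrt (\<sigma>\<^sup>2 * (m (s, t) ^ p * fst (g (s, t)) ^ (2 * q) * c (s, t)))"
        by (simp add: g0_def m_def c_def A_def q_def \<sigma>_def power2_eq_square mult.assoc)
      also have "\<dots> = \<sigma> * F (s, t)"
        using sphere_volume_pos[of n] exp_half_log_weight[OF posK[OF K], of p q]
        by (simp add: real_sqrt_mult F_def \<sigma>_def)
      finally show ?thesis .
    qed
    define \<phi> where "\<phi> t = sqrt (g0 n p lam (LOC_segment \<theta> t) (1, tan \<theta>) (1, tan \<theta>))" for t
    have length: "g0_length n p lam (\<Gamma> s) = (integral {0..a} \<phi> + integral {b..1} \<phi>) + integral {a..b} (\<lambda>t. \<sigma>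
        * F (s, t))"
      if s: "\<bar>s\<bar> < \<delta>" for s
    proof -
      have s\<epsilon>: "- \<epsilon> < s" "s < \<epsilon>" using s \<delta> by linarith+
      have "g0_length n p lam (\<Gamma> s) = integral {0..a} \<phi>
          + integral {a..b} (\<lambda>t. sqrt (g0 n p lam (\<Gamma> s t) (V (s, t)) (V (s, t)))) + integral {b..1} \<phi>"
        unfolding \<phi>_def[abs_def]
      proof (rule g0_length_split[OF ab(1-5)])
        show "(\<Gamma> s has_vector_derivative V (s, t)) (at t)" if "0 < t" "t < 1" for t
          using dV[of s t] that s\<epsilon> by (simp add: g_def)
        show "\<Gamma> s t = LOC_segment \<theta> t" if "0 < t" "t < 1" "t \<notin> {a0..b0}" for t
          using \<Gamma>loc[of s t] that s\<epsilon> by simp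
        show "continuous_on {a..b} (\<lambda>t. V (s, t))"
          by (rule continuous_on_compose2[OF cont(3)]) (use s\<epsilon> ab in \<open>auto intro!: continuous_intros\<close>)
      qed
      also have "integral {a..b} (\<lambda>t. sqrt (g0 n p lam (\<Gamma> s t) (V (s, t)) (V (s, t)))) = integral {a..b}
          (\<lambda>t. \<sigma> * F (s, t))"
        using area[OF s] by (intro integral_cong) (simp add: g_def)
      finally show ?thesis by simp
    qed
    have "second_variation n p lam \<Gamma> = integral {a..b} (\<lambda>t. \<sigma> * (F (0, t) * \<Lambda> (0, t) * \<Lambda> (0, t) + F (0, t) *
        \<Lambda>' (0, t)))"
      unfolding second_variation_def
    proof (rule second_deriv_under_integral[OF \<delta>(1) length, where ?F1.0 = "\<lambda>s t. \<sigma> * (F (s, t) * \<Lambda> (s, t))"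
          and ?F2.0 = "\<lambda>s t. \<sigma> * (F (s, t) * \<Lambda> (s, t) * \<Lambda> (s, t) + F (s, t) * \<Lambda>' (s, t))"])
      fix s t assume st: "\<bar>s\<bar> < \<delta>" "t \<in> {a..b}"
      show "((\<lambda>s. \<sigma> * F (s, t)) has_real_derivative \<sigma> * (F (s, t) * \<Lambda> (s, t))) (at s)"
        by (intro DERIV_cmult dF st)
      show "((\<lambda>s. \<sigma> * (F (s, t) * \<Lambda> (s, t))) has_real_derivative
          \<sigma> * (F (s, t) * \<Lambda> (s, t) * \<Lambda> (s, t) + F (s, t) * \<Lambda>' (s, t))) (at s)"
        by (rule DERIV_cong[OF DERIV_cmult[OF DERIV_mult[OF dF[OF st] d\<Lambda>[OF st]]]]) (simp add:
            algebra_simps)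
    qed (simp_all only: case_prod_unfold prod.collapse, (intro continuous_intros contF)+)
    note second_var = this

    \<comment> \<open>At s = 0 one has F = C t^n. The density splits into a tangential part,
      recognized below as the derivative \<beta>', and the normal quadratic form \<omega>.\<close>
    have dens: "F (0, t) * \<Lambda> (0, t) * \<Lambda> (0, t) + F (0, t) * \<Lambda>' (0, t)
        = C * ((real n * (real n - 1) * t ^ (n - 2) * (x t)\<^sup>2 + 2 * real n * t ^ (n - 1) * x t * x' t
            + (real n * t ^ (n - 1) * x2 t + t ^ n * x2' t))
          + (t ^ n * (z' t)\<^sup>2 - \<kappa> * (t ^ (n - 2) * (z t)\<^sup>2)))" if t: "t \<in> {a..b}" for t
    proof -
      have t01: "t \<in> {0<..<1}" "0 < t" using t ab by auto
      have K: "(0, t) \<in> ?K" using t \<delta> by auto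
      have mt: "m (0, t) = t\<^sup>2 + A * (\<tau> * t)\<^sup>2" using g0[OF t01(1)] by (simp add: m_def)
      have F0: "F (0, t) = C * t ^ n"
      proof -
        have "F (0, t) = sqrt (m (0, t) ^ p * fst (g (0, t)) ^ (2 * q) * c (0, t))"
          unfolding F_def by (rule exp_half_log_weight[OF posK[OF K]])
        also have "m (0, t) = (1 + A * \<tau>\<^sup>2) * t\<^sup>2" by (simp add: mt power2_eq_square algebra_simps)
        also have "fst (g (0, t)) = t" using g0[OF t01(1)] by simp
        also have "((1 + A * \<tau>\<^sup>2) * t\<^sup>2) ^ p * t ^ (2 * q) * c (0, t) = (1 + A * \<tau>\<^sup>2) ^ p * (1 + \<tau>\<^sup>2) * (t ^
            n)\<^sup>2"
          by (simp add: c0[OF t01(1)] q(2) power_mult_distrib power_add power_mult[symmetric] mult.commute)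
        finally show ?thesis using t01 by (simp add: C_def real_sqrt_mult)
      qed
      have "\<Lambda> (0, t) * \<Lambda> (0, t) + \<Lambda>' (0, t) = (\<Lambda> (0, t))\<^sup>2 + \<Lambda>' (0, t)" by (simp add: power2_eq_square)
      also have "\<dots> = (((real n)\<^sup>2 - real n) * (x t)\<^sup>2 + real n * t * x2 t + 2 * real n * t * x t * x' t +
          t\<^sup>2 * x2' t
          + t\<^sup>2 * (z' t)\<^sup>2 - \<kappa> * (z t)\<^sup>2) / t\<^sup>2"
        unfolding \<kappa>_def \<Lambda>_def \<Lambda>'_def m1_def m2_def c1_def c2_def comps mt c0[OF t01(1)] V0[OF t01(1)] g0[OF
            t01(1)] fst_conv snd_conv
        by (rule second_variation_density) (use pn q A t01 ang' in auto)
      finally have eq: "\<Lambda> (0, t) * \<Lambda> (0, t) + \<Lambda>' (0, t) = \<dots>" .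
      obtain k where k: "n = Suc (Suc k)" using n2 by (metis add_2_eq_Suc le_Suc_ex)
      have "F (0, t) * \<Lambda> (0, t) * \<Lambda> (0, t) + F (0, t) * \<Lambda>' (0, t) = F (0, t) * (\<Lambda> (0, t) * \<Lambda> (0, t) + \<Lambda>' (0,
          t))"
        by (simp add: algebra_simps)
      also have "\<dots> = C * (t ^ k * (((real n)\<^sup>2 - real n) * (x t)\<^sup>2 + real n * t * x2 t + 2 * real n * t * x
          t * x' t + t\<^sup>2 * x2' t
          + t\<^sup>2 * (z' t)\<^sup>2 - \<kappa> * (z t)\<^sup>2))"
        unfolding eq F0 using t01(2) by (simp add: k power2_eq_square)
      also have "\<dots> = C * ((real n * (real n - 1) * t ^ k * (x t)\<^sup>2 + 2 * real n * t ^ Suc k * x t * x' t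
            + (real n * t ^ Suc k * x2 t + t ^ Suc (Suc k) * x2' t))
          + (t ^ Suc (Suc k) * (z' t)\<^sup>2 - \<kappa> * (t ^ k * (z t)\<^sup>2)))"
        by (rule arg_cong[where f = "\<lambda>u. C * u"]) (simp add: power2_eq_square algebra_simps)
      finally show ?thesis by (simp add: k)
    qed
    \<comment> \<open>On the ray the length element is r^n dr up to a constant, and \<beta> is the
      second s-derivative of r^(n+1) / (n + 1) for r = t, r_s = x, r_ss = x2. Motion along the ray
      only reparametrizes it, so it can enter only as a boundary term.\<close>
    define \<beta> where "\<beta> t = real n * t ^ (n - 1) * (x t)\<^sup>2 + t ^ n * x2 t" for t
    define \<beta>' where "\<beta>' t = real n * (real n - 1) * t ^ (n - 2) * (x t)\<^sup>2 + 2 * real n * t ^ (n - 1) * x t *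
        x' t
            + (real n * t ^ (n - 1) * x2 t + t ^ n * x2' t)" for t
    have d\<beta>: "(\<beta> has_real_derivative \<beta>' t) (at t)" if "0 < t" "t < 1" for t
      unfolding \<beta>_def[abs_def] \<beta>'_def
      by (rule derivative_eq_intros dx[OF that] dx2[OF that] refl)+
        (use n2 in \<open>simp add: of_nat_diff numeral_2_eq_2 algebra_simps\<close>)
    have "\<beta> a = 0" "\<beta> b = 0"
      using X0[of 0 a] X0[of 0 b] Y0[of 0 a] Y0[of 0 b] \<epsilon> ab ab0 by (auto simp: \<beta>_def x_def x2_def)
    moreover have "(\<beta>' has_integral (\<beta> b - \<beta> a)) {a..b}"
    proof (rule fundamental_theorem_of_calculus)
      show "(\<beta> has_vector_derivative \<beta>' t) (at t within {a..b})" if "t \<in> {a..b}" for t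
        using d\<beta>[of t] that ab
        by (simp add: has_real_derivative_iff_has_vector_derivative has_vector_derivative_at_within)
    qed (use ab in simp)
    ultimately have I\<beta>: "(\<beta>' has_integral 0) {a..b}" by simp
    define \<omega> where "\<omega> t = t ^ n * (z' t)\<^sup>2 - \<kappa> * (t ^ (n - 2) * (z t)\<^sup>2)" for t
    have "continuous_on {a..b} \<omega>"
      unfolding \<omega>_def[abs_def] using ab
      by (intro continuous_intros continuous_on_subset[OF contz'] continuous_at_imp_continuous_on ballI
          DERIV_isCont[OF dz]) auto
    then have I\<omega>: "(\<omega> has_integral integral {a..b} \<omega>) {a..b}"
      by (intro integrable_integral integrable_continuous_real)
    have "((\<lambda>t. (\<sigma> * C) * (\<beta>' t + \<omega> t)) has_integral (\<sigma> * C) * (0 + integral {a..b} \<omega>)) {a..b}"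
      by (intro has_integral_mult_right has_integral_add I\<beta> I\<omega>)
    then have "integral {a..b} (\<lambda>t. (\<sigma> * C) * (\<beta>' t + \<omega> t)) = \<sigma> * C * integral {a..b} \<omega>"
      unfolding add_0_left by (rule integral_unique)
    moreover have "integral {a..b} (\<lambda>t. \<sigma> * (F (0, t) * \<Lambda> (0, t) * \<Lambda> (0, t) + F (0, t) * \<Lambda>' (0, t)))
        = integral {a..b} (\<lambda>t. (\<sigma> * C) * (\<beta>' t + \<omega> t))"
      by (intro integral_cong) (simp add: dens \<beta>'_def \<omega>_def)
    ultimately show "second_variation n p lam \<Gamma> = \<sigma> * C *
        integral {a..b} (\<lambda>t. t ^ n * (z' t)\<^sup>2 - \<kappa> * (t ^ (n - 2) * (z t)\<^sup>2))"
      unfolding \<omega>_def[abs_def] by (simp only: second_var)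
  qed
  show ?thesis
  proof (rule exI[of _ a0], rule exI[of _ b0], rule exI[of _ z], rule exI[of _ z'], intro conjI allI impI)
    show "((\<lambda>s. snd (\<Gamma> s t) - tan \<theta> * fst (\<Gamma> s t)) has_real_derivative (1 + (tan \<theta>)\<^sup>2) * z t) (at 0)"
      if "0 < t" "t < 1" for t
      using DERIV_diff[OF sn[OF dX[OF S0[OF that]]] DERIV_cmult[OF fs[OF dX[OF S0[OF that]]], of \<tau>]] Q
      by (simp add: g_def z_def \<tau>_def)
    show "z t = 0" if "0 < t" "t < 1" "t \<notin> {a0..b0}" for t
      using X0[OF S0[OF that(1,2)] that(3)] by (simp add: z_def)
    show "second_variation n p lam \<Gamma> = sphere_volume n * sqrt ((1 + lam\<^sup>2 * (tan \<theta>)\<^sup>2) ^ p * (1 + (tan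
        \<theta>)\<^sup>2)) *
       integral {a..b} (\<lambda>t. t ^ n * (z' t)\<^sup>2 - (real n - 2 * (real n)\<^sup>2 / (real p * lam\<^sup>2)) * (t ^ (n - 2) *
           (z t)\<^sup>2))"
      if "0 < a" "a < a0" "b0 < b" "b < 1" for a b
      using formula[OF that] by (simp add: \<sigma>_def C_def \<kappa>_def A_def \<tau>_def)
  qed (use ab0 dz contz' in auto)
qed

section \<open>Smooth cut-off functions\<close>

text \<open>A one-variable counterpart of \<open>Ck_on\<close>: the derivative is quantified
  existentially, so closure under products, compositions and special functions needs no computation
  with \<open>frechet_derivative\<close>.\<close>

primrec Ck_real :: "nat \<Rightarrow> (real \<Rightarrow> real) \<Rightarrow> real set \<Rightarrow> bool" where
  "Ck_real 0 f S \<longleftrightarrow> continuous_on S f"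
| "Ck_real (Suc k) f S \<longleftrightarrow> (\<exists>f'. (\<forall>x\<in>S. (f has_real_derivative f' x) (at x)) \<and> Ck_real k f' S)"

lemma Ck_real_SucI:
  "\<lbrakk>\<And>x. x \<in> S \<Longrightarrow> (f has_real_derivative f' x) (at x); Ck_real k f' S\<rbrakk> \<Longrightarrow> Ck_real (Suc k) f S"
  by auto

lemma Ck_real_Suc_imp: "Ck_real (Suc k) f S \<Longrightarrow> Ck_real k f S"
proof (induction k arbitrary: f)
  case 0
  then show ?case by (auto intro!: continuous_at_imp_continuous_on dest: DERIV_isCont)
next
  case (Suc k)
  then obtain f' where "\<forall>x\<in>S. (f has_real_derivative f' x) (at x)" "Ck_real (Suc k) f' S" by auto
  with Suc.IH[of f'] show ?case by auto
qed

lemma Ck_real_const: "Ck_real k (\<lambda>x. c) S"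
proof (induction k arbitrary: c)
  case (Suc k)
  show ?case by (rule Ck_real_SucI[where f' = "\<lambda>x. 0"]) (auto intro: Suc)
qed simp

lemma Ck_real_add: "Ck_real k f S \<Longrightarrow> Ck_real k g S \<Longrightarrow> Ck_real k (\<lambda>x. f x + g x) S"
proof (induction k arbitrary: f g)
  case (Suc k)
  obtain f' g' where "\<forall>x\<in>S. (f has_real_derivative f' x) (at x)" "Ck_real k f' S"
    "\<forall>x\<in>S. (g has_real_derivative g' x) (at x)" "Ck_real k g' S" using Suc.prems by auto
  then show ?case
    by (intro Ck_real_SucI[where f' = "\<lambda>x. f' x + g' x"] Suc.IH DERIV_add) auto
qed (simp add: continuous_on_add)

lemma Ck_real_mult: "Ck_real k f S \<Longrightarrow> Ck_real k g S \<Longrightarrow> Ck_real k (\<lambda>x. f x * g x) S"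
proof (induction k arbitrary: f g)
  case (Suc k)
  obtain f' g' where "\<forall>x\<in>S. (f has_real_derivative f' x) (at x)" "Ck_real k f' S"
    "\<forall>x\<in>S. (g has_real_derivative g' x) (at x)" "Ck_real k g' S" using Suc.prems by auto
  moreover have "Ck_real k f S" "Ck_real k g S" using Suc.prems Ck_real_Suc_imp by blast+
  ultimately show ?case
    by (intro Ck_real_SucI[where f' = "\<lambda>x. f' x * g x + g' x * f x"] Ck_real_add Suc.IH DERIV_mult) auto
qed (simp add: continuous_on_mult)

lemma Ck_real_compose:
  "Ck_real k f T \<Longrightarrow> Ck_real k g S \<Longrightarrow> g ` S \<subseteq> T \<Longrightarrow> Ck_real k (\<lambda>x. f (g x)) S"
proof (induction k arbitrary: f g)
  case 0
  then show ?case by (auto intro: continuous_on_compose2)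
next
  case (Suc k)
  obtain f' g' where d: "\<forall>x\<in>T. (f has_real_derivative f' x) (at x)" "Ck_real k f' T"
    "\<forall>x\<in>S. (g has_real_derivative g' x) (at x)" "Ck_real k g' S" using Suc.prems by auto
  have g: "Ck_real k g S" using Suc.prems Ck_real_Suc_imp by blast
  show ?case
  proof (rule Ck_real_SucI[where f' = "\<lambda>x. f' (g x) * g' x"])
    show "((\<lambda>x. f (g x)) has_real_derivative f' (g x) * g' x) (at x)" if "x \<in> S" for x
      using that d Suc.prems(3) by (intro DERIV_chain2) auto
    show "Ck_real k (\<lambda>x. f' (g x) * g' x) S"
      by (rule Ck_real_mult[OF Suc.IH[OF d(2) g Suc.prems(3)] d(4)])
  qed
qed

lemma Ck_real_ident: "Ck_real k (\<lambda>x. x) S"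
proof (cases k)
  case (Suc j)
  show ?thesis unfolding Suc by (rule Ck_real_SucI[where f' = "\<lambda>x. 1"]) (auto intro: Ck_real_const)
qed simp

lemma Ck_real_exp: "Ck_real k exp S"
proof (induction k)
  case (Suc k)
  then show ?case by (intro Ck_real_SucI[where f' = exp]) auto
qed (simp add: continuous_on_exp continuous_on_id)

lemma Ck_real_inverse: "0 \<notin> S \<Longrightarrow> Ck_real k inverse S"
proof (induction k)
  case 0
  then show ?case by (auto intro!: continuous_intros)
next
  case (Suc k)
  show ?case
  proof (rule Ck_real_SucI[where f' = "\<lambda>x. (-1) * (inverse x * inverse x)"])
    show "(inverse has_real_derivative (-1) * (inverse x * inverse x)) (at x)" if "x \<in> S" for x
      using that Suc.prems by (auto intro!: derivative_eq_intros simp: power2_eq_square)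
    show "Ck_real k (\<lambda>x. (-1) * (inverse x * inverse x)) S"
      by (intro Ck_real_mult Ck_real_const Suc)
  qed
qed

lemma Ck_real_ln: "Ck_real k ln {0<..}"
proof (cases k)
  case 0
  then show ?thesis by (auto intro!: continuous_intros)
next
  case (Suc j)
  show ?thesis unfolding Suc
    by (rule Ck_real_SucI[where f' = inverse])
      (auto intro!: Ck_real_inverse derivative_eq_intros simp: inverse_eq_divide)
qed

text \<open>The class of functions \<open>P (1 / x) * exp (- 1 / x)\<close>, extended by \<open>0\<close>, is closed under
  differentiation, also at the origin.\<close>

definition flat_fun :: "real poly \<Rightarrow> real \<Rightarrow> real" where
  "flat_fun P x = (if x \<le> 0 then 0 else poly P (inverse x) * exp (- inverse x))"

lemma poly_div_exp_tendsto_0: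
  fixes P :: "real poly"
  shows "((\<lambda>y. poly P y * exp (- y)) \<longlongrightarrow> 0) at_top"
proof -
  have "((\<lambda>y. \<Sum>i\<le>degree P. coeff P i * (y ^ i / exp y)) \<longlongrightarrow> (\<Sum>i\<le>degree P. coeff P i * 0)) at_top"
    by (intro tendsto_sum tendsto_mult tendsto_const tendsto_power_div_exp_0)
  moreover have "(\<lambda>y. \<Sum>i\<le>degree P. coeff P i * (y ^ i / exp y)) = (\<lambda>y. poly P y * exp (- y))"
    by (simp add: poly_altdef sum_distrib_right exp_minus divide_inverse mult.assoc)
  ultimately show ?thesis by simp
qed

text \<open>With y = 1 / x the derivative of P(y) exp(-y) is y^2 (P - P')(y) exp(-y), hence the
  factor \<open>[:0, 0, 1:]\<close>. At the origin the right difference quotient is y P(y) exp(-y),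
  which tends to 0 as y grows.\<close>

lemma DERIV_flat_fun:
  "(flat_fun P has_real_derivative flat_fun ([:0, 0, 1:] * (P - pderiv P)) x) (at x)"
proof -
  consider "x < 0" | "x > 0" | "x = 0" by linarith
  then show ?thesis
  proof cases
    case 1
    have "(flat_fun P has_real_derivative 0) (at x)"
      by (rule has_field_derivative_transform_within_open[of "\<lambda>x. 0" _ _ "{..<0}"])
        (use 1 in \<open>auto simp: flat_fun_def\<close>)
    with 1 show ?thesis by (simp add: flat_fun_def)
  next
    case 2
    have "((\<lambda>x. poly P (inverse x) * exp (- inverse x)) has_real_derivative
        flat_fun ([:0, 0, 1:] * (P - pderiv P)) x) (at x)"
      using 2 by (auto intro!: derivative_eq_intros poly_DERIV[THEN DERIV_chain2]
          simp: flat_fun_def power2_eq_square algebra_simps)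
    then show ?thesis
      by (rule has_field_derivative_transform_within_open[of _ _ _ "{0<..}"])
        (use 2 in \<open>auto simp: flat_fun_def\<close>)
  next
    case 3
    have "((\<lambda>y. poly ([:0, 1:] * P) (inverse y) * exp (- inverse y)) \<longlongrightarrow> 0) (at_right 0)"
      using filterlim_compose[OF poly_div_exp_tendsto_0 filterlim_inverse_at_top_right] .
    then have "((\<lambda>y. (flat_fun P y - flat_fun P 0) / (y - 0)) \<longlongrightarrow> 0) (at_right 0)"
      by (rule Lim_transform_eventually)
        (auto simp: eventually_at_right_less flat_fun_def divide_inverse
          intro!: eventually_mono[OF eventually_at_right_less])
    moreover have "((\<lambda>y. (flat_fun P y - flat_fun P 0) / (y - 0)) \<longlongrightarrow> 0) (at_left 0)"
      by (rule Lim_transform_eventually[OF tendsto_const])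
        (auto simp: flat_fun_def eventually_at_filter)
    ultimately have "((\<lambda>y. (flat_fun P y - flat_fun P 0) / (y - 0)) \<longlongrightarrow> 0) (at 0)"
      by (simp add: filterlim_split_at)
    then show ?thesis unfolding 3 by (simp add: has_field_derivative_iff flat_fun_def)
  qed
qed

lemma Ck_real_flat_fun: "Ck_real k (flat_fun P) S"
proof (induction k arbitrary: P)
  case 0
  show ?case by (auto intro!: continuous_at_imp_continuous_on DERIV_isCont DERIV_flat_fun)
next
  case (Suc k)
  show ?case by (rule Ck_real_SucI[OF DERIV_flat_fun Suc])
qed

text \<open>The product of exp(-1 / (u - 1)) and exp(-1 / (2 - u)), extended by zero. The interval
  [1, 2] is chosen because u = - ln t / T then confines t to a compact part of (0, 1) for every T >
  0.\<close>

lemma smooth_bump_exists: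
  "\<exists>B B' :: real \<Rightarrow> real. (\<forall>k. Ck_real k B UNIV) \<and> (\<forall>u. (B has_real_derivative B' u) (at u)) \<and>
     continuous_on UNIV B' \<and> (\<forall>u. u \<notin> {1<..<2} \<longrightarrow> B u = 0 \<and> B' u = 0) \<and> (\<forall>u\<in>{1<..<2}. 0 < B u)"
proof -
  define B where "B u = flat_fun 1 (u + -1) * flat_fun 1 (2 + (-1) * u)" for u :: real
  have B: "Ck_real k B UNIV" for k
    unfolding B_def[abs_def]
    by (intro Ck_real_mult Ck_real_compose[OF Ck_real_flat_fun[where S = UNIV]] Ck_real_add
        Ck_real_const Ck_real_ident) auto
  from B[of 1] obtain B' where B': "\<And>u. (B has_real_derivative B' u) (at u)" "continuous_on UNIV B'"
    by auto
  have zero: "B u = 0" if "u \<notin> {1<..<2}" for u using that by (auto simp: B_def flat_fun_def)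
  have B'0: "B' u = 0" if "u \<notin> {1<..<2}" for u
  proof -
    have ext: "B' v = 0" if "v < 1 \<or> v > 2" for v
    proof -
      have "(B has_real_derivative 0) (at v)"
        by (rule has_field_derivative_transform_within_open[of "\<lambda>x. 0" _ _ "- {1..2}"])
          (use that zero in \<open>auto simp: open_Compl\<close>)
      then show ?thesis using B'(1) DERIV_unique by blast
    qed
    \<comment> \<open>At the endpoints 1 and 2 the value of B' follows from the exterior by a
      one-sided limit.\<close>
    have "isCont B' u" using B'(2) by (simp add: continuous_on_eq_continuous_at)
    show ?thesis
    proof (cases "u \<le> 1")
      case True
      have "(B' \<longlongrightarrow> B' u) (at_left u)"
        using \<open>isCont B' u\<close> by (simp add: isCont_def filterlim_at_split)
      moreover have "(B' \<longlongrightarrow> 0) (at_left u)"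
        by (rule Lim_transform_eventually[OF tendsto_const])
          (use True ext in \<open>auto simp: eventually_at_filter\<close>)
      ultimately show ?thesis using tendsto_unique trivial_limit_at_left_real by blast
    next
      case False
      have "(B' \<longlongrightarrow> B' u) (at_right u)"
        using \<open>isCont B' u\<close> by (simp add: isCont_def filterlim_at_split)
      moreover have "(B' \<longlongrightarrow> 0) (at_right u)"
        by (rule Lim_transform_eventually[OF tendsto_const])
          (use False that ext in \<open>auto simp: eventually_at_filter\<close>)
      ultimately show ?thesis using tendsto_unique trivial_limit_at_right_real by blast
    qed
  qed
  have "0 < B u" if "u \<in> {1<..<2}" for u using that by (auto simp: B_def flat_fun_def)
  with B B' zero B'0 show ?thesis by blast
qed

section \<open>Smoothness of families that are affine in the variation parameter\<close>

lemma Ck_on_cong: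
  assumes "open S" "\<And>x. x \<in> S \<Longrightarrow> f x = g x" "Ck_on k f S"
  shows "Ck_on k g S"
  using assms(2,3)
proof (induction k arbitrary: f g)
  case 0
  then show ?case by (simp cong: continuous_on_cong)
next
  case (Suc k)
  have f: "f differentiable_on S" "\<And>v. Ck_on k (\<lambda>x. frechet_derivative f (at x) v) S"
    using Suc.prems by auto
  have gd: "(g has_derivative frechet_derivative f (at x)) (at x)" if "x \<in> S" for x
  proof (rule has_derivative_transform_within_open[OF _ assms(1) that Suc.prems(1)])
    show "(f has_derivative frechet_derivative f (at x)) (at x)"
      using f(1) that assms(1)
      by (simp add: differentiable_on_eq_differentiable_at frechet_derivative_works[symmetric])
  qed
  have fd: "frechet_derivative f (at x) = frechet_derivative g (at x)" if "x \<in> S" for x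
    using frechet_derivative_at[OF gd[OF that]] .
  have "g differentiable_on S"
    unfolding differentiable_on_eq_differentiable_at[OF assms(1)] differentiable_def using gd by blast
  moreover have "Ck_on k (\<lambda>x. frechet_derivative g (at x) v) S" for v
    by (rule Suc.IH[OF _ f(2)[of v]]) (simp add: fd)
  ultimately show ?case by simp
qed

text \<open>The class is closed under directional derivatives: a + s b differentiated in direction
  (v1, v2) is (v2 a' + v1 b) + s (v2 b'), again affine in s. Hence a single induction on k covers
  all mixed derivatives.\<close>

lemma Ck_on_affine_family:
  assumes S: "open S"
  assumes "Ck_real k a1 S" "Ck_real k b1 S" "Ck_real k a2 S" "Ck_real k b2 S"
  shows "Ck_on k (\<lambda>(s, t). (a1 t + s * b1 t, a2 t + s * b2 t)) (UNIV \<times> S)"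
  using assms(2-)
proof (induction k arbitrary: a1 b1 a2 b2)
  case 0
  have "continuous_on (UNIV \<times> S) (\<lambda>z. h (snd z))" if "continuous_on S h" for h :: "real \<Rightarrow> real"
    by (rule continuous_on_compose2[OF that]) (auto intro!: continuous_intros)
  with 0 show ?case by (auto simp: case_prod_unfold intro!: continuous_intros)
next
  case (Suc k)
  let ?f = "\<lambda>(s, t). (a1 t + s * b1 t, a2 t + s * b2 t)"
  obtain a1' where a1': "\<And>x. x \<in> S \<Longrightarrow> (a1 has_real_derivative a1' x) (at x)" "Ck_real k a1' S"
    using Suc.prems(1) by auto
  obtain b1' where b1': "\<And>x. x \<in> S \<Longrightarrow> (b1 has_real_derivative b1' x) (at x)" "Ck_real k b1' S"
    using Suc.prems(2) by auto
  obtain a2' where a2': "\<And>x. x \<in> S \<Longrightarrow> (a2 has_real_derivative a2' x) (at x)" "Ck_real k a2' S"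
    using Suc.prems(3) by auto
  obtain b2' where b2': "\<And>x. x \<in> S \<Longrightarrow> (b2 has_real_derivative b2' x) (at x)" "Ck_real k b2' S"
    using Suc.prems(4) by auto
  note d = a1'(1) b1'(1) a2'(1) b2'(1) and c = a1'(2) b1'(2) a2'(2) b2'(2)
  have o: "open (UNIV \<times> S :: (real \<times> real) set)" using S by (intro open_Times) auto
  have snd': "((\<lambda>z. h (snd z)) has_derivative (\<lambda>v. h' * snd v)) (at z)"
    if "(h has_real_derivative h') (at (snd z))" for h h' and z :: "real \<times> real"
    using has_derivative_compose[OF has_derivative_snd[OF has_derivative_ident], of h "(*) h'" z UNIV] that
    by (simp add: has_field_derivative_def)
  have D: "(?f has_derivative (\<lambda>v.
      (snd v * a1' (snd z) + fst v * b1 (snd z) + fst z * (snd v * b1' (snd z)),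
       snd v * a2' (snd z) + fst v * b2 (snd z) + fst z * (snd v * b2' (snd z))))) (at z)"
    if "z \<in> UNIV \<times> S" for z
  proof -
    have z: "snd z \<in> S" using that by auto
    note sd = snd'[OF d(1)[OF z]] snd'[OF d(2)[OF z]] snd'[OF d(3)[OF z]] snd'[OF d(4)[OF z]]
    show ?thesis unfolding case_prod_unfold
      by (rule has_derivative_eq_rhs[OF has_derivative_Pair[OF
          has_derivative_add[OF sd(1) has_derivative_mult[OF has_derivative_fst[OF has_derivative_ident]
              sd(2)]]
          has_derivative_add[OF sd(3) has_derivative_mult[OF has_derivative_fst[OF has_derivative_ident]
              sd(4)]]]])
        (simp add: fun_eq_iff algebra_simps)
  qed
  have "?f differentiable_on (UNIV \<times> S)"
    using D by (auto simp: differentiable_on_eq_differentiable_at[OF o] differentiable_def)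
  moreover have "Ck_on k (\<lambda>z. frechet_derivative ?f (at z) v) (UNIV \<times> S)" for v
  proof (rule Ck_on_cong[OF o])
    have b: "Ck_real k b1 S" "Ck_real k b2 S" using Suc.prems Ck_real_Suc_imp by blast+
    show "Ck_on k (\<lambda>(s, t). ((snd v * a1' t + fst v * b1 t) + s * (snd v * b1' t),
        (snd v * a2' t + fst v * b2 t) + s * (snd v * b2' t))) (UNIV \<times> S)"
      by (intro Suc.IH Ck_real_add Ck_real_mult Ck_real_const b c)
    show "(case z of (s, t) \<Rightarrow> ((snd v * a1' t + fst v * b1 t) + s * (snd v * b1' t),
        (snd v * a2' t + fst v * b2 t) + s * (snd v * b2' t))) = frechet_derivative ?f (at z) v"
      if "z \<in> UNIV \<times> S" for z
      using frechet_derivative_at[OF D[OF that], symmetric] by (simp add: case_prod_unfold)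
  qed
  ultimately show ?case by simp
qed

lemma smooth_on_subset: "smooth_on T f \<Longrightarrow> S \<subseteq> T \<Longrightarrow> smooth_on S f"
proof -
  have "Ck_on k f T \<Longrightarrow> S \<subseteq> T \<Longrightarrow> Ck_on k f S" for k
    by (induction k arbitrary: f) (auto intro: continuous_on_subset differentiable_on_subset)
  then show "smooth_on T f \<Longrightarrow> S \<subseteq> T \<Longrightarrow> smooth_on S f" by (auto simp: smooth_on_def)
qed

section \<open>Stability and instability\<close>

text \<open>Adding the derivative of \<open>m t\<^sup>n\<^sup>-\<^sup>1 z\<^sup>2\<close> with \<open>m = (n - 1) / 2\<close> completes the square \<open>(t z' + m
    z)\<^sup>2\<close>.\<close>

lemma Hardy_inequality:
  fixes z z' :: "real \<Rightarrow> real"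
  assumes ab: "0 < a" "a < b" and n: "2 \<le> n"
    and dz: "\<And>t. t \<in> {a..b} \<Longrightarrow> (z has_real_derivative z' t) (at t)" and cz: "continuous_on {a..b} z'"
    and z0: "z a = 0" "z b = 0" and \<kappa>: "\<kappa> \<le> ((real n - 1) / 2)\<^sup>2"
  shows "0 \<le> integral {a..b} (\<lambda>t. t ^ n * (z' t)\<^sup>2 - \<kappa> * (t ^ (n - 2) * (z t)\<^sup>2))"
proof -
  obtain k where k: "n = Suc (Suc k)" using n by (metis add_2_eq_Suc le_Suc_ex)
  define m where "m = (real n - 1) / 2"
  define \<omega> where "\<omega> t = t ^ n * (z' t)\<^sup>2 - \<kappa> * (t ^ (n - 2) * (z t)\<^sup>2)" for t
  define \<gamma> where "\<gamma> t = m * t ^ (n - 1) * (z t)\<^sup>2" for t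
  define \<gamma>' where "\<gamma>' t = t ^ (n - 2) * (2 * m\<^sup>2 * (z t)\<^sup>2 + 2 * m * t * z t * z' t)" for t
  have "(\<gamma> has_vector_derivative \<gamma>' t) (at t within {a..b})" if "t \<in> {a..b}" for t
  proof -
    have km: "1 + real k = 2 * m" by (simp add: m_def k)
    have "(\<gamma> has_real_derivative m * ((1 + real k) * t ^ k) * (z t)\<^sup>2 + m * t ^ Suc k * (2 * z t * z' t))
        (at t)"
    proof -
      have "((\<lambda>t. t ^ Suc k) has_real_derivative (1 + real k) * t ^ k) (at t)"
        by (rule DERIV_cong[OF DERIV_pow]) simp
      from DERIV_mult[OF DERIV_cmult[OF this, of m] DERIV_power[OF dz[OF that], of 2]]
      show ?thesis unfolding \<gamma>_def[abs_def] k by (simp add: algebra_simps)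
    qed
    then have "(\<gamma> has_real_derivative \<gamma>' t) (at t)"
      by (rule DERIV_cong) (simp add: \<gamma>'_def k km power2_eq_square algebra_simps)
    then show ?thesis
      by (simp add: has_real_derivative_iff_has_vector_derivative has_vector_derivative_at_within)
  qed
  then have "(\<gamma>' has_integral (\<gamma> b - \<gamma> a)) {a..b}"
    using ab by (intro fundamental_theorem_of_calculus) auto
  then have "(\<gamma>' has_integral 0) {a..b}" by (simp add: \<gamma>_def z0)
  moreover have "continuous_on {a..b} z"
    by (intro continuous_at_imp_continuous_on ballI DERIV_isCont[OF dz])
  then have "continuous_on {a..b} \<omega>"
    unfolding \<omega>_def[abs_def] by (intro continuous_intros cz)
  then have "(\<omega> has_integral integral {a..b} \<omega>) {a..b}"
    by (intro integrable_integral integrable_continuous_real)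
  ultimately have "((\<lambda>t. \<omega> t + \<gamma>' t) has_integral (integral {a..b} \<omega> + 0)) {a..b}"
    by (intro has_integral_add)
  moreover have "0 \<le> \<omega> t + \<gamma>' t" if "t \<in> {a..b}" for t
  proof -
    have "\<omega> t + \<gamma>' t = t ^ k * ((t * z' t + m * z t)\<^sup>2 + (m\<^sup>2 - \<kappa>) * (z t)\<^sup>2)"
      by (simp add: \<omega>_def \<gamma>'_def k power2_eq_square algebra_simps)
    then show ?thesis using that ab \<kappa> by (simp add: m_def)
  qed
  ultimately have "0 \<le> integral {a..b} \<omega> + 0" by (rule has_integral_nonneg)
  then show ?thesis by (simp add: \<omega>_def[abs_def])
qed

lemma LOC_stable_if:
  assumes pn: "0 < p" "p < n" and lam: "0 < lam"
    and ang: "real (n - p) * (1 + lam\<^sup>2 * (tan \<theta>)\<^sup>2) = real p * (lam\<^sup>2 - 1)"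
    and \<kappa>: "real n - 2 * (real n)\<^sup>2 / (real p * lam\<^sup>2) \<le> ((real n - 1) / 2)\<^sup>2"
  shows "LOC_stable n p lam \<theta>"
  unfolding LOC_stable_def
proof (intro allI impI)
  fix \<Gamma> assume "compact_variation \<theta> \<Gamma>"
  from second_variation_formula[OF this pn lam ang] obtain a0 b0 z z' where ab0: "0 < a0" "a0 < b0" "b0 < 1"
    and dz: "\<forall>t. 0 < t \<longrightarrow> t < 1 \<longrightarrow> (z has_real_derivative z' t) (at t)"
    and cz: "continuous_on {0<..<1} z'"
    and z0: "\<forall>t. 0 < t \<longrightarrow> t < 1 \<longrightarrow> t \<notin> {a0..b0} \<longrightarrow> z t = 0"
    and sv: "\<forall>a b. 0 < a \<longrightarrow> a < a0 \<longrightarrow> b0 < b \<longrightarrow> b < 1 \<longrightarrow> second_variation n p lam \<Gamma> =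
      sphere_volume n * sqrt ((1 + lam\<^sup>2 * (tan \<theta>)\<^sup>2) ^ p * (1 + (tan \<theta>)\<^sup>2)) *
      integral {a..b} (\<lambda>t. t ^ n * (z' t)\<^sup>2 - (real n - 2 * (real n)\<^sup>2 / (real p * lam\<^sup>2)) * (t ^ (n - 2) *
          (z t)\<^sup>2))"
    by blast
  \<comment> \<open>Any window around the support will do; its endpoints lie outside [a0, b0], which
    gives Hardy's boundary condition.\<close>
  define a b where "a = a0 / 2" and "b = (1 + b0) / 2"
  have ab: "0 < a" "a < a0" "b0 < b" "b < 1" "a < b" using ab0 by (auto simp: a_def b_def)
  have "0 \<le> integral {a..b} (\<lambda>t. t ^ n * (z' t)\<^sup>2 - (real n - 2 * (real n)\<^sup>2 / (real p * lam\<^sup>2)) * (t ^ (n -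
      2) * (z t)\<^sup>2))"
  proof (rule Hardy_inequality[OF ab(1,5) _ _ _ _ _ \<kappa>])
    show "continuous_on {a..b} z'" by (rule continuous_on_subset[OF cz]) (use ab in auto)
    show "(z has_real_derivative z' t) (at t)" if "t \<in> {a..b}" for t using that ab
        by (intro dz[rule_format]) auto
  qed (use pn ab ab0 z0 in auto)
  then show "0 \<le> second_variation n p lam \<Gamma>"
    unfolding sv[rule_format, OF ab(1-4)] using sphere_volume_pos[of n] by (intro mult_nonneg_nonneg) auto
qed

text \<open>Points move along the fixed normal direction (- tan \<theta>, 1). What restricts s is
  the condition r > 0: on the support t is at least a, so a bound on z yields a uniform
  \<epsilon>.\<close>

lemma compact_variation_normal:
  fixes z :: "real \<Rightarrow> real"
  assumes ab: "0 < a" "a < b" "b < 1" and z: "\<And>k. Ck_real k z {0<..}"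
    and z0: "\<And>t. 0 < t \<Longrightarrow> t \<notin> {a..b} \<Longrightarrow> z t = 0"
  shows "compact_variation \<theta> (\<lambda>s t. (t + s * ((- tan \<theta>) * z t), tan \<theta> * t + s * z t))"
proof -
  have "continuous_on {a..b} z"
    using z[of 0] ab by (auto intro: continuous_on_subset)
  then have "bounded (z ` {a..b})" by (intro compact_imp_bounded compact_continuous_image) auto
  then obtain M where M: "0 < M" "\<And>t. t \<in> {a..b} \<Longrightarrow> \<bar>z t\<bar> \<le> M"
    unfolding bounded_pos by auto
  \<comment> \<open>The added 1 keeps N positive even if the tangent vanishes. Then |s tan \<theta>
    z t| < a whenever |s| < a / N.\<close>
  define N where "N = \<bar>tan \<theta>\<bar> * M + 1"
  have N: "0 < N" "\<bar>tan \<theta>\<bar> * M < N" using M by (auto simp: N_def intro!: add_nonneg_pos)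
  define \<epsilon> where "\<epsilon> = a / N"
  have \<epsilon>: "0 < \<epsilon>" using ab N by (simp add: \<epsilon>_def)
  have pos: "0 < t + s * ((- tan \<theta>) * z t)" if "s \<in> {-\<epsilon><..<\<epsilon>}" "t \<in> {0<..1}" for s t
  proof (cases "t \<in> {a..b}")
    case True
    have "\<bar>s * (tan \<theta> * z t)\<bar> = \<bar>s\<bar> * (\<bar>tan \<theta>\<bar> * \<bar>z t\<bar>)" by (simp add: abs_mult)
    also have "\<dots> \<le> \<bar>s\<bar> * N"
      using M(2)[OF True] N mult_left_mono[OF M(2)[OF True], of "\<bar>tan \<theta>\<bar>"] by (intro mult_left_mono) auto
    also have "\<dots> < \<epsilon> * N" using that N by (intro mult_strict_right_mono) auto
    also have "\<dots> = a" using N by (simp add: \<epsilon>_def)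
    also have "a \<le> t" using True by simp
    finally show ?thesis by auto
  next
    case False
    with that z0[of t] show ?thesis by auto
  qed
  have z1: "Ck_real k z {0<..<1}" for k
  proof -
    have "Ck_real k (\<lambda>x. z x) {0<..<1}"
      by (rule Ck_real_compose[OF z Ck_real_ident]) auto
    then show ?thesis by simp
  qed
  have "smooth_on ({-\<epsilon><..<\<epsilon>} \<times> {0<..<1}) (\<lambda>(s, t). (t + s * ((- tan \<theta>) * z t), tan \<theta> * t + s * z t))"
  proof (rule smooth_on_subset)
    show "smooth_on (UNIV \<times> {0<..<1}) (\<lambda>(s, t). (t + s * ((- tan \<theta>) * z t), tan \<theta> * t + s * z t))"
      unfolding smooth_on_def
      by (intro allI Ck_on_affine_family open_greaterThanLessThan Ck_real_mult Ck_real_const Ck_real_ident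
          z1)
  qed auto
  note smooth = this
  show ?thesis unfolding compact_variation_def
  proof (rule exI[of _ \<epsilon>], rule exI[of _ a], rule exI[of _ b], intro conjI ballI impI)
    fix s t :: real assume st: "s \<in> {-\<epsilon><..<\<epsilon>}" "t \<in> {0<..1}"
    show "0 < fst (t + s * ((- tan \<theta>) * z t), tan \<theta> * t + s * z t)" using pos[OF st] by simp
    show "(t + s * ((- tan \<theta>) * z t), tan \<theta> * t + s * z t) = LOC_segment \<theta> t" if "t \<notin> {a..b}"
      using z0[OF _ that] st by (simp add: LOC_segment_def)
  qed (use ab \<epsilon> smooth in \<open>auto simp: LOC_segment_def\<close>)
qed

text \<open>
  The test function is the virtual extremal \<open>t\<close> to the power \<open>- m\<close> of Hardy's inequality, cut off by a
  bump \<open>B\<close> on the logarithmic scale \<open>u = - ln t / T\<close>. In \<open>u\<close> the form becomes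
  \<open>\<integral> B'\<^sup>2 / T - T (\<kappa> - m\<^sup>2) \<integral> B\<^sup>2\<close>, which is negative for large \<open>T\<close>.
\<close>

lemma LOC_unstable_if:
  assumes pn: "0 < p" "p < n" and lam: "0 < lam"
    and ang: "real (n - p) * (1 + lam\<^sup>2 * (tan \<theta>)\<^sup>2) = real p * (lam\<^sup>2 - 1)"
    and \<kappa>: "((real n - 1) / 2)\<^sup>2 < real n - 2 * (real n)\<^sup>2 / (real p * lam\<^sup>2)"
  shows "LOC_unstable n p lam \<theta>"
proof -
  define m where "m = (real n - 1) / 2"
  define K where "K = real n - 2 * (real n)\<^sup>2 / (real p * lam\<^sup>2)"
  have mK: "m\<^sup>2 < K" using \<kappa> by (simp add: m_def K_def)
  from smooth_bump_exists obtain B B' :: "real \<Rightarrow> real" where bump: "\<forall>k. Ck_real k B UNIV"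
    "\<forall>u. (B has_real_derivative B' u) (at u)" "continuous_on UNIV B'"
    "\<forall>u. u \<notin> {1<..<2} \<longrightarrow> B u = 0 \<and> B' u = 0" "\<forall>u\<in>{1<..<2}. 0 < B u"
    by blast
  note B = bump(1,2)[rule_format] bump(3) bump(4)[rule_format, THEN conjunct1]
    bump(4)[rule_format, THEN conjunct2] bump(5)[rule_format]
  have cB: "continuous_on S B" "continuous_on S B'" for S
    using B(1)[of 0] B(3) by (auto intro: continuous_on_subset)
  define \<alpha> where "\<alpha> = integral {1..2} (\<lambda>u. (B u)\<^sup>2)"
  define \<beta> where "\<beta> = integral {1..2} (\<lambda>u. (B' u)\<^sup>2)"
  have I\<alpha>: "((\<lambda>u. (B u)\<^sup>2) has_integral \<alpha>) {1..2}" and I\<beta>: "((\<lambda>u. (B' u)\<^sup>2) has_integral \<beta>) {1..2}"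
    unfolding \<alpha>_def \<beta>_def by (intro integrable_integral integrable_continuous_real continuous_intros cB)+
  have \<alpha>: "0 < \<alpha>"
  proof -
    have "0 \<le> \<alpha>" using I\<alpha> by (rule has_integral_nonneg) simp
    moreover have "\<alpha> \<noteq> 0"
    proof
      assume "\<alpha> = 0"
      then have "(B (3/2))\<^sup>2 = 0"
        using I\<alpha> has_integral_0_cbox_imp_0[of 1 2 "\<lambda>u. (B u)\<^sup>2" "3/2"]
        by (auto intro!: continuous_intros cB)
      with B(6)[of "3/2"] show False by simp
    qed
    ultimately show ?thesis by simp
  qed
  have \<beta>: "0 \<le> \<beta>" using I\<beta> by (rule has_integral_nonneg) simp
  have IBB': "((\<lambda>u. 2 * B u * B' u) has_integral 0) {1..2}"
  proof -
    have "((\<lambda>u. 2 * B u * B' u) has_integral ((B 2)\<^sup>2 - (B 1)\<^sup>2)) {1..2}"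
    proof (rule fundamental_theorem_of_calculus)
      fix u
      have "((\<lambda>u. (B u)\<^sup>2) has_real_derivative 2 * B u * B' u) (at u)"
        by (auto intro!: derivative_eq_intros B(2))
      then show "((\<lambda>u. (B u)\<^sup>2) has_vector_derivative 2 * B u * B' u) (at u within {1..2})"
        by (simp add: has_real_derivative_iff_has_vector_derivative has_vector_derivative_at_within)
    qed simp
    then show ?thesis using B(4)[of 1] B(4)[of 2] by simp
  qed
  \<comment> \<open>Just large enough for \<open>\<beta> / T^2 < (K - m^2) * \<alpha>\<close>; the
    added 1 makes this strict and T positive even if \<beta> = 0.\<close>
  define T where "T = sqrt (\<beta> / ((K - m\<^sup>2) * \<alpha>)) + 1"
  have T: "0 < T" using \<beta> \<alpha> mK by (auto simp: T_def intro!: add_nonneg_pos divide_nonneg_nonneg)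
  have T2: "\<beta> / T\<^sup>2 < (K - m\<^sup>2) * \<alpha>"
  proof -
    have "\<beta> / ((K - m\<^sup>2) * \<alpha>) = (sqrt (\<beta> / ((K - m\<^sup>2) * \<alpha>)))\<^sup>2" using \<beta> \<alpha> mK by simp
    also have "\<dots> < T\<^sup>2" using \<beta> \<alpha> mK by (intro power_strict_mono) (auto simp: T_def)
    finally show ?thesis using \<alpha> mK T by (simp add: field_simps)
  qed
  \<comment> \<open>The integrand in the variable u, up to the factor T that comes from dt / t = - T
    du. The cross term 2 B B' is a derivative and integrates to zero.\<close>
  define H where "H u = (m * B u + B' u / T)\<^sup>2 - K * (B u)\<^sup>2" for u
  have cH: "continuous_on S H" for S unfolding H_def[abs_def] using T by (intro continuous_intros cB) auto
  have H0: "H u = 0" if "u \<notin> {1<..<2}" for u using B(4,5)[OF that] by (simp add: H_def)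
  define h where "h = (m\<^sup>2 - K) * \<alpha> + m / T * 0 + (1 / T\<^sup>2) * \<beta>"
  have h: "h < 0" using T2 by (simp add: h_def algebra_simps)
  have IH: "(H has_integral h) {1..2}"
  proof -
    have "H = (\<lambda>u. (m\<^sup>2 - K) * (B u)\<^sup>2 + m / T * (2 * B u * B' u) + (1 / T\<^sup>2) * (B' u)\<^sup>2)"
      using T by (simp add: H_def fun_eq_iff power2_eq_square field_simps)
    moreover have "((\<lambda>u. (m\<^sup>2 - K) * (B u)\<^sup>2 + m / T * (2 * B u * B' u) + (1 / T\<^sup>2) * (B' u)\<^sup>2) has_integral
        h) {1..2}"
      unfolding h_def by (intro has_integral_add has_integral_mult_right I\<alpha> I\<beta> IBB')
    ultimately show ?thesis by simp
  qed

  define z where "z t = exp ((- m) * ln t) * B ((- 1 / T) * ln t)" for t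
  define z' where "z' t = - (exp ((- m) * ln t) / t) * (m * B ((- 1 / T) * ln t) + B' ((- 1 / T) * ln t) /
      T)" for t
  have Ckz: "Ck_real k z {0<..}" for k
    unfolding z_def[abs_def]
    by (intro Ck_real_mult Ck_real_compose[OF Ck_real_exp[of _ UNIV]] Ck_real_compose[OF B(1)]
        Ck_real_const Ck_real_ln) auto
  have dz: "(z has_real_derivative z' t) (at t)" if "0 < t" for t
  proof -
    have l: "((\<lambda>t. c * ln t) has_real_derivative c / t) (at t)" for c
      using that by (auto intro!: derivative_eq_intros)
    have "(z has_real_derivative exp ((- m) * ln t) * ((- m) / t) * B ((- 1 / T) * ln t)
        + B' ((- 1 / T) * ln t) * ((- 1 / T) / t) * exp ((- m) * ln t)) (at t)"
      unfolding z_def[abs_def]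
      by (intro DERIV_mult DERIV_chain2[OF DERIV_exp l] DERIV_chain2[OF B(2) l])
    then show ?thesis
      by (rule DERIV_cong) (use that T in \<open>simp add: z'_def field_simps\<close>)
  qed
  \<comment> \<open>The values of t at u = 2 and u = 1; u decreases in t, so the order is
    reversed.\<close>
  define A0 B0 where "A0 = exp (- 2 * T)" and "B0 = exp (- T)"
  have A0: "0 < A0" "A0 < B0" "B0 < 1" using T by (auto simp: A0_def B0_def)
  have lnA0: "u \<le> A0 \<longleftrightarrow> 2 \<le> (- 1 / T) * ln u" and lnB0: "B0 \<le> u \<longleftrightarrow> (- 1 / T) * ln u \<le> 1" if "0 < u" for u
  proof -
    have "u \<le> A0 \<longleftrightarrow> ln u \<le> - 2 * T" unfolding A0_def using that ln_le_cancel_iff[of u "exp (- 2 * T)"]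
        by simp
    then show "u \<le> A0 \<longleftrightarrow> 2 \<le> (- 1 / T) * ln u" using T by (auto simp: field_simps)
    have "B0 \<le> u \<longleftrightarrow> - T \<le> ln u" unfolding B0_def using that by (simp add: ln_ge_iff)
    then show "B0 \<le> u \<longleftrightarrow> (- 1 / T) * ln u \<le> 1" using T by (simp add: field_simps)
  qed
  have z0: "z t = 0" if "0 < t" "t \<notin> {A0..B0}" for t
  proof -
    have "(- 1 / T) * ln t \<notin> {1<..<2}" using that lnA0[of t] lnB0[of t] by auto
    then show ?thesis using B(4) by (simp add: z_def)
  qed
  define \<Gamma> where "\<Gamma> s t = (t + s * ((- tan \<theta>) * z t), tan \<theta> * t + s * z t)" for s t
  have cv: "compact_variation \<theta> \<Gamma>"
    unfolding \<Gamma>_def[abs_def] by (rule compact_variation_normal[OF A0 Ckz z0])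
  from second_variation_formula[OF cv pn lam ang] obtain a0 b0 w w' where ab0: "0 < a0" "a0 < b0" "b0 < 1"
    and w: "\<forall>t. 0 < t \<longrightarrow> t < 1 \<longrightarrow>
      ((\<lambda>s. snd (\<Gamma> s t) - tan \<theta> * fst (\<Gamma> s t)) has_real_derivative (1 + (tan \<theta>)\<^sup>2) * w t) (at 0)"
    and dw: "\<forall>t. 0 < t \<longrightarrow> t < 1 \<longrightarrow> (w has_real_derivative w' t) (at t)"
    and sv: "\<forall>a b. 0 < a \<longrightarrow> a < a0 \<longrightarrow> b0 < b \<longrightarrow> b < 1 \<longrightarrow> second_variation n p lam \<Gamma> =
      sphere_volume n * sqrt ((1 + lam\<^sup>2 * (tan \<theta>)\<^sup>2) ^ p * (1 + (tan \<theta>)\<^sup>2)) *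
      integral {a..b} (\<lambda>t. t ^ n * (w' t)\<^sup>2 - (real n - 2 * (real n)\<^sup>2 / (real p * lam\<^sup>2)) * (t ^ (n - 2) *
          (w t)\<^sup>2))"
    by blast
  have Q: "0 < 1 + (tan \<theta>)\<^sup>2" by (simp add: add_pos_nonneg)
  \<comment> \<open>The formula only supplies some w; uniqueness of the derivative at s = 0
    identifies it with the chosen z.\<close>
  have wz: "w t = z t" if "0 < t" "t < 1" for t
  proof -
    have "((\<lambda>s. snd (\<Gamma> s t) - tan \<theta> * fst (\<Gamma> s t)) has_real_derivative (1 + (tan \<theta>)\<^sup>2) * z t) (at 0)"
      unfolding \<Gamma>_def fst_conv snd_conv
      by (auto intro!: derivative_eq_intros simp: power2_eq_square algebra_simps)
    from DERIV_unique[OF w[rule_format, OF that] this] Q show ?thesis by simp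
  qed
  have w'z': "w' t = z' t" if "0 < t" "t < 1" for t
  proof -
    have "(w has_real_derivative z' t) (at t)"
      by (rule has_field_derivative_transform_within_open[OF dz, of _ "{0<..<1}"])
        (use that wz in auto)
    with dw[rule_format, OF that] show ?thesis by (rule DERIV_unique)
  qed
  \<comment> \<open>The window has to enclose both [a0, b0], of which the formula reveals nothing
    further, and the interval [A0, B0] that carries z.\<close>
  define a b where "a = min (a0 / 2) A0" and "b = max ((1 + b0) / 2) B0"
  have ab: "0 < a" "a < a0" "b0 < b" "b < 1" "a \<le> A0" "B0 \<le> b" "a < b"
    using ab0 A0 by (auto simp: a_def b_def min_def max_def)
  define lo hi where "lo = (- 1 / T) * ln b" and "hi = (- 1 / T) * ln a"
  have lohi: "lo \<le> 1" "2 \<le> hi" using lnA0[of a] lnB0[of b] ab A0 by (auto simp: lo_def hi_def)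
  define \<Phi> where "\<Phi> v = integral {lo..v} H" for v
  have d\<Phi>: "(\<Phi> has_real_derivative H v) (at v within {lo..hi})" if "v \<in> {lo..hi}" for v
    unfolding \<Phi>_def[abs_def] has_real_derivative_iff_has_vector_derivative
    by (rule integral_has_vector_derivative[OF cH that])
  \<comment> \<open>Since 2 m = n - 1, both t^n (t^(-m) / t)^2 and t^(n - 2) (t^(-m))^2 equal 1 /
    t.\<close>
  have dens: "t ^ n * (w' t)\<^sup>2 - K * (t ^ (n - 2) * (w t)\<^sup>2) = H ((- 1 / T) * ln t) / t" if t: "t \<in> {a..b}"
      for t
  proof -
    have t01: "0 < t" "t < 1" using t ab by auto
    have "2 \<le> n" using pn by simp
    then obtain k where k: "n = Suc (Suc k)" by (metis add_2_eq_Suc le_Suc_ex)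
    have "(exp ((- m) * ln t))\<^sup>2 = exp (- (real (Suc k) * ln t))"
      unfolding power2_eq_square exp_add[symmetric] by (rule arg_cong[where f = exp]) (simp add: m_def k
          field_simps)
    also have "\<dots> = inverse (t ^ Suc k)"
      using t01 by (simp only: exp_minus exp_of_nat_mult exp_ln)
    finally have e2: "(exp ((- m) * ln t))\<^sup>2 = inverse (t ^ Suc k)" .
    have "t ^ n * (w' t)\<^sup>2 - K * (t ^ (n - 2) * (w t)\<^sup>2)
        = t ^ k * (exp ((- m) * ln t))\<^sup>2 * H ((- 1 / T) * ln t)"
      unfolding wz[OF t01] w'z'[OF t01] z_def z'_def H_def k
      using t01 by (simp add: power_mult_distrib power_divide power2_eq_square) (simp add: field_simps)
    also have "\<dots> = H ((- 1 / T) * ln t) / t" unfolding e2 using t01 by (simp add: field_simps)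
    finally show ?thesis .
  qed
  \<comment> \<open>Substitution u = - ln t / T through the primitive \<Phi> of H; the factor - T
    compensates the inner derivative.\<close>
  have "((\<lambda>t. H ((- 1 / T) * ln t) / t) has_integral ((- T) * \<Phi> ((- 1 / T) * ln b) - (- T) * \<Phi> ((- 1 / T) *
      ln a))) {a..b}"
  proof (rule fundamental_theorem_of_calculus)
    fix t assume t: "t \<in> {a..b}"
    have t0: "0 < t" using t ab by auto
    have range: "(- 1 / T) * ln t \<in> {lo..hi}" if "t \<in> {a..b}" for t
      using that ab T by (auto simp: lo_def hi_def field_simps)
    have l: "((\<lambda>t. (- 1 / T) * ln t) has_real_derivative (- 1 / T) / t) (at t within {a..b})"
      using t0 T by (auto intro!: derivative_eq_intros)
    have "((\<lambda>t. \<Phi> ((- 1 / T) * ln t)) has_real_derivative H ((- 1 / T) * ln t) * ((- 1 / T) / t)) (at t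
        within {a..b})"
    proof -
      have "(\<Phi> has_real_derivative H ((- 1 / T) * ln t)) (at ((- 1 / T) * ln t) within (\<lambda>t. (- 1 / T) * ln
          t) ` {a..b})"
        by (rule DERIV_subset[OF d\<Phi>[OF range[OF t]]]) (use range in blast)
      from DERIV_image_chain[OF this l] show ?thesis by (simp add: o_def)
    qed
    from DERIV_cmult[OF this, of "- T"]
    show "((\<lambda>t. (- T) * \<Phi> ((- 1 / T) * ln t)) has_vector_derivative H ((- 1 / T) * ln t) / t) (at t within
        {a..b})"
      using T by (simp add: has_real_derivative_iff_has_vector_derivative[symmetric])
  qed (use ab in simp)
  then have "integral {a..b} (\<lambda>t. H ((- 1 / T) * ln t) / t) = T * \<Phi> hi - T * \<Phi> lo"
    by (simp add: integral_unique lo_def hi_def)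
  also have "\<Phi> lo = 0" by (simp add: \<Phi>_def)
  also have "\<Phi> hi = h"
  proof -
    have "(H has_integral h) {lo..hi}"
      by (rule has_integral_on_superset[OF IH]) (use lohi H0 in auto)
    then show ?thesis by (simp add: \<Phi>_def integral_unique)
  qed
  finally have "integral {a..b} (\<lambda>t. H ((- 1 / T) * ln t) / t) = T * h" by simp
  then have "integral {a..b} (\<lambda>t. t ^ n * (w' t)\<^sup>2 - K * (t ^ (n - 2) * (w t)\<^sup>2)) = T * h"
    using integral_cong[OF dens] by (rule trans[rotated])
  then have "second_variation n p lam \<Gamma> = sphere_volume n * sqrt ((1 + lam\<^sup>2 * (tan \<theta>)\<^sup>2) ^ p * (1 + (tan
      \<theta>)\<^sup>2)) * (T * h)"
    using sv[rule_format, OF ab(1-4)] by (simp add: K_def)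
  moreover have "0 < sphere_volume n * sqrt ((1 + lam\<^sup>2 * (tan \<theta>)\<^sup>2) ^ p * (1 + (tan \<theta>)\<^sup>2))"
    using sphere_volume_pos[of n] Q by (auto intro!: mult_pos_pos zero_less_power add_pos_nonneg)
  moreover have "T * h < 0" using T h by (rule mult_pos_neg)
  ultimately have "second_variation n p lam \<Gamma> < 0" by (metis mult_pos_neg)
  with cv show ?thesis unfolding LOC_unstable_def by blast
qed

text \<open>With p \<open>lam^2\<close> replaced by k (k + n - 1), Hardy's condition bounds k from
  above for n = 3 and n = 5 and always holds for n at least 7.\<close>

theorem theorem5p1:
  fixes f :: "'a::euclidean_space \<Rightarrow> 'b::euclidean_space"
    and n m p k :: nat and lam \<theta> :: real
  assumes "DIM('a) = n + 1" and "DIM('b) = m + 1"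
    and "LOMSE f"
    and "LOMSE_type f n p k lam"
    and "LOM_angle f \<theta>"
  shows "(LOC_stable n p lam \<theta> \<longleftrightarrow> Type_I n p k) \<and> (LOC_unstable n p lam \<theta> \<longleftrightarrow> Type_II n p k)"
proof -
  have f: "smooth_on_sphere f" "f ` sphere 0 1 \<subseteq> sphere 0 1" using assms(3)
      by (auto simp: LOMSE_def LOM_def)
  have lam: "0 < lam" and k: "0 < k" "even k"
    and sv: "\<And>x. norm x = 1 \<Longrightarrow> singular_values f x = {0, lam} \<and> dim (singular_space f x lam) = p"
    and sh: "\<And>b. b \<in> Basis \<Longrightarrow> spherical_harmonic k (\<lambda>x. f x \<bullet> b)"
    and hopf: "factors_through_Hopf f p lam"
    using assms(4) by (auto simp: LOMSE_type_def)
  obtain \<pi> :: "'a \<Rightarrow> 'a set" where "Hopf_fibration \<pi> p" using hopf by (auto simp: factors_through_Hopf_def)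
  then have np: "(n, p) = (3, 2) \<or> (n, p) = (5, 4) \<or> 7 \<le> n" and p: "0 < p"
    using Hopf_fibration_dims assms(1) by (auto simp: Hopf_fibration_def)
  obtain x :: 'a where x: "norm x = 1" using vector_choose_size[of 1] by auto
  then have x0: "x \<noteq> 0" by auto
  obtain B0 B1 where B: "finite B0" "finite B1" "B0 \<inter> B1 = {}" "B0 \<noteq> {}"
    "B0 \<subseteq> singular_space f x 0" "B1 \<subseteq> singular_space f x lam"
    "\<And>e. e \<in> B0 \<union> B1 \<Longrightarrow> norm e = 1"
    "pairwise orthogonal (B0 \<union> B1)" "span (B0 \<union> B1) = tangent_sphere x"
    "card B1 = dim (singular_space f x lam)" "card B0 + card B1 = DIM('a) - 1"
    using singular_frame[OF linear_sphere_diff[OF f(1) x0] x _ lam] sv[OF x] by blast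
  have "card B1 = p" using B(10) sv[OF x] by simp
  moreover have "card B0 + card B1 = n" using B(11) assms(1) by simp
  moreover have "0 < card B0" using B(1,4) by (simp add: card_gt_0_iff)
  ultimately have pn: "p < n" and card: "card B1 = p" "card B0 = n - p" by auto
  have ang: "real (n - p) * (1 + lam\<^sup>2 * (tan \<theta>)\<^sup>2) = real p * (lam\<^sup>2 - 1)"
    using LOM_angle_equation[OF f x assms(5) B(1-3,5-9)] card by simp
  have plam: "real p * lam\<^sup>2 = real k * (real k + real n - 1)"
    using LOMSE_eigenvalue_equation[OF f x sh k assms(1) B(1-3,5-9)] card by simp
  let ?crit = "real n - 2 * (real n)\<^sup>2 / (real p * lam\<^sup>2) \<le> ((real n - 1) / 2)\<^sup>2"
  have stable: "?crit \<Longrightarrow> LOC_stable n p lam \<theta>"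
    by (rule LOC_stable_if[OF p pn lam ang])
  have unstable: "\<not> ?crit \<Longrightarrow> LOC_unstable n p lam \<theta>"
    by (rule LOC_unstable_if[OF p pn lam ang]) simp
  \<comment> \<open>The two notions are complementary by definition, so the two implications above
    decide both equivalences.\<close>
  have dual: "LOC_unstable n p lam \<theta> \<longleftrightarrow> \<not> LOC_stable n p lam \<theta>"
    by (auto simp: LOC_unstable_def LOC_stable_def not_le)
  obtain j where j: "k = 2 * j" "0 < j" using k by (auto elim!: evenE)
  have types: "Type_I n p k \<longleftrightarrow> ?crit" "Type_II n p k \<longleftrightarrow> \<not> Type_I n p k"
  proof -
    consider "n = 3" "p = 2" | "n = 5" "p = 4" | "7 \<le> n" using np by auto
    then have "(Type_I n p k \<longleftrightarrow> ?crit) \<and> (Type_II n p k \<longleftrightarrow> \<not> Type_I n p k)"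
    proof cases
      case 1
      have X: "0 < real k * (real k + 2)" using k(1) by simp
      \<comment> \<open>Here 3 - 18 / (k (k + 2)) is compared with 1; k = 2, 4 give the products 8,
        24.\<close>
      have "?crit \<longleftrightarrow> 2 \<le> 18 / (real k * (real k + 2))"
        unfolding plam unfolding 1 by (simp add: power2_eq_square algebra_simps)
      also have "\<dots> \<longleftrightarrow> real k * (real k + 2) \<le> 9"
        unfolding pos_le_divide_eq[OF X] by auto
      also have "\<dots> \<longleftrightarrow> j = 1"
      proof
        assume le: "real k * (real k + 2) \<le> 9"
        show "j = 1"
        proof (rule ccontr)
          assume "j \<noteq> 1"
          then have "4 \<le> real k" using j by simp
          then have "4 * (4 + 2) \<le> real k * (real k + 2)" by (intro mult_mono) auto
          with le show False by simp
        qed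
      qed (simp add: j)
      finally show ?thesis using 1 j by (auto simp: Type_I_def Type_II_def)
    next
      case 2
      have X: "0 < real k * (real k + 4)" using k(1) by simp
      \<comment> \<open>Here 5 - 50 / (k (k + 4)) is compared with 4; k = 2, 4, 6 give the products
        12, 32, 60.\<close>
      have "?crit \<longleftrightarrow> 1 \<le> 50 / (real k * (real k + 4))"
        unfolding plam unfolding 2 by (simp add: power2_eq_square algebra_simps)
      also have "\<dots> \<longleftrightarrow> real k * (real k + 4) \<le> 50"
        unfolding pos_le_divide_eq[OF X] by auto
      also have "\<dots> \<longleftrightarrow> j = 1 \<or> j = 2"
      proof
        assume le: "real k * (real k + 4) \<le> 50"
        show "j = 1 \<or> j = 2"
        proof (rule ccontr)
          assume "\<not> (j = 1 \<or> j = 2)"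
          then have "6 \<le> real k" using j by simp
          then have "6 * (6 + 4) \<le> real k * (real k + 4)" by (intro mult_mono) auto
          with le show False by simp
        qed
      qed (auto simp: j)
      finally show ?thesis using 2 j by (auto simp: Type_I_def Type_II_def)
    next
      case 3
      have "real n - 2 * (real n)\<^sup>2 / (real p * lam\<^sup>2) \<le> real n" by simp
      also have "\<dots> \<le> ((real n - 1) / 2)\<^sup>2"
      proof -
        \<comment> \<open>The expression is n^2 - 6 n + 1, so n itself is already below Hardy's
          constant, whatever k is.\<close>
        have "0 \<le> (real n - 7) * (real n + 1) + 8" using 3 by simp
        then show ?thesis by (simp add: power2_eq_square field_simps)
      qed
      finally show ?thesis using 3 by (auto simp: Type_I_def Type_II_def)
    qed
    then show "Type_I n p k \<longleftrightarrow> ?crit" "Type_II n p k \<longleftrightarrow> \<not> Type_I n p k" by auto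
  qed
  show ?thesis using stable unstable dual types by blast
qed

end
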